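(* Let $G$ be a bipartite graph. Then the edge ring $\Bbbk[G]$ is pseudo-Gorenstein if and only if every block of $G$ is matching-covered.
   Context: All graphs are finite, with no loops and no multiple edges. $\Bbbk$ is an algebraically closed field of characteristic $0$. For a graph $G$ on vertex set $[d]=\{1,\ldots,d\}$ with edge set $E(G)$, the edge ring is $\Bbbk[G]=\Bbbk[t_it_j : \{i,j\}\in E(G)]\subset \Bbbk[t_1,\ldots,t_d]$, graded by $\deg(t_it_j)=1$ for every edge $\{i,j\}$. (For bipartite $G$ this ring is normal and Cohen--Macaulay.) For a Cohen--Macaulay standard graded domain $R=\bigoplus_{k\ge 0}R_k$ with $R_0=\Bbbk$ and Krull dimension $D$, write $\sum_{k\ge0}(\dim_\Bbbk R_k)t^k=\dfrac{h_0+h_1t+\cdots+h_st^s}{(1-t)^D}$ with $h_s\ne 0$. $R$ is called pseudo-Gorenstein if $h_s=1$. A connected graph is called 2-connected if deleting any one vertex leaves a connected graph; a block of $G$ is a maximal 2-connected subgraph of $G$ (so a bridge together with its two endpoints is a block). A graph is matching-covered if it is connected and each of its edges is contained in some perfect matching of it (so a block consisting of an isolated vertex is vacuously matching-covered). *)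

theory Defs
  imports
    "HOL-Library.Poly_Mapping"
    "HOL-Library.Extended_Nat"
    "HOL-Computational_Algebra.Polynomial_FPS"
    "HOL-Algebra.Generated_Rings"
    "HOL-Algebra.Algebraic_Closure_Type"
begin

section \<open>Simple graphs\<close>

record 'a graph =
  Verts :: "'a set"
  Edges :: "'a set set"

definition simple_graph :: "'a graph \<Rightarrow> bool" where
  "simple_graph G \<longleftrightarrow> finite (Verts G) \<and>
     (\<forall>e\<in>Edges G. \<exists>u\<in>Verts G. \<exists>v\<in>Verts G. u \<noteq> v \<and> e = {u, v})"

definition subgraph :: "'a graph \<Rightarrow> 'a graph \<Rightarrow> bool" where
  "subgraph H G \<longleftrightarrow> simple_graph H \<and> Verts H \<subseteq> Verts G \<and> Edges H \<subseteq> Edges G"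

definition delete_vertex :: "'a \<Rightarrow> 'a graph \<Rightarrow> 'a graph" where
  "delete_vertex v G = \<lparr>Verts = Verts G - {v}, Edges = {e \<in> Edges G. v \<notin> e}\<rparr>"

text \<open>The graph without vertices counts as connected.  Hence a single vertex is 2-connected, and an
  isolated vertex of a graph is one of its blocks.\<close>

definition connected_graph :: "'a graph \<Rightarrow> bool" where
  "connected_graph G \<longleftrightarrow>
     (\<forall>u\<in>Verts G. \<forall>v\<in>Verts G. (u, v) \<in> {(x, y). {x, y} \<in> Edges G}\<^sup>*)"

definition two_connected :: "'a graph \<Rightarrow> bool" where
  "two_connected G \<longleftrightarrow>
     connected_graph G \<and> (\<forall>v\<in>Verts G. connected_graph (delete_vertex v G))"

definition is_block :: "'a graph \<Rightarrow> 'a graph \<Rightarrow> bool" where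
  "is_block B G \<longleftrightarrow> subgraph B G \<and> two_connected B \<and>
     (\<forall>H. subgraph H G \<and> two_connected H \<and> subgraph B H \<longrightarrow> H = B)"

definition bipartite :: "'a graph \<Rightarrow> bool" where
  "bipartite G \<longleftrightarrow> (\<exists>A B. A \<union> B = Verts G \<and> A \<inter> B = {} \<and>
     (\<forall>e\<in>Edges G. \<exists>a\<in>A. \<exists>b\<in>B. e = {a, b}))"

definition perfect_matching :: "'a set set \<Rightarrow> 'a graph \<Rightarrow> bool" where
  "perfect_matching M G \<longleftrightarrow> M \<subseteq> Edges G \<and> (\<forall>v\<in>Verts G. \<exists>!e. e \<in> M \<and> v \<in> e)"

definition matching_covered :: "'a graph \<Rightarrow> bool" where
  "matching_covered G \<longleftrightarrow>
     connected_graph G \<and> (\<forall>e\<in>Edges G. \<exists>M. perfect_matching M G \<and> e \<in> M)"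

section \<open>Krull dimension and pseudo-Gorenstein graded algebras\<close>

definition krull_dim :: "('a, 'b) ring_scheme \<Rightarrow> enat" where
  "krull_dim R = Sup {enat n | n. \<exists>P :: nat \<Rightarrow> 'a set.
     (\<forall>i\<le>n. primeideal (P i) R) \<and> (\<forall>i<n. P i \<subset> P (Suc i))}"

definition hilbert_series :: "('k::field \<Rightarrow> 'a::ab_group_add \<Rightarrow> 'a) \<Rightarrow> (nat \<Rightarrow> 'a set) \<Rightarrow> rat fps"
  where "hilbert_series scale A = Abs_fps (\<lambda>k. of_nat (vector_space.dim scale (A k)))"

text \<open>The graded algebra is given by its scalar multiplication, its ring structure \<open>R\<close>
  and its homogeneous components \<open>A k\<close>.  The notion is meant for Cohen--Macaulay standard graded
  domains; these standing hypotheses are not part of the predicate.  Since \<open>h\<close> and \<open>D\<close> are uniquely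
  determined, the existential quantifiers only name them; \<open>lead_coeff h\<close> is the last nonzero
  coefficient of the numerator.\<close>

definition pseudo_Gorenstein ::
    "('k::field \<Rightarrow> 'a::ab_group_add \<Rightarrow> 'a) \<Rightarrow> 'a ring \<Rightarrow> (nat \<Rightarrow> 'a set) \<Rightarrow> bool" where
  "pseudo_Gorenstein scale R A \<longleftrightarrow>
     (\<exists>(h :: rat poly) D. krull_dim R = enat D \<and>
        hilbert_series scale A = fps_of_poly h / (1 - fps_X) ^ D \<and> lead_coeff h = 1)"

section \<open>Edge rings\<close>

text \<open>Polynomials over \<open>'k\<close> in variables indexed by \<open>'v\<close>: finitely supported functions from
  monomials (exponent vectors) to coefficients, with the convolution product.\<close>

type_synonym ('v, 'k) mpoly = "('v \<Rightarrow>\<^sub>0 nat) \<Rightarrow>\<^sub>0 'k"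

definition Const :: "'k::field \<Rightarrow> ('v, 'k) mpoly" where
  "Const c = Poly_Mapping.single 0 c"

definition Var :: "'v \<Rightarrow> ('v, 'k::field) mpoly" where
  "Var i = Poly_Mapping.single (Poly_Mapping.single i 1) 1"

definition mpoly_scale :: "'k::field \<Rightarrow> ('v, 'k) mpoly \<Rightarrow> ('v, 'k) mpoly" where
  "mpoly_scale c p = Const c * p"

lemma vector_space_mpoly_scale: "vector_space (mpoly_scale :: 'k::field \<Rightarrow> ('v, 'k) mpoly \<Rightarrow> _)"
  by unfold_locales
    (simp_all add: mpoly_scale_def Const_def algebra_simps single_add mult_single
      flip: mult.assoc)

definition edge_monomial :: "'v set \<Rightarrow> ('v, 'k::field) mpoly" where
  "edge_monomial e = (\<Prod>i\<in>e. Var i)"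

definition edge_ring :: "'v graph \<Rightarrow> ('v, 'k::field) mpoly ring" where
  "edge_ring G = ring_of_type_algebra
     \<lparr>carrier := generate_ring ring_of_type_algebra (range Const \<union> edge_monomial ` Edges G)\<rparr>"

text \<open>Every edge monomial has degree 1, so the component of degree \<open>k\<close> is spanned by the products
  of \<open>k\<close> edge monomials.\<close>

definition edge_ring_component :: "'v graph \<Rightarrow> nat \<Rightarrow> ('v, 'k::field) mpoly set" where
  "edge_ring_component G k = module.span mpoly_scale
     {\<Prod>i<k. edge_monomial (f i) | f. \<forall>i<k. f i \<in> Edges G}"

end

theory Submission
  imports Defs
begin

text \<open>Lattice points of the edge cone of a bipartite graph are flows modulo circulations.  A generic
  weight selects a standard representative in each class; the supports of standard representatives
  form a unimodular triangulation of the cone.  Perturbing the lattice points by a generic vector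
  makes the simplices of the triangulation half-open, so that they partition the lattice points, and
  perturbing in the opposite direction partitions the interior lattice points by the complementary
  half-open simplices.  Hence the leading coefficient of the numerator of the Hilbert series is the
  number of interior lattice points of least degree.

  A flow \<open>c\<close> is interior iff every edge on which it vanishes lies, in positive direction, on a cycle
  along which \<open>c\<close> can be augmented.  Since cycles lie in blocks, this can be checked block by block.
  In a matching-covered block the all-ones vector is the unique interior degree vector of least
  degree.  Conversely, if in a 2-connected block a least interior point had a vertex of degree at
  least 2, a unit of degree could be moved to another vertex of the same colour class.\<close>

section \<open>Circulations and elementary cycles\<close>

text \<open>Elementary cycles and cuts of a directed graph both have entries in {-1, 0, 1}. This
  replaces determinants throughout: cycles witness dependence, cuts act as dual functionals, and
  both are controlled by one positive weight \<open>q\<close> that is nonzero on every nonzero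
  ternary vector. As \<open>q\<close> pairs with a nonzero cut to a nonzero number of size at most
  \<open>sum q E\<close>, any scale \<open>N > sum q E\<close> suffices for perturbations, and all
  arithmetic stays in the integers. The leading coefficient counts as claimed because a simplex with
  r walls removed contributes X^r / (1 - X)^rank, while the complementary half-open simplex has a
  single lowest point, of degree rank - r; the largest r and the least interior degree belong
  together. \<open>pseudo_Gorenstein\<close> fixes the exponent of the denominator as the Krull
  dimension, so this must be shown to equal the common size of the maximal simplices. A map to
  Laurent polynomials gives a chain of primes of that length; conversely a chain of length n forces
  growth of order n, which the triangulation bounds.\<close>

lemma minimal_closed_subset:
  assumes "finite W" "W \<noteq> {}" "s ` W \<subseteq> W"
  obtains O' where "O' \<subseteq> W" "O' \<noteq> {}" "s ` O' = O'"
    "\<And>P. P \<subseteq> O' \<Longrightarrow> P \<noteq> {} \<Longrightarrow> s ` P \<subseteq> P \<Longrightarrow> P = O'"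
proof -
  \<comment> \<open>An invariant set of least cardinality is a single directed cycle in the graph of
    \<open>s\<close>.\<close>
  define Q where "Q P \<longleftrightarrow> P \<subseteq> W \<and> P \<noteq> {} \<and> s ` P \<subseteq> P" for P
  have "Q W" using assms by (simp add: Q_def)
  then obtain P where P: "Q P" and min: "\<And>R. Q R \<Longrightarrow> card P \<le> card R"
    using ex_has_least_nat[of Q W card] by blast
  have fin: "finite P" using P assms finite_subset Q_def by metis
  have least: "R = P" if "R \<subseteq> P" "R \<noteq> {}" "s ` R \<subseteq> R" for R
  proof -
    have "Q R" using that P by (auto simp: Q_def)
    with min have "card P \<le> card R" by blast
    with that fin show ?thesis by (simp add: card_seteq)
  qed
  have "s ` P = P" using P by (intro least) (auto simp: Q_def)
  then show thesis using that[of P] P least by (auto simp: Q_def)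
qed

text \<open>A superincreasing weight works: the element inserted last outweighs all earlier ones
  together, so a nonzero entry there decides the sum, and otherwise the earlier elements
  decide.\<close>

lemma signed_powers_of_two_nonzero:
  assumes "finite (E :: 'e set)"
  obtains q :: "'e \<Rightarrow> int" where "\<And>e. q e > 0"
    "\<And>\<phi>. (\<And>e. \<phi> e \<in> {-1, 0, 1}) \<Longrightarrow> \<exists>e\<in>E. \<phi> e \<noteq> 0 \<Longrightarrow> (\<Sum>e\<in>E. q e * \<phi> e) \<noteq> 0"
proof -
  have "\<exists>q :: 'e \<Rightarrow> int. (\<forall>e. q e > 0) \<and>
    (\<forall>\<phi>. (\<forall>e. \<phi> e \<in> {-1, 0, 1}) \<longrightarrow> (\<exists>e\<in>E. \<phi> e \<noteq> 0) \<longrightarrow> (\<Sum>e\<in>E. q e * \<phi> e) \<noteq> 0)"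
    using assms
  proof (induction E)
    case empty
    show ?case by (rule exI[of _ "\<lambda>_. 1"]) auto
  next
    case (insert a E)
    then obtain q :: "'e \<Rightarrow> int" where q: "\<And>e. q e > 0"
      "\<And>\<phi>. \<forall>e. \<phi> e \<in> {-1, 0, 1} \<Longrightarrow> (\<exists>e\<in>E. \<phi> e \<noteq> 0) \<Longrightarrow> (\<Sum>e\<in>E. q e * \<phi> e) \<noteq> 0"
      by blast
    define q' where "q' = q(a := 1 + sum q E)"
    have pos: "q' e > 0" for e
      using q(1) by (simp add: q'_def add_pos_nonneg less_imp_le sum_nonneg)
    have "(\<Sum>e\<in>insert a E. q' e * \<phi> e) \<noteq> 0"
      if t: "\<forall>e. \<phi> e \<in> {-1, 0, 1}" and nz: "\<exists>e\<in>insert a E. \<phi> e \<noteq> 0" for \<phi>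
    proof -
      have eq: "(\<Sum>e\<in>insert a E. q' e * \<phi> e) = (1 + sum q E) * \<phi> a + (\<Sum>e\<in>E. q e * \<phi> e)"
        using insert.hyps by (auto simp: q'_def intro!: sum.cong)
      have "\<bar>\<Sum>e\<in>E. q e * \<phi> e\<bar> \<le> (\<Sum>e\<in>E. \<bar>q e * \<phi> e\<bar>)" by (rule sum_abs)
      also have "\<dots> \<le> sum q E"
      proof (rule sum_mono)
        fix e show "\<bar>q e * \<phi> e\<bar> \<le> q e" using t[rule_format, of e] q(1)[of e] by auto
      qed
      finally have le: "\<bar>\<Sum>e\<in>E. q e * \<phi> e\<bar> \<le> sum q E" .
      consider "\<phi> a = 0" | "\<phi> a = 1" | "\<phi> a = -1" using t by auto
      then show ?thesis
      proof cases
        case 1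
        then show ?thesis using eq q(2)[OF t] nz by auto
      qed (use eq le in auto)
    qed
    then show ?case using pos by blast
  qed
  then show thesis using that by blast
qed

definition vec :: "'e set \<Rightarrow> ('e \<Rightarrow> int) set" where
  "vec S = {c. \<forall>e. e \<notin> S \<longrightarrow> c e = 0}"

definition supp :: "('e \<Rightarrow> int) \<Rightarrow> 'e set" where
  "supp c = {e. c e \<noteq> 0}"

definition ternary :: "('e \<Rightarrow> int) \<Rightarrow> bool" where
  "ternary c \<longleftrightarrow> (\<forall>e. c e \<in> {-1, 0, 1})"

lemma vec_mono: "S \<subseteq> T \<Longrightarrow> c \<in> vec S \<Longrightarrow> c \<in> vec T"
  by (auto simp: vec_def)

lemma vec_lincomb:
  "c \<in> vec S \<Longrightarrow> d \<in> vec S \<Longrightarrow> (\<lambda>e. x * c e + y * d e) \<in> vec S"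
  by (auto simp: vec_def)

lemma vec_iff_supp: "c \<in> vec S \<longleftrightarrow> supp c \<subseteq> S"
  by (auto simp: vec_def supp_def)

section \<open>Boundaries, circulations and cuts\<close>

locale flow_network =
  fixes E :: "'e set" and \<alpha> \<beta> :: "'e \<Rightarrow> 'v"
  assumes finite_E: "finite E"
begin

definition bd :: "('e \<Rightarrow> int) \<Rightarrow> 'v \<Rightarrow> int" where
  "bd c v = (\<Sum>e\<in>E. c e * (of_bool (\<alpha> e = v) - of_bool (\<beta> e = v)))"

definition circ :: "('e \<Rightarrow> int) set" where
  "circ = {k \<in> vec E. bd k = (\<lambda>_. 0)}"

definition cut :: "'v set \<Rightarrow> 'e \<Rightarrow> int" where
  "cut U e = of_bool (\<alpha> e \<in> U) - of_bool (\<beta> e \<in> U)"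

definition single_edge :: "'e \<Rightarrow> 'e \<Rightarrow> int" where
  "single_edge e = (\<lambda>f. of_bool (f = e))"

lemma bd_lincomb: "bd (\<lambda>e. x * c e + y * d e) = (\<lambda>v. x * bd c v + y * bd d v)"
  by (simp add: bd_def fun_eq_iff sum_distrib_left flip: sum.distrib) (simp add: algebra_simps)

lemma bd_add: "bd (\<lambda>e. c e + d e) = (\<lambda>v. bd c v + bd d v)"
  using bd_lincomb[of 1 c 1 d] by simp

lemma bd_diff: "bd (\<lambda>e. c e - d e) = (\<lambda>v. bd c v - bd d v)"
  using bd_lincomb[of 1 c "-1" d] by simp

lemma bd_scale: "bd (\<lambda>e. x * c e) = (\<lambda>v. x * bd c v)"
  using bd_lincomb[of x c 0 c] by simp

lemma bd_minus: "bd (\<lambda>e. - c e) = (\<lambda>v. - bd c v)"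
  using bd_scale[of "-1" c] by simp

lemma bd_zero: "bd (\<lambda>e. 0) = (\<lambda>v. 0)"
  by (simp add: bd_def fun_eq_iff)

lemma bd_sum: "bd (\<lambda>e. \<Sum>i\<in>I. c i e) = (\<lambda>v. \<Sum>i\<in>I. bd (c i) v)"
  by (induction I rule: infinite_finite_induct) (simp_all add: bd_zero bd_add)

lemma bd_single_edge:
  "e \<in> E \<Longrightarrow> bd (single_edge e) v = of_bool (\<alpha> e = v) - of_bool (\<beta> e = v)"
  by (simp add: bd_def single_edge_def sum.remove[OF finite_E, of e])

lemma circ_add: "k \<in> circ \<Longrightarrow> l \<in> circ \<Longrightarrow> (\<lambda>e. k e + l e) \<in> circ"
  by (auto simp: circ_def vec_def bd_add)

lemma circ_diff: "k \<in> circ \<Longrightarrow> l \<in> circ \<Longrightarrow> (\<lambda>e. k e - l e) \<in> circ"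
  by (auto simp: circ_def vec_def bd_diff)

lemma circ_scale: "k \<in> circ \<Longrightarrow> (\<lambda>e. x * k e) \<in> circ"
  by (auto simp: circ_def vec_def bd_scale)

lemma circ_minus: "k \<in> circ \<Longrightarrow> (\<lambda>e. - k e) \<in> circ"
  by (auto simp: circ_def vec_def bd_minus)

lemma circ_zero: "(\<lambda>e. 0) \<in> circ"
  by (auto simp: circ_def vec_def bd_zero)

lemma circ_sum: "(\<And>i. i \<in> I \<Longrightarrow> k i \<in> circ) \<Longrightarrow> (\<lambda>e. \<Sum>i\<in>I. k i e) \<in> circ"
  by (induction I rule: infinite_finite_induct) (simp_all add: circ_zero circ_add)

lemma circ_diffI: "c \<in> vec E \<Longrightarrow> d \<in> vec E \<Longrightarrow> bd c = bd d \<Longrightarrow> (\<lambda>e. c e - d e) \<in> circ"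
  by (auto simp: circ_def vec_def bd_diff)

lemma cut_ternary: "cut U e \<in> {-1, 0, 1}"
  by (auto simp: cut_def)

text \<open>Summation by parts: pairing with a cut sees only the boundary, so cuts are linear
  functionals on flows modulo circulations. Intersecting with the set of end points keeps the sum
  finite for arbitrary \<open>U\<close>.\<close>

lemma sum_cut: "(\<Sum>e\<in>E. c e * cut U e) = (\<Sum>v\<in>U \<inter> (\<alpha> ` E \<union> \<beta> ` E). bd c v)"
proof -
  let ?Y = "U \<inter> (\<alpha> ` E \<union> \<beta> ` E)"
  have fin: "finite ?Y" using finite_E by simp
  have "(\<Sum>v\<in>?Y. bd c v) =
      (\<Sum>e\<in>E. \<Sum>v\<in>?Y. c e * (of_bool (\<alpha> e = v) - of_bool (\<beta> e = v)))"
    unfolding bd_def by (rule sum.swap)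
  also have "\<dots> = (\<Sum>e\<in>E. c e * cut U e)"
  proof (rule sum.cong[OF refl])
    fix e assume e: "e \<in> E"
    have "(\<Sum>v\<in>?Y. of_bool (\<alpha> e = v) :: int) = of_bool (\<alpha> e \<in> U)"
      using fin e by (simp add: of_bool_def)
    moreover have "(\<Sum>v\<in>?Y. of_bool (\<beta> e = v) :: int) = of_bool (\<beta> e \<in> U)"
      using fin e by (simp add: of_bool_def)
    ultimately show "(\<Sum>v\<in>?Y. c e * (of_bool (\<alpha> e = v) - of_bool (\<beta> e = v))) = c e * cut U e"
      by (simp add: cut_def sum_subtractf flip: sum_distrib_left)
  qed
  finally show ?thesis by simp
qed

lemma sum_cut_cong: "bd c = bd d \<Longrightarrow> (\<Sum>e\<in>E. c e * cut U e) = (\<Sum>e\<in>E. d e * cut U e)"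
  by (simp add: sum_cut)

text \<open>Either a path in \<open>S\<close> joins the ends of \<open>e\<close>, or the component
  of \<open>\<alpha> e\<close> under \<open>S\<close> is a cut crossed by \<open>e\<close> and by no
  edge of \<open>S\<close>. This integral duality stands in for choosing a linear functional that
  vanishes on \<open>S\<close> but not on \<open>e\<close>.\<close>

lemma span_or_cut:
  assumes "e \<in> E" "S \<subseteq> E"
  obtains (span) k where "k \<in> vec S" "bd k = bd (single_edge e)"
  | (cut) U where "\<And>f. f \<in> S \<Longrightarrow> cut U f = 0" "cut U e \<noteq> 0"
proof -
  define r where "r = {(u, v). \<exists>f\<in>S. (\<alpha> f = u \<and> \<beta> f = v) \<or> (\<alpha> f = v \<and> \<beta> f = u)}"
  have path: "\<exists>k\<in>vec S. bd k = (\<lambda>w. of_bool (u = w) - of_bool (v = w))" if "(u, v) \<in> r\<^sup>*" for u v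
    using that
  proof (induction rule: rtrancl_induct)
    case base
    show ?case by (rule bexI[of _ "\<lambda>_. 0"]) (auto simp: bd_zero vec_def)
  next
    case (step v w)
    then obtain k where k: "k \<in> vec S" "bd k = (\<lambda>w. of_bool (u = w) - of_bool (v = w))" by blast
    from step obtain f where f: "f \<in> S" "(\<alpha> f = v \<and> \<beta> f = w) \<or> (\<alpha> f = w \<and> \<beta> f = v)"
      by (auto simp: r_def)
    define x :: int where "x = (if \<alpha> f = v \<and> \<beta> f = w then 1 else -1)"
    have fE: "f \<in> E" using f assms by blast
    have "single_edge f \<in> vec S" using f by (auto simp: vec_def single_edge_def)
    then have "(\<lambda>e. 1 * k e + x * single_edge f e) \<in> vec S" using k by (intro vec_lincomb)
    moreover have "bd (\<lambda>e. 1 * k e + x * single_edge f e) = (\<lambda>z. of_bool (u = z) - of_bool (w = z))"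
      unfolding bd_lincomb using f k(2) by (auto simp: bd_single_edge[OF fE] x_def)
    ultimately show ?case by blast
  qed
  define U where "U = {v. (\<alpha> e, v) \<in> r\<^sup>*}"
  show thesis
  proof (cases "\<beta> e \<in> U")
    case True
    then obtain k where "k \<in> vec S" "bd k = (\<lambda>w. of_bool (\<alpha> e = w) - of_bool (\<beta> e = w))"
      using path[of "\<alpha> e" "\<beta> e"] by (auto simp: U_def)
    then show ?thesis using bd_single_edge[OF assms(1)] by (intro span[of k]) auto
  next
    case False
    have "\<alpha> f \<in> U \<longleftrightarrow> \<beta> f \<in> U" if "f \<in> S" for f
    proof -
      have "(\<alpha> f, \<beta> f) \<in> r" "(\<beta> f, \<alpha> f) \<in> r" using that by (auto simp: r_def)
      then show ?thesis by (auto simp: U_def intro: rtrancl_into_rtrancl)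
    qed
    moreover have "\<alpha> e \<in> U" by (simp add: U_def)
    ultimately show ?thesis using False by (intro cut[of U]) (auto simp: cut_def)
  qed
qed

text \<open>Orient each edge in the support of a circulation by the sign of its coefficient: every vertex
  with an outgoing arc is followed by another one, so successors can be iterated, and a minimal
  invariant set of vertices carries an elementary cycle.\<close>

lemma conformal_cycle:
  assumes k: "k \<in> circ" "k \<noteq> (\<lambda>_. 0)"
  obtains \<kappa> C s \<epsilon> where "\<kappa> \<in> circ" "ternary \<kappa>" "\<kappa> \<noteq> (\<lambda>_. 0)"
    "\<And>e. \<kappa> e = 1 \<Longrightarrow> k e > 0" "\<And>e. \<kappa> e = -1 \<Longrightarrow> k e < 0"
    "C \<noteq> {}" "finite C" "s ` C = C" "\<And>P. P \<subseteq> C \<Longrightarrow> P \<noteq> {} \<Longrightarrow> s ` P \<subseteq> P \<Longrightarrow> P = C"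
    "supp \<kappa> = \<epsilon> ` C" "\<And>u. u \<in> C \<Longrightarrow> \<epsilon> u \<in> E \<and> {\<alpha> (\<epsilon> u), \<beta> (\<epsilon> u)} = {u, s u}"
proof -
  define hd where "hd e = (if k e > 0 then \<beta> e else \<alpha> e)" for e
  define tl where "tl e = (if k e > 0 then \<alpha> e else \<beta> e)" for e
  have bdk: "bd k v = (\<Sum>e\<in>E. \<bar>k e\<bar> * (of_bool (tl e = v) - of_bool (hd e = v)))" for v
    unfolding bd_def by (rule sum.cong) (auto simp: hd_def tl_def)
  define W where "W = tl ` {e \<in> E. k e \<noteq> 0}"
  have finW: "finite W" using finite_E by (simp add: W_def)
  have W_ne: "W \<noteq> {}" using k by (auto simp: W_def circ_def vec_def fun_eq_iff)
  \<comment> \<open>Conservation at \<open>hd e\<close>: if no arc left this vertex, it would only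
    receive, and the boundary there would be negative.\<close>
  have hdW: "hd e \<in> W" if e: "e \<in> E" "k e \<noteq> 0" for e
  proof (rule ccontr)
    assume "hd e \<notin> W"
    then have no: "\<not> (tl f = hd e)" if "f \<in> E" "k f \<noteq> 0" for f using that by (force simp: W_def)
    have "bd k (hd e) = - (\<Sum>f\<in>E. \<bar>k f\<bar> * of_bool (hd f = hd e))"
      unfolding bdk sum_negf[symmetric]
    proof (rule sum.cong[OF refl])
      fix f assume "f \<in> E"
      with no[of f] show "\<bar>k f\<bar> * (of_bool (tl f = hd e) - of_bool (hd f = hd e)) =
          - (\<bar>k f\<bar> * of_bool (hd f = hd e))" by (cases "k f = 0") auto
    qed
    moreover have "(\<Sum>f\<in>E. \<bar>k f\<bar> * of_bool (hd f = hd e)) > 0"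
      using e finite_E by (intro sum_pos2[of E e]) auto
    ultimately show False using k by (simp add: circ_def)
  qed
  define \<epsilon> where "\<epsilon> v = (SOME e. e \<in> E \<and> k e \<noteq> 0 \<and> tl e = v)" for v
  have \<epsilon>: "\<epsilon> v \<in> E" "k (\<epsilon> v) \<noteq> 0" "tl (\<epsilon> v) = v" if "v \<in> W" for v
  proof -
    have "\<exists>e. e \<in> E \<and> k e \<noteq> 0 \<and> tl e = v" using that by (auto simp: W_def)
    from someI_ex[OF this] show "\<epsilon> v \<in> E" "k (\<epsilon> v) \<noteq> 0" "tl (\<epsilon> v) = v" by (auto simp: \<epsilon>_def)
  qed
  define s where "s v = hd (\<epsilon> v)" for v
  have "s ` W \<subseteq> W" using \<epsilon> hdW by (auto simp: s_def)
  from minimal_closed_subset[OF finW W_ne this]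
  obtain C where C: "C \<subseteq> W" "C \<noteq> {}" "s ` C = C"
    and Cmin: "\<And>P. P \<subseteq> C \<Longrightarrow> P \<noteq> {} \<Longrightarrow> s ` P \<subseteq> P \<Longrightarrow> P = C" by blast
  have finC: "finite C" using C finW finite_subset by blast
  \<comment> \<open>A surjection of a finite set permutes it, so tails and heads cancel in the
    boundary of \<open>\<kappa>\<close>.\<close>
  have injs: "inj_on s C" using C finC by (simp add: eq_card_imp_inj_on)
  define \<kappa> where "\<kappa> e = (if e \<in> \<epsilon> ` C then sgn (k e) else 0)" for e
  have inj\<epsilon>: "inj_on \<epsilon> C" using \<epsilon>(3) C by (metis inj_on_inverseI subsetD)
  have "bd \<kappa> v = 0" for v
  proof -
    have "bd \<kappa> v = (\<Sum>e\<in>\<epsilon> ` C. \<kappa> e * (of_bool (\<alpha> e = v) - of_bool (\<beta> e = v)))"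
      unfolding bd_def using finite_E C \<epsilon> by (intro sum.mono_neutral_right) (auto simp: \<kappa>_def)
    also have "\<dots> = (\<Sum>u\<in>C. \<kappa> (\<epsilon> u) * (of_bool (\<alpha> (\<epsilon> u) = v) - of_bool (\<beta> (\<epsilon> u) = v)))"
      using inj\<epsilon> by (simp add: sum.reindex)
    also have "\<dots> = (\<Sum>u\<in>C. of_bool (u = v) - of_bool (s u = v))"
    proof (rule sum.cong[OF refl])
      fix u assume "u \<in> C"
      with \<epsilon>[of u] C show "\<kappa> (\<epsilon> u) * (of_bool (\<alpha> (\<epsilon> u) = v) - of_bool (\<beta> (\<epsilon> u) = v)) =
          (of_bool (u = v) - of_bool (s u = v))"
        by (auto simp: \<kappa>_def s_def hd_def tl_def sgn_if split: if_splits)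
    qed
    also have "\<dots> = (\<Sum>u\<in>C. of_bool (u = v)) - (\<Sum>u\<in>s ` C. of_bool (u = v))"
      by (simp add: sum_subtractf sum.reindex[OF injs])
    also have "\<dots> = 0" by (simp add: C)
    finally show ?thesis .
  qed
  then have circ: "\<kappa> \<in> circ" using \<epsilon> C by (auto simp: circ_def vec_def \<kappa>_def)
  have supp: "supp \<kappa> = \<epsilon> ` C" using \<epsilon> C by (auto simp: supp_def \<kappa>_def sgn_if)
  show thesis
  proof (rule that[OF circ _ _ _ _ C(2) finC C(3) Cmin supp])
    show "ternary \<kappa>" by (auto simp: ternary_def \<kappa>_def sgn_if)
    show "\<kappa> \<noteq> (\<lambda>_. 0)" using supp C by (auto simp: supp_def fun_eq_iff)
    show "k e > 0" if "\<kappa> e = 1" for e using that by (auto simp: \<kappa>_def sgn_if split: if_splits)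
    show "k e < 0" if "\<kappa> e = -1" for e using that by (auto simp: \<kappa>_def sgn_if split: if_splits)
    show "\<epsilon> u \<in> E \<and> {\<alpha> (\<epsilon> u), \<beta> (\<epsilon> u)} = {u, s u}" if "u \<in> C" for u
      using that \<epsilon>[of u] C by (auto simp: s_def hd_def tl_def split: if_splits)
  qed
qed

lemma conformal_ternary:
  assumes "k \<in> circ" "k \<noteq> (\<lambda>_. 0)"
  obtains \<kappa> where "\<kappa> \<in> circ" "ternary \<kappa>" "\<kappa> \<noteq> (\<lambda>_. 0)"
    "\<And>e. \<kappa> e = 1 \<Longrightarrow> k e > 0" "\<And>e. \<kappa> e = -1 \<Longrightarrow> k e < 0"
  using conformal_cycle[OF assms] by metis

text \<open>The decreasing measure for arguments that peel conformal ternary circulations off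
  \<open>k\<close> one at a time.\<close>

lemma sum_abs_conformal_less:
  assumes "k \<in> circ" "\<kappa> \<in> circ" "ternary \<kappa>" "\<kappa> \<noteq> (\<lambda>_. 0)"
    "\<And>e. \<kappa> e = 1 \<Longrightarrow> k e > 0" "\<And>e. \<kappa> e = -1 \<Longrightarrow> k e < 0"
  shows "(\<Sum>e\<in>E. \<bar>k e - \<kappa> e\<bar>) < (\<Sum>e\<in>E. \<bar>k e\<bar>)"
proof (rule sum_strict_mono_ex1[OF finite_E])
  have le: "\<bar>k e - \<kappa> e\<bar> \<le> \<bar>k e\<bar> \<and> (\<kappa> e \<noteq> 0 \<longrightarrow> \<bar>k e - \<kappa> e\<bar> < \<bar>k e\<bar>)" for e
  proof -
    have "\<kappa> e \<in> {-1, 0, 1}" using assms(3) by (auto simp: ternary_def)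
    with assms(5,6)[of e] show ?thesis by auto
  qed
  show "\<forall>e\<in>E. \<bar>k e - \<kappa> e\<bar> \<le> \<bar>k e\<bar>" using le by blast
  obtain e where "\<kappa> e \<noteq> 0" using assms(4) by blast
  then show "\<exists>e\<in>E. \<bar>k e - \<kappa> e\<bar> < \<bar>k e\<bar>" using le assms(2) by (auto simp: circ_def vec_def)
qed

text \<open>Peel off conformal ternary circulations until one passes through \<open>e\<close>. Those
  that miss \<open>e\<close> leave \<open>k e\<close> unchanged, and the remainder never has a sign
  opposite to that of \<open>k\<close>, so a circulation conformal to the remainder is conformal to
  \<open>k\<close>.\<close>

lemma conformal_ternary_through:
  assumes "k \<in> circ" "k e > 0"
  obtains \<kappa> where "\<kappa> \<in> circ" "ternary \<kappa>" "\<kappa> e = 1"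
    "\<And>e. \<kappa> e = 1 \<Longrightarrow> k e > 0" "\<And>e. \<kappa> e = -1 \<Longrightarrow> k e < 0"
proof -
  have "\<exists>\<kappa>. \<kappa> \<in> circ \<and> ternary \<kappa> \<and> \<kappa> e = 1 \<and> (\<forall>e. \<kappa> e = 1 \<longrightarrow> k e > 0) \<and> (\<forall>e. \<kappa> e = -1 \<longrightarrow> k e < 0)"
    using assms
  proof (induction "nat (\<Sum>e\<in>E. \<bar>k e\<bar>)" arbitrary: k rule: less_induct)
    case less
    have "k \<noteq> (\<lambda>_. 0)" using less.prems by auto
    from conformal_ternary[OF less.prems(1) this] obtain \<kappa> where \<kappa>: "\<kappa> \<in> circ" "ternary \<kappa>" "\<kappa> \<noteq> (\<lambda>_. 0)"
      "\<And>e. \<kappa> e = 1 \<Longrightarrow> k e > 0" "\<And>e. \<kappa> e = -1 \<Longrightarrow> k e < 0" by blast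
    show ?case
    proof (cases "\<kappa> e = 1")
      case True
      then show ?thesis using \<kappa> by blast
    next
      case False
      then have "\<kappa> e = 0" using \<kappa>(2) \<kappa>(5)[of e] less.prems by (auto simp: ternary_def)
      define k' where "k' = (\<lambda>e. k e - \<kappa> e)"
      have "nat (\<Sum>e\<in>E. \<bar>k' e\<bar>) < nat (\<Sum>e\<in>E. \<bar>k e\<bar>)"
        using sum_abs_conformal_less[OF less.prems(1) \<kappa>] by (subst nat_less_eq_zless) (auto simp: k'_def intro: sum_nonneg)
      moreover have "k' \<in> circ" using less.prems \<kappa> by (simp add: k'_def circ_diff)
      moreover have "k' e > 0" using less.prems \<open>\<kappa> e = 0\<close> by (simp add: k'_def)
      ultimately obtain l where l: "l \<in> circ" "ternary l" "l e = 1"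
        "\<And>e. l e = 1 \<Longrightarrow> k' e > 0" "\<And>e. l e = -1 \<Longrightarrow> k' e < 0"
        using less.hyps[of k'] by blast
      have "k f > 0" if "k' f > 0" for f
        using that \<kappa>(2)[unfolded ternary_def, rule_format, of f] \<kappa>(4,5)[of f]
        by (auto simp: k'_def)
      moreover have "k f < 0" if "k' f < 0" for f
        using that \<kappa>(2)[unfolded ternary_def, rule_format, of f] \<kappa>(4,5)[of f]
        by (auto simp: k'_def)
      ultimately show ?thesis using l by blast
    qed
  qed
  then show thesis using that by blast
qed

end

section \<open>A half-open triangulation of the cone\<close>

lemma ternary_nonzero_cases: "ternary \<kappa> \<Longrightarrow> \<kappa> e = 1 \<or> \<kappa> e = -1 \<or> \<kappa> e = 0"
  by (auto simp: ternary_def)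

definition effective_vec :: "'e set \<Rightarrow> ('e \<Rightarrow> int) set" where
  "effective_vec S = {c \<in> vec S. \<forall>e. c e \<ge> 0}"

locale weighted_network = flow_network E \<alpha> \<beta> for E :: "'e set" and \<alpha> \<beta> :: "'e \<Rightarrow> 'v" +
  fixes q :: "'e \<Rightarrow> int"
  assumes bipartite_ends: "\<alpha> ` E \<inter> \<beta> ` E = {}"
    and q_pos: "\<And>e. q e > 0"
    and q_generic: "\<And>\<phi>. (\<And>e. \<phi> e \<in> {-1, 0, 1}) \<Longrightarrow> \<exists>e\<in>E. \<phi> e \<noteq> 0 \<Longrightarrow> (\<Sum>e\<in>E. q e * \<phi> e) \<noteq> 0"
begin

text \<open>The condition says that trading the positive part of a ternary circulation supported in
  \<open>S\<close> for its negative part always raises the cost \<open>q\<close>. The faces form the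
  simplicial complex of a squarefree initial ideal of the toric ideal.\<close>

definition face :: "'e set \<Rightarrow> bool" where
  "face S \<longleftrightarrow> S \<subseteq> E \<and> (\<forall>\<kappa>\<in>circ. ternary \<kappa> \<and> \<kappa> \<noteq> (\<lambda>_. 0) \<and> (\<forall>e. \<kappa> e = 1 \<longrightarrow> e \<in> S) \<longrightarrow>
     (\<Sum>e\<in>E. q e * \<kappa> e) < 0)"

definition standard :: "('e \<Rightarrow> int) set" where
  "standard = {c \<in> effective_vec E. face (supp c)}"

text \<open>Spanning is required over the integers. Together with \<open>face_independent\<close>
  this makes \<open>T\<close> a lattice basis, so unimodularity is part of the notion.\<close>

definition facet :: "'e set \<Rightarrow> bool" where
  "facet T \<longleftrightarrow> face T \<and> (\<forall>e\<in>E. \<exists>k\<in>vec T. bd k = bd (single_edge e))"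

text \<open>Every edge crosses from the tail class to the head class, so the total of a flow is its
  pairing with a cut.\<close>

lemma sum_cong_bd:
  assumes "bd c = bd d"
  shows "sum c E = sum d E"
proof -
  have "cut (\<alpha> ` E) e = 1" if "e \<in> E" for e
    using that bipartite_ends by (auto simp: cut_def disjoint_iff)
  then show ?thesis using sum_cut_cong[OF assms, of "\<alpha> ` E"] by simp
qed

lemma face_subset: "face T \<Longrightarrow> S \<subseteq> T \<Longrightarrow> face S"
  by (auto simp: face_def) blast

text \<open>A ternary circulation conformal to \<open>c - d\<close> has its positive part in
  \<open>supp c\<close>, and its negative has its positive part in \<open>supp d\<close>. If both
  supports are faces, it and its negative both have negative cost.\<close>

lemma face_unique:
  assumes "c \<in> effective_vec E" "d \<in> effective_vec E" "bd c = bd d" "face (supp c)" "face (supp d)"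
  shows "c = d"
proof (rule ccontr)
  assume "c \<noteq> d"
  define k where "k = (\<lambda>e. c e - d e)"
  have "k \<in> circ" using assms by (auto simp: k_def effective_vec_def intro: circ_diffI)
  moreover have "k \<noteq> (\<lambda>_. 0)" using \<open>c \<noteq> d\<close> by (auto simp: k_def fun_eq_iff)
  ultimately obtain \<kappa> where \<kappa>: "\<kappa> \<in> circ" "ternary \<kappa>" "\<kappa> \<noteq> (\<lambda>_. 0)"
    "\<And>e. \<kappa> e = 1 \<Longrightarrow> k e > 0" "\<And>e. \<kappa> e = -1 \<Longrightarrow> k e < 0"
    using conformal_ternary by blast
  have nn: "c e \<ge> 0" "d e \<ge> 0" for e using assms by (auto simp: effective_vec_def)
  have "e \<in> supp c" if "\<kappa> e = 1" for e
    using \<kappa>(4)[OF that] nn[of e] by (auto simp: supp_def k_def)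
  then have "(\<Sum>e\<in>E. q e * \<kappa> e) < 0" using assms(4) \<kappa> by (auto simp: face_def)
  moreover have "e \<in> supp d" if "- \<kappa> e = 1" for e
    using \<kappa>(5)[of e] that nn[of e] by (auto simp: supp_def k_def)
  moreover have "ternary (\<lambda>e. - \<kappa> e)" "(\<lambda>e. - \<kappa> e) \<noteq> (\<lambda>_. 0)"
    using \<kappa> by (auto simp: ternary_def fun_eq_iff)
  ultimately have "(\<Sum>e\<in>E. q e * \<kappa> e) < 0 \<and> (\<Sum>e\<in>E. q e * (- \<kappa> e)) < 0"
    using assms(5) circ_minus[OF \<kappa>(1)] unfolding face_def by blast
  then show False by (auto simp: sum_negf)
qed

lemma standard_unique:
  "c \<in> standard \<Longrightarrow> d \<in> standard \<Longrightarrow> bd c = bd d \<Longrightarrow> c = d"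
  by (auto simp: standard_def intro: face_unique)

text \<open>Take the cheapest representative: if its support were not a face, subtracting a ternary
  circulation of positive cost would keep it nonnegative and make it cheaper.\<close>

lemma standard_exists:
  assumes "c \<in> effective_vec E"
  obtains d where "d \<in> standard" "bd d = bd c"
proof -
  define Q where "Q d \<longleftrightarrow> d \<in> effective_vec E \<and> bd d = bd c" for d
  define m where "m d = nat (\<Sum>e\<in>E. q e * d e)" for d :: "'e \<Rightarrow> int"
  have "Q c" using assms by (simp add: Q_def)
  then obtain d where d: "Q d" and min: "\<And>d'. Q d' \<Longrightarrow> m d \<le> m d'"
    using ex_has_least_nat[of Q c m] by blast
  have dnn: "d e \<ge> 0" for e using d by (auto simp: Q_def effective_vec_def)
  have "face (supp d)"
    unfolding face_def
  proof (intro conjI ballI impI)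
    show "supp d \<subseteq> E" using d by (auto simp: Q_def effective_vec_def vec_def supp_def)
    fix \<kappa> assume \<kappa>: "\<kappa> \<in> circ" "ternary \<kappa> \<and> \<kappa> \<noteq> (\<lambda>_. 0) \<and> (\<forall>e. \<kappa> e = 1 \<longrightarrow> e \<in> supp d)"
    show "(\<Sum>e\<in>E. q e * \<kappa> e) < 0"
    proof (rule ccontr)
      assume "\<not> ?thesis"
      moreover have "\<exists>e\<in>E. \<kappa> e \<noteq> 0" using \<kappa> by (auto simp: circ_def vec_def fun_eq_iff)
      then have "(\<Sum>e\<in>E. q e * \<kappa> e) \<noteq> 0" using \<kappa> by (intro q_generic) (auto simp: ternary_def)
      ultimately have pos: "(\<Sum>e\<in>E. q e * \<kappa> e) > 0" by simp
      define d' where "d' = (\<lambda>e. d e - \<kappa> e)"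
      have "d' e \<ge> 0" for e
      proof (cases "\<kappa> e = 1")
        case True
        then have "d e \<noteq> 0" using \<kappa> by (auto simp: supp_def)
        then show ?thesis using dnn[of e] True by (simp add: d'_def)
      next
        case False
        then have "\<kappa> e \<le> 0" using \<kappa> ternary_nonzero_cases[of \<kappa> e] by auto
        then show ?thesis using dnn[of e] by (simp add: d'_def)
      qed
      moreover have "d' \<in> vec E" "bd d' = bd c"
        using d \<kappa> by (auto simp: d'_def Q_def effective_vec_def vec_def circ_def bd_diff)
      ultimately have "Q d'" by (auto simp: Q_def effective_vec_def)
      then have "m d \<le> m d'" by (rule min)
      moreover have "(\<Sum>e\<in>E. q e * d' e) = (\<Sum>e\<in>E. q e * d e) - (\<Sum>e\<in>E. q e * \<kappa> e)"
        by (simp add: d'_def algebra_simps sum_subtractf)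
      moreover have "(\<Sum>e\<in>E. q e * d' e) \<ge> 0"
        using \<open>\<And>e. d' e \<ge> 0\<close> q_pos by (intro sum_nonneg) (simp add: less_imp_le)
      ultimately show False using pos by (simp add: m_def)
    qed
  qed
  then show thesis using d that by (auto simp: Q_def standard_def)
qed

text \<open>As in \<open>face_unique\<close>, but with entries of arbitrary sign: a circulation
  supported in \<open>S\<close> has both its positive and its negative part there, so one face
  suffices for the contradiction.\<close>

lemma face_independent:
  assumes "face S" "k \<in> vec S" "l \<in> vec S" "bd k = bd l"
  shows "k = l"
proof (rule ccontr)
  assume "k \<noteq> l"
  define m where "m = (\<lambda>e. k e - l e)"
  have "S \<subseteq> E" using assms by (simp add: face_def)
  then have "m \<in> circ" using assms unfolding m_def by (intro circ_diffI) (auto intro: vec_mono)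
  moreover have "m \<noteq> (\<lambda>_. 0)" using \<open>k \<noteq> l\<close> by (auto simp: m_def fun_eq_iff)
  ultimately obtain \<kappa> where \<kappa>: "\<kappa> \<in> circ" "ternary \<kappa>" "\<kappa> \<noteq> (\<lambda>_. 0)"
    "\<And>e. \<kappa> e = 1 \<Longrightarrow> m e > 0" "\<And>e. \<kappa> e = -1 \<Longrightarrow> m e < 0"
    using conformal_ternary by blast
  have S: "e \<in> S" if "m e \<noteq> 0" for e using that assms by (cases "e \<in> S") (auto simp: m_def vec_def)
  have "\<forall>e. \<kappa> e = 1 \<longrightarrow> e \<in> S" using S \<kappa>(4) by (metis less_irrefl)
  then have "(\<Sum>e\<in>E. q e * \<kappa> e) < 0" using assms(1) \<kappa> by (auto simp: face_def)
  moreover have "(\<Sum>e\<in>E. q e * (- \<kappa> e)) < 0"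
  proof -
    have "ternary (\<lambda>e. - \<kappa> e)" "(\<lambda>e. - \<kappa> e) \<noteq> (\<lambda>_. 0)" "\<forall>e. - \<kappa> e = 1 \<longrightarrow> e \<in> S"
      using \<kappa> S by (force simp: ternary_def fun_eq_iff)+
    then show ?thesis using assms(1) circ_minus[OF \<kappa>(1)] unfolding face_def by blast
  qed
  ultimately show False by (simp add: sum_negf)
qed

lemma finite_facets: "finite {T. facet T}"
  by (rule finite_subset[of _ "Pow E"]) (auto simp: facet_def face_def finite_E)

lemma facet_span:
  assumes "facet T" "c \<in> vec E"
  obtains d where "d \<in> vec T" "bd d = bd c"
proof -
  from assms have "\<forall>e\<in>E. \<exists>k. k \<in> vec T \<and> bd k = bd (single_edge e)" by (auto simp: facet_def)
  from bchoice[OF this] obtain k where k: "\<And>e. e \<in> E \<Longrightarrow> k e \<in> vec T"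
    "\<And>e. e \<in> E \<Longrightarrow> bd (k e) = bd (single_edge e)" by blast
  have c: "c = (\<lambda>f. \<Sum>e\<in>E. c e * single_edge e f)"
  proof
    fix f show "c f = (\<Sum>e\<in>E. c e * single_edge e f)"
      using assms(2) finite_E by (auto simp: single_edge_def vec_def of_bool_def if_distrib[of "\<lambda>x. _ * x"] cong: if_cong)
  qed
  show thesis
  proof (rule that[of "\<lambda>f. \<Sum>e\<in>E. c e * k e f"])
    show "(\<lambda>f. \<Sum>e\<in>E. c e * k e f) \<in> vec T" using k by (auto simp: vec_def intro!: sum.neutral)
    show "bd (\<lambda>f. \<Sum>e\<in>E. c e * k e f) = bd c"
      by (subst (2) c) (simp add: bd_sum bd_scale k)
  qed
qed

text \<open>For a facet \<open>T\<close>, these are the coordinates of the class of \<open>c\<close>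
  in the lattice basis \<open>T\<close>.\<close>

definition coord :: "'e set \<Rightarrow> ('e \<Rightarrow> int) \<Rightarrow> ('e \<Rightarrow> int)" where
  "coord T c = (THE d. d \<in> vec T \<and> bd d = bd c)"

lemma coord_unique: "facet T \<Longrightarrow> d \<in> vec T \<Longrightarrow> bd d = bd c \<Longrightarrow> coord T c = d"
  unfolding coord_def by (rule the_equality) (auto simp: facet_def intro: face_independent)

lemma coord:
  assumes "facet T" "c \<in> vec E"
  shows "coord T c \<in> vec T" "bd (coord T c) = bd c"
  using facet_span[OF assms] coord_unique[OF assms(1)] by metis+

lemma coord_cong: "bd c = bd d \<Longrightarrow> coord T c = coord T d"
  by (simp add: coord_def)

lemma facet_subset_E: "facet T \<Longrightarrow> T \<subseteq> E"
  by (simp add: facet_def face_def)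

lemma coord_lincomb:
  assumes "facet T" "c \<in> vec E" "d \<in> vec E"
  shows "coord T (\<lambda>e. x * c e + y * d e) = (\<lambda>e. x * coord T c e + y * coord T d e)"
  using assms by (intro coord_unique) (auto simp: coord bd_lincomb intro: vec_lincomb)

text \<open>\<open>q\<close> serves both as the cost defining standard representatives and as the generic direction
  of the half-open decomposition.\<close>

definition qvec :: "'e \<Rightarrow> int" where
  "qvec e = (if e \<in> E then q e else 0)"

lemma qvec: "qvec \<in> vec E"
  by (simp add: qvec_def vec_def)

lemma cut_qvec_bound: "\<bar>\<Sum>e\<in>E. qvec e * cut U e\<bar> \<le> sum q E"
proof -
  have "\<bar>\<Sum>e\<in>E. qvec e * cut U e\<bar> \<le> (\<Sum>e\<in>E. \<bar>qvec e * cut U e\<bar>)" by (rule sum_abs)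
  also have "\<dots> \<le> sum q E"
  proof (rule sum_mono)
    fix e assume "e \<in> E" then show "\<bar>qvec e * cut U e\<bar> \<le> q e"
      using q_pos[of e] cut_ternary[of U e] by (auto simp: qvec_def)
  qed
  finally show ?thesis .
qed

text \<open>Cuts are ternary too, so the genericity that separates the costs of circulations also
  keeps the direction \<open>qvec\<close> off every cut hyperplane.\<close>

lemma cut_qvec_nonzero: "\<exists>e\<in>E. cut U e \<noteq> 0 \<Longrightarrow> (\<Sum>e\<in>E. qvec e * cut U e) \<noteq> 0"
  using q_generic[of "cut U", OF cut_ternary] by (simp add: qvec_def cong: sum.cong)

text \<open>Removing \<open>e\<close> from the basis \<open>T\<close> leaves a cut that vanishes on
  the rest; pairing \<open>qvec\<close> with it returns the coordinate at \<open>e\<close> up to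
  sign. So \<open>qvec\<close> is parallel to no wall of a simplex, and one bound serves all its
  coordinates.\<close>

lemma coord_q:
  assumes "facet T" "e \<in> T"
  shows "coord T qvec e \<noteq> 0" "\<bar>coord T qvec e\<bar> \<le> sum q E"
proof -
  have TE: "T \<subseteq> E" using assms facet_subset_E by blast
  obtain U where U: "\<And>f. f \<in> T - {e} \<Longrightarrow> cut U f = 0" "cut U e \<noteq> 0"
  proof (rule span_or_cut[of e "T - {e}"])
    fix k assume k: "k \<in> vec (T - {e})" "bd k = bd (single_edge e)"
    have "k = single_edge e"
      using assms k by (intro face_independent[of T]) (auto simp: facet_def vec_def single_edge_def)
    moreover have "k e = 0" using k by (auto simp: vec_def)
    ultimately show thesis by (simp add: single_edge_def)
  qed (use assms TE in auto)
  have "(\<Sum>f\<in>E. qvec f * cut U f) = (\<Sum>f\<in>E. coord T qvec f * cut U f)"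
    using coord[OF assms(1) qvec] by (intro sum_cut_cong) simp
  also have "\<dots> = (\<Sum>f\<in>E. if f = e then coord T qvec e * cut U e else 0)"
  proof (rule sum.cong[OF refl])
    fix f show "coord T qvec f * cut U f = (if f = e then coord T qvec e * cut U e else 0)"
      using U(1)[of f] coord(1)[OF assms(1) qvec] by (auto simp: vec_def)
  qed
  also have "\<dots> = coord T qvec e * cut U e" using assms TE finite_E by auto
  finally have eq: "(\<Sum>f\<in>E. qvec f * cut U f) = coord T qvec e * cut U e" .
  have "(\<Sum>f\<in>E. qvec f * cut U f) \<noteq> 0" using U assms TE by (intro cut_qvec_nonzero) auto
  with eq show "coord T qvec e \<noteq> 0" by auto
  show "\<bar>coord T qvec e\<bar> \<le> sum q E"
    using cut_qvec_bound[of U] eq U(2) cut_ternary[of U e] by auto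
qed

text \<open>If the support did not span, a cut vanishing on it would give
  \<open>0 = N * a + x * b\<close> with \<open>0 < |b| < N\<close>, which divisibility by
  \<open>N\<close> forbids. Perturbed points therefore lie on no lower-dimensional cone.\<close>

lemma perturbed_support_facet:
  assumes "c \<in> vec E" "N > sum q E" "x \<in> {1, -1}" "z \<in> standard"
    and bd: "bd z = bd (\<lambda>e. N * c e + x * qvec e)"
  shows "facet (supp z)"
  unfolding facet_def
proof (intro conjI ballI)
  show fz: "face (supp z)" using assms by (simp add: standard_def)
  fix e assume e: "e \<in> E"
  show "\<exists>k\<in>vec (supp z). bd k = bd (single_edge e)"
  proof (rule span_or_cut[OF e])
    show "supp z \<subseteq> E" using fz by (simp add: face_def)
  next
    fix U assume U: "\<And>f. f \<in> supp z \<Longrightarrow> cut U f = 0" "cut U e \<noteq> 0"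
    let ?a = "\<Sum>f\<in>E. c f * cut U f" and ?b = "\<Sum>f\<in>E. qvec f * cut U f"
    have b: "?b \<noteq> 0" using U e by (intro cut_qvec_nonzero) auto
    have "0 = (\<Sum>f\<in>E. z f * cut U f)" using U by (intro sum.neutral[symmetric]) (auto simp: supp_def)
    also have "\<dots> = (\<Sum>f\<in>E. (N * c f + x * qvec f) * cut U f)" by (rule sum_cut_cong[OF bd])
    also have "\<dots> = N * ?a + x * ?b"
      by (simp add: algebra_simps sum.distrib sum_distrib_left)
    finally have "N dvd x * ?b" by (metis dvd_add_right_iff dvd_0_right dvd_triv_left)
    then have "N dvd ?b" using assms(3) by auto
    then have "N \<le> \<bar>?b\<bar>" using b by (metis dvd_abs_iff dvd_imp_le_int zdvd_imp_le abs_ge_zero zero_less_abs_iff)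
    then show ?thesis using cut_qvec_bound[of U] assms(2) by linarith
  qed blast
qed

text \<open>The walls removed from the simplex \<open>T\<close>: a small move in direction
  \<open>x * qvec\<close> decreases these coordinates, so a point must be strictly positive there to
  stay in the cone over \<open>T\<close>.\<close>

definition half_open :: "int \<Rightarrow> 'e set \<Rightarrow> 'e set" where
  "half_open x T = {e \<in> T. x * coord T qvec e < 0}"

text \<open>The simplex is read off as the support of the standard representative of the perturbed
  point. The numbers \<open>N * d e + x * coord T qvec e\<close> are positive there and the second
  term is below \<open>N\<close> in absolute value, so \<open>d e\<close> is nonnegative, and
  positive where the second term is negative.\<close>

lemma half_open_decomposition:
  assumes c: "c \<in> vec E" and N: "N > sum q E" and x: "x \<in> {1, -1}"
    and z: "z \<in> effective_vec E" "bd z = bd (\<lambda>e. N * c e + x * qvec e)"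
  obtains T d where "facet T" "d \<in> standard" "bd d = bd c" "half_open x T \<subseteq> supp d" "supp d \<subseteq> T"
proof -
  obtain y where y: "y \<in> standard" "bd y = bd z" using standard_exists[OF z(1)] .
  define T where "T = supp y"
  have T: "facet T" unfolding T_def using y z by (intro perturbed_support_facet[OF c N x y(1)]) simp
  define d where "d = coord T c"
  have d: "d \<in> vec T" "bd d = bd c" using coord[OF T c] by (auto simp: d_def)
  have "y = coord T (\<lambda>e. N * c e + x * qvec e)"
    using T y z by (intro coord_unique[symmetric]) (auto simp: T_def vec_iff_supp)
  then have yeq: "y e = N * d e + x * coord T qvec e" for e
    using coord_lincomb[OF T c qvec] by (simp add: d_def)
  have ypos: "y e > 0" if "e \<in> T" for e
    using that y(1) by (auto simp: T_def supp_def standard_def effective_vec_def le_less)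
  have dnn: "d e \<ge> 0 \<and> (x * coord T qvec e < 0 \<longrightarrow> d e > 0)" if e: "e \<in> T" for e
  proof -
    have le: "\<bar>x * coord T qvec e\<bar> < N" using coord_q(2)[OF T e] N x by auto
    have "N > 0" using le by linarith
    have p: "N * d e + x * coord T qvec e > 0" using ypos[OF e] yeq by simp
    then have "N * d e > N * (-1)" using le by (simp add: abs_if split: if_splits)
    then have "d e > -1" using \<open>N > 0\<close> by (simp only: mult_less_cancel_left_pos)
    moreover have "d e \<noteq> 0" if "x * coord T qvec e < 0" using p that by auto
    ultimately show ?thesis by (auto simp: less_le)
  qed
  have TE: "T \<subseteq> E" using T by (rule facet_subset_E)
  have sd: "supp d \<subseteq> T" using d by (simp add: vec_iff_supp)
  have "d e \<ge> 0" for e using dnn d(1) by (cases "e \<in> T") (auto simp: vec_def)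
  then have "d \<in> effective_vec E" using d(1) TE by (auto simp: effective_vec_def intro: vec_mono)
  moreover have "face (supp d)" using T sd face_subset by (auto simp: facet_def)
  ultimately have "d \<in> standard" by (simp add: standard_def)
  moreover have "half_open x T \<subseteq> supp d" using dnn by (fastforce simp: half_open_def supp_def)
  ultimately show thesis using that T d sd by blast
qed

lemma half_open_perturbation:
  assumes T: "facet T" "half_open x T \<subseteq> supp d" "supp d \<subseteq> T" and d: "d \<in> standard"
    and N: "N > sum q E" and x: "x \<in> {1, -1}"
  obtains z where "z \<in> standard" "supp z = T" "bd z = bd (\<lambda>e. N * d e + x * qvec e)"
proof -
  define z where "z = (\<lambda>e. N * d e + x * coord T qvec e)"
  have dv: "d \<in> vec T" using T by (simp add: vec_iff_supp)
  have dnn: "d e \<ge> 0" for e using d by (simp add: standard_def effective_vec_def)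
  have pos: "z e > 0" if e: "e \<in> T" for e
  proof -
    have le: "\<bar>x * coord T qvec e\<bar> < N" using coord_q(2)[OF T(1) e] N x by auto
    show ?thesis
    proof (cases "d e = 0")
      case True
      then have "e \<notin> half_open x T" using T by (auto simp: supp_def)
      then have "x * coord T qvec e \<ge> 0" using e by (simp add: half_open_def)
      moreover have "x * coord T qvec e \<noteq> 0" using coord_q(1)[OF T(1) e] x by auto
      ultimately show ?thesis using True by (simp add: z_def less_le)
    next
      case False
      then have "d e \<ge> 1" using dnn[of e] by simp
      then have "N * d e \<ge> N * 1" using le by (intro mult_left_mono) auto
      then show ?thesis using le by (simp add: z_def)
    qed
  qed
  have zv: "z \<in> vec T" using dv coord(1)[OF T(1) qvec] by (simp add: z_def vec_lincomb)
  have sz: "supp z = T" using zv pos by (force simp: supp_def vec_def)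
  have "z e \<ge> 0" for e using pos[of e] zv by (cases "e \<in> T") (auto simp: vec_def)
  then have "z \<in> effective_vec E"
    using zv facet_subset_E[OF T(1)] by (auto simp: effective_vec_def intro: vec_mono)
  then have "z \<in> standard" using T(1) sz by (simp add: standard_def facet_def)
  moreover have "bd z = bd (\<lambda>e. N * d e + x * qvec e)"
    unfolding z_def bd_lincomb using coord(2)[OF T(1) qvec] by simp
  ultimately show thesis using that sz by blast
qed

text \<open>By \<open>half_open_perturbation\<close>, \<open>T\<close> and \<open>T'\<close> are
  both the support of the standard representative of the same perturbed point, with
  \<open>N = sum q E + 1\<close>.\<close>

lemma half_open_unique:
  assumes "facet T" "half_open x T \<subseteq> supp d" "supp d \<subseteq> T"
    "facet T'" "half_open x T' \<subseteq> supp d" "supp d \<subseteq> T'" "d \<in> standard" "x \<in> {1, -1}"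
  shows "T = T'"
  using half_open_perturbation[OF assms(1,2,3,7) less_add_one assms(8)]
    half_open_perturbation[OF assms(4,5,6,7) less_add_one assms(8)] standard_unique
  by (metis (no_types, lifting))

lemma half_open_minus:
  assumes "facet T"
  shows "half_open (-1) T = T - half_open 1 T"
  using coord_q(1)[OF assms] by (force simp: half_open_def)

text \<open>The direction 1 is always admissible, since adding \<open>q\<close> keeps a flow
  nonnegative; these half-open simplices therefore cover all standard points, not only interior
  ones.\<close>

lemma ex1_facet:
  assumes "c \<in> standard"
  shows "\<exists>!T. facet T \<and> half_open 1 T \<subseteq> supp c \<and> supp c \<subseteq> T"
proof -
  have cv: "c \<in> vec E" "\<And>e. c e \<ge> 0" using assms by (auto simp: standard_def effective_vec_def)
  define N where "N = sum q E + 1"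
  have "N > 0" using q_pos by (simp add: N_def sum_nonneg less_imp_le add_nonneg_pos)
  then have "(\<lambda>e. N * c e + 1 * qvec e) \<in> effective_vec E"
    using cv q_pos qvec by (auto simp: effective_vec_def qvec_def vec_def less_imp_le intro!: add_nonneg_nonneg)
  then obtain T d where "facet T" "d \<in> standard" "bd d = bd c" "half_open 1 T \<subseteq> supp d" "supp d \<subseteq> T"
    using half_open_decomposition[OF cv(1), of N 1] by (auto simp: N_def)
  moreover from this assms have "d = c" by (intro standard_unique)
  ultimately show ?thesis using half_open_unique[of _ 1 c] assms by (auto intro!: ex_ex1I)
qed

section \<open>Points of the relative interior\<close>

definition interior :: "('e \<Rightarrow> int) \<Rightarrow> bool" where
  "interior c \<longleftrightarrow> (\<forall>e\<in>E. c e > 0 \<or> (\<exists>k\<in>circ. k e > 0 \<and> (\<forall>f\<in>E. c f = 0 \<longrightarrow> k f \<ge> 0)))"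

text \<open>Interior points admit a small move against \<open>qvec\<close>. A weighted sum
  \<open>K\<close> of the augmenting circulations makes up for \<open>q\<close> on the zero edges of
  \<open>c\<close>; on the other edges a large multiple of \<open>c\<close> does.\<close>

lemma perturbation_if_interior:
  assumes c: "c \<in> effective_vec E" and int: "interior c"
  obtains N z where "N > sum q E" "z \<in> effective_vec E" "bd z = bd (\<lambda>e. N * c e + (-1) * qvec e)"
proof -
  define Z where "Z = {e\<in>E. c e = 0}"
  have "\<forall>e\<in>Z. \<exists>k. k \<in> circ \<and> k e > 0 \<and> (\<forall>f\<in>Z. k f \<ge> 0)"
    using int by (force simp: interior_def Z_def)
  from bchoice[OF this] obtain k where k: "\<And>e. e \<in> Z \<Longrightarrow> k e \<in> circ" "\<And>e. e \<in> Z \<Longrightarrow> k e e > 0"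
    "\<And>e f. e \<in> Z \<Longrightarrow> f \<in> Z \<Longrightarrow> k e f \<ge> 0" by blast
  define K where "K = (\<lambda>f. \<Sum>e\<in>Z. q e * k e f)"
  have K: "K \<in> circ" unfolding K_def using k(1) by (intro circ_sum circ_scale)
  have finZ: "finite Z" using finite_E by (simp add: Z_def)
  have Kge: "K f \<ge> q f" if "f \<in> Z" for f
  proof -
    have "q f * 1 \<le> q f * k f f" using k(2)[OF that] q_pos[of f] by (intro mult_left_mono) auto
    also have "\<dots> \<le> K f" unfolding K_def
      using that finZ k(3) q_pos by (intro member_le_sum) (auto simp: less_imp_le)
    finally show ?thesis by simp
  qed
  \<comment> \<open>Exceeds \<open>sum q E\<close>, as the perturbation lemmas require, and also
    \<open>q e + |K e|\<close> for each edge, so that one unit of \<open>c e\<close> outweighs both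
    losses.\<close>
  define N where "N = sum q E + 1 + (\<Sum>f\<in>E. \<bar>K f\<bar>) + sum q E"
  define z where "z = (\<lambda>e. (N * c e + (-1) * qvec e) + K e)"
  have Kv: "K \<in> vec E" "bd K = (\<lambda>_. 0)" using K by (auto simp: circ_def)
  have qs: "sum q E \<ge> 0" using q_pos by (simp add: sum_nonneg less_imp_le)
  have as: "(\<Sum>f\<in>E. \<bar>K f\<bar>) \<ge> 0" by (simp add: sum_nonneg)
  have znn: "z e \<ge> 0" if e: "e \<in> E" for e
  proof (cases "e \<in> Z")
    case True
    then show ?thesis using Kge[OF True] e by (simp add: z_def Z_def qvec_def)
  next
    case False
    then have "c e \<ge> 1" using c e by (auto simp: Z_def effective_vec_def) (smt (verit))
    then have "N * c e \<ge> N * 1" using qs as by (intro mult_left_mono) (auto simp: N_def)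
    moreover have "\<bar>K e\<bar> \<le> (\<Sum>f\<in>E. \<bar>K f\<bar>)" using e finite_E by (intro member_le_sum) auto
    moreover have "q e \<le> sum q E" using e finite_E q_pos by (intro member_le_sum) (auto simp: less_imp_le)
    ultimately show ?thesis using qs e by (simp add: z_def N_def qvec_def)
  qed
  have zv: "z \<in> vec E" using c Kv by (auto simp: z_def vec_def effective_vec_def qvec_def)
  have "z e \<ge> 0" for e using znn[of e] zv by (cases "e \<in> E") (auto simp: vec_def)
  then have "z \<in> effective_vec E" using zv by (simp add: effective_vec_def)
  moreover have "bd z = bd (\<lambda>e. N * c e + (-1) * qvec e)" unfolding z_def bd_add[of _ K] Kv by simp
  moreover have "N > sum q E" using qs as unfolding N_def by linarith
  ultimately show thesis using that by blast
qed

text \<open>Two representatives of the perturbed point differ by a circulation, and on the zero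
  edges of \<open>c\<close> this one is at least \<open>q\<close>; it augments all of them at
  once.\<close>

lemma interior_if_perturbation:
  assumes c: "c \<in> effective_vec E"
    and z: "z \<in> effective_vec E" "bd z = bd (\<lambda>e. N * c e + (-1) * qvec e)"
  shows "interior c"
  unfolding interior_def
proof
  fix e assume e: "e \<in> E"
  define k where "k = (\<lambda>e. z e - (N * c e + (-1) * qvec e))"
  have "k \<in> circ" unfolding k_def using z c qvec
    by (intro circ_diffI vec_lincomb) (auto simp: effective_vec_def)
  moreover have "k f > 0" if "c f = 0" "f \<in> E" for f
    using z that q_pos[of f] by (simp add: k_def effective_vec_def qvec_def add_nonneg_pos)
  ultimately show "c e > 0 \<or> (\<exists>k\<in>circ. k e > 0 \<and> (\<forall>f\<in>E. c f = 0 \<longrightarrow> k f \<ge> 0))"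
    using c e by (auto simp: effective_vec_def less_le)
qed

text \<open>The definition of \<open>interior\<close> refers to the zero set of one representative,
  but the perturbation criterion sees only its boundary.\<close>

lemma interior_cong:
  assumes "c \<in> effective_vec E" "d \<in> effective_vec E" "bd c = bd d" "interior c"
  shows "interior d"
proof -
  obtain N z where "N > sum q E" "z \<in> effective_vec E" "bd z = bd (\<lambda>e. N * c e + (-1) * qvec e)"
    using perturbation_if_interior assms by blast
  moreover have "bd (\<lambda>e. N * c e + (-1) * qvec e) = bd (\<lambda>e. N * d e + (-1) * qvec e)"
    unfolding bd_lincomb using assms by simp
  ultimately show ?thesis using interior_if_perturbation assms by metis
qed

lemma interior_iff_facet:
  assumes c: "c \<in> standard"
  shows "interior c \<longleftrightarrow> (\<exists>T. facet T \<and> T - half_open 1 T \<subseteq> supp c \<and> supp c \<subseteq> T)"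
proof
  have ce: "c \<in> effective_vec E" "c \<in> vec E" using c by (auto simp: standard_def effective_vec_def)
  {
    assume "interior c"
    then obtain N z where "N > sum q E" "z \<in> effective_vec E" "bd z = bd (\<lambda>e. N * c e + (-1) * qvec e)"
      using perturbation_if_interior ce by blast
    then obtain T d where "facet T" "d \<in> standard" "bd d = bd c" "half_open (-1) T \<subseteq> supp d" "supp d \<subseteq> T"
      using half_open_decomposition[OF ce(2), of N "-1" z] by auto
    moreover from this c have "d = c" by (intro standard_unique)
    ultimately show "\<exists>T. facet T \<and> T - half_open 1 T \<subseteq> supp c \<and> supp c \<subseteq> T"
      using half_open_minus by metis
  next
    assume "\<exists>T. facet T \<and> T - half_open 1 T \<subseteq> supp c \<and> supp c \<subseteq> T"
    then obtain T where T: "facet T" "half_open (-1) T \<subseteq> supp c" "supp c \<subseteq> T"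
      using half_open_minus by metis
    obtain z where "z \<in> standard" "bd z = bd (\<lambda>e. (sum q E + 1) * c e + (-1) * qvec e)"
    proof (rule half_open_perturbation[OF T c less_add_one])
      show "- 1 \<in> {1, - 1 :: int}" by simp
    qed
    then show "interior c"
      using interior_if_perturbation[OF ce(1)] by (auto simp: standard_def)
  }
qed

text \<open>Counting modulo 2 replaces a comparison of dimensions. If two subsets of
  \<open>S\<close> have \<open>T\<close>-coordinates of equal parity, their difference is twice a
  lattice element; its coordinates in the basis \<open>S\<close> are then even and lie in {-1, 0,
  1}, so they vanish. Hence 2^|S| is at most 2^|T|.\<close>

lemma facet_card_le:
  assumes "facet S" "facet T"
  shows "card S \<le> card T"
proof -
  have fin: "finite S" "finite T" using assms facet_subset_E finite_E finite_subset by blast+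
  define ch where "ch A = (\<lambda>e. of_bool (e \<in> A) :: int)" for A :: "'e set"
  have chv: "ch A \<in> vec E" if "A \<subseteq> S" for A
    using that assms facet_subset_E by (auto simp: ch_def vec_def)
  define g where "g A = {e \<in> T. odd (coord T (ch A) e)}" for A
  have "inj_on g (Pow S)"
  proof (rule inj_onI)
    fix A B assume A: "A \<in> Pow S" and B: "B \<in> Pow S" and eq: "g A = g B"
    define d where "d = (\<lambda>e. 1 * coord T (ch A) e + (-1) * coord T (ch B) e)"
    have "d \<in> vec T" unfolding d_def using A B chv coord(1)[OF assms(2)] by (intro vec_lincomb) auto
    have "even (d e)" for e
    proof (cases "e \<in> T")
      case True
      then show ?thesis using eq by (auto simp: g_def d_def set_eq_iff)
    qed (use \<open>d \<in> vec T\<close> in \<open>auto simp: vec_def\<close>)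
    then have d2: "d = (\<lambda>e. 2 * (d e div 2))" by auto
    have hv: "(\<lambda>e. d e div 2) \<in> vec E"
      using \<open>d \<in> vec T\<close> assms facet_subset_E[of T] by (auto simp: vec_def)
    from facet_span[OF assms(1) hv] obtain h where h: "h \<in> vec S" "bd h = bd (\<lambda>e. d e div 2)" .
    have "bd (\<lambda>e. 1 * ch A e + (-1) * ch B e) = bd d"
      unfolding d_def bd_lincomb using coord(2)[OF assms(2)] A B chv by auto
    also have "\<dots> = bd (\<lambda>e. 2 * h e)" by (subst d2) (simp only: bd_scale h)
    finally have bdeq: "bd (\<lambda>e. 1 * ch A e + (-1) * ch B e) = bd (\<lambda>e. 2 * h e)" .
    have "(\<lambda>e. 1 * ch A e + (-1) * ch B e) = (\<lambda>e. 2 * h e)"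
      using A B h assms bdeq by (intro face_independent[of S]) (auto simp: facet_def ch_def vec_def)
    then have "ch A e - ch B e = 2 * h e" for e by (simp add: fun_eq_iff)
    then have ev: "even (ch A e - ch B e)" for e by simp
    have "e \<in> A \<longleftrightarrow> e \<in> B" for e using ev[of e] by (auto simp: ch_def of_bool_def split: if_splits)
    then show "A = B" by blast
  qed
  moreover have "g ` Pow S \<subseteq> Pow T" by (auto simp: g_def)
  ultimately have "card (Pow S) \<le> card (Pow T)" using fin by (intro card_inj_on_le) auto
  then show ?thesis using fin by (simp add: card_Pow)
qed

definition rank :: nat where
  "rank = card (SOME T. facet T)"

lemma card_facet: "facet T \<Longrightarrow> card T = rank"
  unfolding rank_def by (metis facet_card_le le_antisym someI)

lemma zero_standard: "(\<lambda>_. 0) \<in> standard"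
proof -
  have "(\<lambda>_. 0) \<in> effective_vec E" by (simp add: effective_vec_def vec_def)
  then obtain d where d: "d \<in> standard" "bd d = bd (\<lambda>_. 0)" by (rule standard_exists)
  have nn: "d e \<ge> 0" "e \<notin> E \<Longrightarrow> d e = 0" for e
    using d(1) by (auto simp: standard_def effective_vec_def vec_def)
  have "sum d E = 0" using sum_cong_bd[OF d(2)] by simp
  then have "d e = 0" if "e \<in> E" for e
    using that nn finite_E sum_nonneg_eq_0_iff[of E d] by auto
  then have "d = (\<lambda>_. 0)" using nn by blast
  with d show ?thesis by simp
qed

lemma facet_exists: "\<exists>T. facet T"
  using ex1_facet[OF zero_standard] by blast

end

section \<open>The numerator of the Hilbert series\<close>

definition points :: "'e set \<Rightarrow> 'e set \<Rightarrow> nat \<Rightarrow> ('e \<Rightarrow> int) set" where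
  "points T J k = {c \<in> effective_vec T. J \<subseteq> supp c \<and> sum c T = int k}"

lemma effective_le_sum:
  assumes "finite T" "c \<in> effective_vec T" shows "c e \<le> sum c T"
  using assms by (cases "e \<in> T")
    (auto simp: effective_vec_def vec_def intro: member_le_sum sum_nonneg)

lemma effective_vec_bounded:
  assumes "finite T"
  shows "finite {c \<in> effective_vec T. sum c T \<le> int n}"
    "card {c \<in> effective_vec T. sum c T \<le> int n} \<le> (n + 1) ^ card T"
proof -
  let ?A = "{c \<in> effective_vec T. sum c T \<le> int n}" and ?B = "T \<rightarrow>\<^sub>E {0..int n}"
  have inj: "inj_on (\<lambda>c. restrict c T) ?A"
  proof (rule inj_onI)
    fix c d assume c: "c \<in> ?A" and d: "d \<in> ?A" and eq: "restrict c T = restrict d T"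
    show "c = d"
    proof
      fix e show "c e = d e"
        using c d fun_cong[OF eq, of e] by (cases "e \<in> T") (auto simp: effective_vec_def vec_def)
    qed
  qed
  have sub: "(\<lambda>c. restrict c T) ` ?A \<subseteq> ?B"
  proof
    fix x assume "x \<in> (\<lambda>c. restrict c T) ` ?A"
    then obtain c where c: "c \<in> effective_vec T" "sum c T \<le> int n" "x = restrict c T" by blast
    have "c e \<le> int n" for e using effective_le_sum[OF assms c(1), of e] c(2) by linarith
    with c show "x \<in> ?B" by (auto simp: effective_vec_def)
  qed
  have fin: "finite ?B" using assms by (intro finite_PiE) auto
  show "finite ?A" using inj_on_finite[OF inj sub fin] .
  have "card ?A \<le> card ?B" using card_inj_on_le[OF inj sub fin] .
  also have "card ?B = (n + 1) ^ card T" using assms by (simp add: card_PiE nat_add_distrib)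
  finally show "card ?A \<le> (n + 1) ^ card T" .
qed

lemma finite_points: "finite T \<Longrightarrow> finite (points T J k)"
  by (rule finite_subset[OF _ effective_vec_bounded(1)[of T k]]) (auto simp: points_def)

lemma card_points_shift:
  assumes "finite T" "a \<in> T"
  shows "card (points T (insert a J) (Suc k)) = card (points T (J - {a}) k)"
proof (rule bij_betw_same_card[of "\<lambda>c. c(a := c a - 1)"], rule bij_betwI[of _ _ _ "\<lambda>c. c(a := c a + 1)"])
  have sum_upd: "sum (c(a := x)) T = sum c T - c a + x" for c and x :: int
    using assms by (simp add: sum.remove[of T a])
  have nz: "c a \<ge> 1" if "c \<in> points T (insert a J) (Suc k)" for c
  proof -
    from that have "c a \<ge> 0" "c a \<noteq> 0" by (auto simp: points_def effective_vec_def supp_def)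
    then show ?thesis by linarith
  qed
  show "(\<lambda>c. c(a := c a - 1)) \<in> points T (insert a J) (Suc k) \<rightarrow> points T (J - {a}) k"
  proof
    fix c assume c: "c \<in> points T (insert a J) (Suc k)"
    show "c(a := c a - 1) \<in> points T (J - {a}) k"
      unfolding points_def mem_Collect_eq
    proof (intro conjI)
      show "sum (c(a := c a - 1)) T = int k" using c by (simp only: sum_upd) (simp add: points_def)
    qed (use nz[OF c] c assms in \<open>auto simp: points_def effective_vec_def vec_def supp_def\<close>)
  qed
  show "(\<lambda>c. c(a := c a + 1)) \<in> points T (J - {a}) k \<rightarrow> points T (insert a J) (Suc k)"
  proof
    fix c assume c: "c \<in> points T (J - {a}) k"
    then have "c a \<ge> 0" by (simp add: points_def effective_vec_def)
    then have ca: "c a + 1 \<noteq> 0" by linarith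
    from c show "c(a := c a + 1) \<in> points T (insert a J) (Suc k)"
      unfolding points_def mem_Collect_eq
    proof (intro conjI)
      show "sum (c(a := c a + 1)) T = int (Suc k)" using c by (simp only: sum_upd) (simp add: points_def)
    qed (use ca c assms in \<open>auto simp: points_def effective_vec_def vec_def supp_def\<close>)
  qed
qed auto

text \<open>One coordinate at a time: \<open>step\<close> splits by whether the new coordinate
  vanishes and yields a factor 1/(1 - X); \<open>shift\<close> adds a factor X if the coordinate has
  to be positive.\<close>

lemma fps_points:
  assumes "finite T" "J \<subseteq> T"
  shows "Abs_fps (\<lambda>k. of_nat (card (points T J k))) * (1 - fps_X) ^ card T = (fps_X ^ card J :: rat fps)"
  using assms
proof (induction T arbitrary: J)
  case empty
  have "points {} {} k = (if k = 0 then {\<lambda>_. 0} else {} :: ('a \<Rightarrow> int) set)" for k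
    by (auto simp: points_def effective_vec_def vec_def supp_def)
  then have "Abs_fps (\<lambda>k. of_nat (card (points ({} :: 'a set) {} k))) = (1 :: rat fps)"
    by (intro fps_ext) auto
  then show ?case using empty by simp
next
  case (insert a T)
  define F where "F S I = (Abs_fps (\<lambda>k. of_nat (card (points S I k))) :: rat fps)" for S I :: "'a set"
  have shift: "F (insert a T) (insert a I) = fps_X * F (insert a T) (I - {a})" for I
  proof (rule fps_ext)
    fix k
    show "F (insert a T) (insert a I) $ k = (fps_X * F (insert a T) (I - {a})) $ k"
    proof (cases k)
      case 0
      have "points (insert a T) (insert a I) 0 = {}"
      proof (rule ccontr)
        assume "points (insert a T) (insert a I) 0 \<noteq> {}"
        then obtain c where c: "c \<in> points (insert a T) (insert a I) 0" by blast
        then have "c a \<le> 0" "c a \<ge> 0"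
          using effective_le_sum[of "insert a T" c a] insert.hyps by (auto simp: points_def effective_vec_def)
        then show False using c by (auto simp: points_def supp_def)
      qed
      then show ?thesis using 0 by (simp add: F_def)
    next
      case (Suc k')
      then show ?thesis using card_points_shift[of "insert a T" a I k'] insert.hyps by (simp add: F_def)
    qed
  qed
  have step: "F (insert a T) I * (1 - fps_X) = F T I" if "a \<notin> I" for I
  proof -
    have "points (insert a T) I k = points T I k \<union> points (insert a T) (insert a I) k" for k
    proof (intro Set.set_eqI iffI)
      fix c assume c: "c \<in> points (insert a T) I k"
      show "c \<in> points T I k \<union> points (insert a T) (insert a I) k"
        using c insert.hyps by (cases "c a = 0") (auto simp: points_def effective_vec_def vec_def supp_def)
    next
      fix c assume c: "c \<in> points T I k \<union> points (insert a T) (insert a I) k"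
      then show "c \<in> points (insert a T) I k"
        using insert.hyps by (auto simp: points_def effective_vec_def vec_def)
    qed
    moreover have "points T I k \<inter> points (insert a T) (insert a I) k = {}" for k
      using insert.hyps by (auto simp: points_def effective_vec_def vec_def supp_def)
    ultimately have "card (points (insert a T) I k) =
        card (points T I k) + card (points (insert a T) (insert a I) k)" for k
      using insert.hyps by (simp add: card_Un_disjoint finite_points)
    then have "F (insert a T) I = F T I + F (insert a T) (insert a I)"
      by (intro fps_ext) (simp add: F_def)
    also have "F (insert a T) (insert a I) = fps_X * F (insert a T) I" using shift[of I] that by simp
    finally show ?thesis by (simp add: algebra_simps)
  qed
  have "F (insert a T) (J - {a}) * (1 - fps_X) ^ card (insert a T) = F T (J - {a}) * (1 - fps_X) ^ card T"
    using step[of "J - {a}"] insert.hyps by (simp flip: mult.assoc)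
  also have "\<dots> = fps_X ^ card (J - {a})" unfolding F_def using insert.prems by (intro insert.IH) auto
  finally have base: "F (insert a T) (J - {a}) * (1 - fps_X) ^ card (insert a T) = fps_X ^ card (J - {a})" .
  show ?case
  proof (cases "a \<in> J")
    case True
    have fJ: "finite J" using insert finite_subset by blast
    have "F (insert a T) J = fps_X * F (insert a T) (J - {a})" using shift[of J] True by (simp add: insert_absorb)
    then have "F (insert a T) J * (1 - fps_X) ^ card (insert a T) = fps_X * fps_X ^ card (J - {a})"
      using base by (simp add: mult.assoc)
    also have "\<dots> = fps_X ^ card J" using card.remove[OF fJ True] by simp
    finally show ?thesis by (simp add: F_def)
  next
    case False
    then show ?thesis using base by (simp add: F_def)
  qed
qed

context weighted_network
begin

lemma sum_supp: "c \<in> vec T \<Longrightarrow> T \<subseteq> E \<Longrightarrow> sum c T = sum c E"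
  using finite_E by (intro sum.mono_neutral_left) (auto simp: vec_def)

lemma standard_degree_decomposition:
  "{c \<in> standard. sum c E = int k} = (\<Union>T\<in>{T. facet T}. points T (half_open 1 T) k)"
proof (intro Set.set_eqI iffI)
  fix c assume c: "c \<in> {c \<in> standard. sum c E = int k}"
  then obtain T where T: "facet T" "half_open 1 T \<subseteq> supp c" "supp c \<subseteq> T" using ex1_facet by blast
  have "c \<in> vec T" using T by (simp add: vec_iff_supp)
  with c T show "c \<in> (\<Union>T\<in>{T. facet T}. points T (half_open 1 T) k)"
    using sum_supp[of c T] facet_subset_E[OF T(1)]
    by (auto simp: points_def standard_def effective_vec_def)
next
  fix c assume "c \<in> (\<Union>T\<in>{T. facet T}. points T (half_open 1 T) k)"
  then obtain T where T: "facet T" "c \<in> points T (half_open 1 T) k" by blast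
  then have c: "c \<in> vec T" "\<And>e. c e \<ge> 0" "sum c T = int k" by (auto simp: points_def effective_vec_def)
  have "face (supp c)" using T c face_subset by (auto simp: facet_def vec_iff_supp)
  then show "c \<in> {c \<in> standard. sum c E = int k}"
    using c sum_supp[of c T] facet_subset_E[OF T(1)]
    by (auto simp: standard_def effective_vec_def intro: vec_mono)
qed

definition h_numerator :: "rat poly" where
  "h_numerator = (\<Sum>T | facet T. monom 1 (card (half_open 1 T)))"

lemma half_open_subset: "half_open x T \<subseteq> T"
  by (auto simp: half_open_def)

lemma hilbert_numerator:
  "Abs_fps (\<lambda>k. of_nat (card {c \<in> standard. sum c E = int k})) * (1 - fps_X) ^ rank = fps_of_poly h_numerator"
proof -
  have fin: "finite T" if "facet T" for T using that facet_subset_E finite_E finite_subset by blast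
  have "card {c \<in> standard. sum c E = int k} = (\<Sum>T | facet T. card (points T (half_open 1 T) k))" for k
    unfolding standard_degree_decomposition
  proof (rule card_UN_disjoint)
    show "\<forall>T\<in>{T. facet T}. \<forall>T'\<in>{T. facet T}. T \<noteq> T' \<longrightarrow>
        points T (half_open 1 T) k \<inter> points T' (half_open 1 T') k = {}"
    proof (intro ballI impI)
      fix T T' assume T: "T \<in> {T. facet T}" "T' \<in> {T. facet T}" "T \<noteq> T'"
      show "points T (half_open 1 T) k \<inter> points T' (half_open 1 T') k = {}"
      proof (rule ccontr)
        assume "points T (half_open 1 T) k \<inter> points T' (half_open 1 T') k \<noteq> {}"
        then obtain c where c: "c \<in> points T (half_open 1 T) k" "c \<in> points T' (half_open 1 T') k" by blast
        with T have "c \<in> standard" using standard_degree_decomposition[of k] by blast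
        with c T show False using half_open_unique[of T 1 c T']
          by (auto simp: points_def effective_vec_def vec_iff_supp)
      qed
    qed
  qed (use finite_facets fin finite_points in auto)
  then have "Abs_fps (\<lambda>k. of_nat (card {c \<in> standard. sum c E = int k})) =
      (\<Sum>T | facet T. Abs_fps (\<lambda>k. of_nat (card (points T (half_open 1 T) k))) :: rat fps)"
    by (intro fps_ext) (simp add: fps_sum_nth)
  then have "Abs_fps (\<lambda>k. of_nat (card {c \<in> standard. sum c E = int k})) * (1 - fps_X) ^ rank =
      (\<Sum>T | facet T. Abs_fps (\<lambda>k. of_nat (card (points T (half_open 1 T) k))) * (1 - fps_X) ^ card T :: rat fps)"
    by (simp add: sum_distrib_right card_facet cong: sum.cong_simp)
  also have "\<dots> = (\<Sum>T | facet T. fps_X ^ card (half_open 1 T))"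
    using fin half_open_subset by (intro sum.cong fps_points) auto
  also have "\<dots> = fps_of_poly h_numerator"
    by (simp add: h_numerator_def fps_of_poly_sum fps_of_poly_monom)
  finally show ?thesis .
qed

text \<open>Polynomial growth of order \<open>rank\<close>; this is what bounds the Krull dimension
  from above.\<close>

lemma card_standard_le:
  "finite {c \<in> standard. sum c E \<le> int n}"
  "card {c \<in> standard. sum c E \<le> int n} \<le> card {T. facet T} * (n + 1) ^ rank"
proof -
  have fin: "finite T" if "facet T" for T using that facet_subset_E finite_E finite_subset by blast
  let ?B = "\<lambda>T. {c \<in> effective_vec T. sum c T \<le> int n}"
  have sub: "{c \<in> standard. sum c E \<le> int n} \<subseteq> (\<Union>T\<in>{T. facet T}. ?B T)"
  proof
    fix c assume c: "c \<in> {c \<in> standard. sum c E \<le> int n}"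
    then obtain T where T: "facet T" "supp c \<subseteq> T" using ex1_facet by blast
    then have "c \<in> vec T" by (simp add: vec_iff_supp)
    with c T show "c \<in> (\<Union>T\<in>{T. facet T}. ?B T)"
      using sum_supp[of c T] facet_subset_E[OF T(1)] by (auto simp: standard_def effective_vec_def)
  qed
  have finU: "finite (\<Union>T\<in>{T. facet T}. ?B T)"
    using finite_facets fin effective_vec_bounded(1) by blast
  show "finite {c \<in> standard. sum c E \<le> int n}" using finite_subset[OF sub finU] .
  have "card {c \<in> standard. sum c E \<le> int n} \<le> card (\<Union>T\<in>{T. facet T}. ?B T)"
    using card_mono[OF finU sub] .
  also have "\<dots> \<le> (\<Sum>T | facet T. card (?B T))" using finite_facets by (rule card_UN_le)
  also have "\<dots> \<le> (\<Sum>T | facet T. (n + 1) ^ rank)"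
  proof (rule sum_mono)
    fix T assume "T \<in> {T. facet T}"
    then show "card (?B T) \<le> (n + 1) ^ rank"
      using effective_vec_bounded(2)[of T n] fin[of T] card_facet[of T] by simp
  qed
  finally show "card {c \<in> standard. sum c E \<le> int n} \<le> card {T. facet T} * (n + 1) ^ rank" by simp
qed

section \<open>Least interior points and the leading coefficient\<close>

definition min_interior :: "('e \<Rightarrow> int) \<Rightarrow> bool" where
  "min_interior c \<longleftrightarrow> c \<in> effective_vec E \<and> interior c \<and>
     (\<forall>d\<in>effective_vec E. interior d \<longrightarrow> sum c E \<le> sum d E)"

text \<open>The interior point of least degree in the cone over a facet \<open>T\<close>.\<close>

definition open_corner :: "'e set \<Rightarrow> 'e \<Rightarrow> int" where
  "open_corner T = (\<lambda>e. of_bool (e \<in> T - half_open 1 T))"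

definition max_removed :: nat where
  "max_removed = Max ((\<lambda>T. card (half_open 1 T)) ` {T. facet T})"

lemma max_removed:
  "facet T \<Longrightarrow> card (half_open 1 T) \<le> max_removed"
  "\<exists>T. facet T \<and> card (half_open 1 T) = max_removed"
proof -
  let ?S = "(\<lambda>T. card (half_open 1 T)) ` {T. facet T}"
  have S: "finite ?S" "?S \<noteq> {}" using finite_facets facet_exists by auto
  show "facet T \<Longrightarrow> card (half_open 1 T) \<le> max_removed"
    unfolding max_removed_def using S by (intro Max_ge) auto
  show "\<exists>T. facet T \<and> card (half_open 1 T) = max_removed"
    using Max_in[OF S] unfolding max_removed_def by force
qed

lemma lead_coeff_h_numerator:
  "lead_coeff h_numerator = of_nat (card {T. facet T \<and> card (half_open 1 T) = max_removed})"
proof -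
  have coeff: "coeff h_numerator i = of_nat (card {T. facet T \<and> card (half_open 1 T) = i})" for i
  proof -
    have "coeff h_numerator i = (\<Sum>T | facet T. of_bool (card (half_open 1 T) = i))"
      by (simp add: h_numerator_def coeff_sum of_bool_def)
    also have "\<dots> = of_nat (card ({T. facet T} \<inter> {T. card (half_open 1 T) = i}))"
      using finite_facets by (simp add: of_bool_def sum.If_cases)
    also have "{T. facet T} \<inter> {T. card (half_open 1 T) = i} = {T. facet T \<and> card (half_open 1 T) = i}" by blast
    finally show ?thesis .
  qed
  have "degree h_numerator = max_removed"
  proof (rule antisym)
    show "degree h_numerator \<le> max_removed"
    proof (rule degree_le, intro allI impI)
      fix i assume "i > max_removed"
      then have "{T. facet T \<and> card (half_open 1 T) = i} = {}" using max_removed(1) by (auto simp: not_le[symmetric])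
      then show "coeff h_numerator i = 0" by (simp only: coeff) simp
    qed
    have "{T. facet T \<and> card (half_open 1 T) = max_removed} \<noteq> {}" using max_removed(2) by blast
    moreover have "finite {T. facet T \<and> card (half_open 1 T) = max_removed}"
      by (rule finite_subset[OF _ finite_facets]) auto
    ultimately have "coeff h_numerator max_removed \<noteq> 0" by (simp add: coeff)
    then show "max_removed \<le> degree h_numerator" by (rule le_degree)
  qed
  then show ?thesis by (simp add: coeff)
qed

lemma open_corner:
  assumes "facet T"
  shows "open_corner T \<in> standard" "interior (open_corner T)"
    "sum (open_corner T) E = int rank - int (card (half_open 1 T))"
proof -
  have TE: "T \<subseteq> E" using assms by (rule facet_subset_E)
  have supp: "supp (open_corner T) = T - half_open 1 T" by (auto simp: supp_def open_corner_def)
  have "face (supp (open_corner T))" using assms face_subset supp by (auto simp: facet_def)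
  then show std: "open_corner T \<in> standard" using TE
    by (auto simp: standard_def effective_vec_def vec_def open_corner_def)
  show "interior (open_corner T)" unfolding interior_iff_facet[OF std] using assms supp by blast
  have fin: "finite T" using TE finite_E finite_subset by blast
  have "sum (open_corner T) E = (\<Sum>e\<in>T - half_open 1 T. 1)"
    unfolding open_corner_def of_bool_def using TE finite_E
    by (subst sum.If_cases) (auto intro!: arg_cong[where f = card])
  also have "\<dots> = int rank - int (card (half_open 1 T))"
    using fin half_open_subset[of 1 T] card_facet[OF assms] card_mono[OF fin half_open_subset[of 1 T]]
    by (simp add: card_Diff_subset finite_subset of_nat_diff)
  finally show "sum (open_corner T) E = int rank - int (card (half_open 1 T))" .
qed

text \<open>The corner lies in the half-open simplices of direction -1 of both facets, and such a
  facet is unique.\<close>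

lemma open_corner_inj:
  assumes "facet T" "facet T'" "open_corner T = open_corner T'"
  shows "T = T'"
proof -
  have supp: "supp (open_corner T) = T - half_open 1 T" for T by (auto simp: supp_def open_corner_def)
  show ?thesis
  proof (rule half_open_unique[of T "-1" "open_corner T" T'])
    show "half_open (- 1) T \<subseteq> supp (open_corner T)" "supp (open_corner T) \<subseteq> T"
      using half_open_minus[OF assms(1)] supp[of T] by auto
    show "half_open (- 1) T' \<subseteq> supp (open_corner T)" "supp (open_corner T) \<subseteq> T'"
      using half_open_minus[OF assms(2)] supp[of T'] assms(3) by auto
  qed (use assms open_corner in auto)
qed

text \<open>The standard representative dominates, entry by entry, the corner of the simplex
  containing it; if the totals agree, so do the vectors.\<close>

lemma interior_degree_ge:
  assumes "c \<in> effective_vec E" "interior c"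
  shows "sum c E \<ge> int rank - int max_removed"
    and "sum c E = int rank - int max_removed \<Longrightarrow>
      \<exists>T. facet T \<and> card (half_open 1 T) = max_removed \<and> bd c = bd (open_corner T)"
proof -
  obtain d where d: "d \<in> standard" "bd d = bd c" using standard_exists[OF assms(1)] .
  have de: "d \<in> effective_vec E" using d by (simp add: standard_def)
  have "interior d" using interior_cong[OF assms(1) de] d assms(2) by simp
  then obtain T where T: "facet T" "T - half_open 1 T \<subseteq> supp d" "supp d \<subseteq> T"
    using interior_iff_facet[OF d(1)] by blast
  have nn: "d e \<ge> 0" for e using de by (simp add: effective_vec_def)
  have le: "open_corner T e \<le> d e" for e
  proof (cases "e \<in> T - half_open 1 T")
    case True
    then have "d e \<noteq> 0" using T by (auto simp: supp_def)
    then show ?thesis using nn[of e] by (auto simp: open_corner_def)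
  qed (use nn in \<open>auto simp: open_corner_def\<close>)
  have s: "sum c E = sum d E" using sum_cong_bd[OF d(2)] by simp
  have c1: "sum (open_corner T) E \<le> sum c E" unfolding s by (intro sum_mono le)
  have c2: "int rank - int max_removed \<le> sum (open_corner T) E"
    using open_corner(3)[OF T(1)] max_removed(1)[OF T(1)] by simp
  show "sum c E \<ge> int rank - int max_removed" using c1 c2 by simp
  assume eq: "sum c E = int rank - int max_removed"
  then have "sum (open_corner T) E = sum d E" using c1 c2 s by simp
  then have "open_corner T e = d e" if "e \<in> E" for e
    using sum_mono_inv[of "open_corner T" E d] le that finite_E by simp
  moreover have "open_corner T e = d e" if "e \<notin> E" for e
    using that de facet_subset_E[OF T(1)] by (auto simp: effective_vec_def vec_def open_corner_def)
  ultimately have "open_corner T = d" by blast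
  moreover have "card (half_open 1 T) = max_removed"
    using eq c1 c2 open_corner(3)[OF T(1)] by simp
  ultimately show "\<exists>T. facet T \<and> card (half_open 1 T) = max_removed \<and> bd c = bd (open_corner T)"
    using T d by metis
qed

lemma min_interior_open_corner:
  assumes "facet T" "card (half_open 1 T) = max_removed"
  shows "min_interior (open_corner T)"
  using open_corner[OF assms(1)] assms(2) interior_degree_ge(1)
  by (auto simp: min_interior_def standard_def)

lemma min_interior_exists: "\<exists>c. min_interior c"
  using max_removed(2) min_interior_open_corner by blast

text \<open>Taking corners matches the facets with the most removed walls with the classes of least
  interior points: \<open>open_corner_inj\<close> gives injectivity and
  \<open>interior_degree_ge\<close> surjectivity.\<close>

lemma lead_coeff_h_numerator_eq_1_iff:
  "lead_coeff h_numerator = 1 \<longleftrightarrow> (\<forall>c d. min_interior c \<and> min_interior d \<longrightarrow> bd c = bd d)"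
proof -
  let ?M = "{T. facet T \<and> card (half_open 1 T) = max_removed}"
  have "lead_coeff h_numerator = 1 \<longleftrightarrow> card ?M = 1"
    unfolding lead_coeff_h_numerator by (rule of_nat_eq_1_iff)
  also have "\<dots> \<longleftrightarrow> (\<forall>c d. min_interior c \<and> min_interior d \<longrightarrow> bd c = bd d)"
  proof
    assume "card ?M = 1"
    then obtain T where T: "?M = {T}" by (auto simp: card_1_singleton_iff)
    have "bd c = bd (open_corner T)" if c: "min_interior c" for c
    proof -
      have "sum c E \<ge> int rank - int max_removed"
        using c interior_degree_ge(1) by (auto simp: min_interior_def)
      moreover have "T \<in> ?M" using T by blast
      then have "sum c E \<le> int rank - int max_removed"
        using c open_corner[of T] by (auto simp: min_interior_def standard_def)
      ultimately obtain T' where "T' \<in> ?M" "bd c = bd (open_corner T')"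
        using c interior_degree_ge(2)[of c] by (auto simp: min_interior_def)
      with T show ?thesis by auto
    qed
    then show "\<forall>c d. min_interior c \<and> min_interior d \<longrightarrow> bd c = bd d" by metis
  next
    assume u: "\<forall>c d. min_interior c \<and> min_interior d \<longrightarrow> bd c = bd d"
    obtain T where T: "T \<in> ?M" using max_removed(2) by blast
    have "T' = T" if T': "T' \<in> ?M" for T'
    proof -
      have "bd (open_corner T') = bd (open_corner T)" using u T T' min_interior_open_corner by auto
      then have "open_corner T' = open_corner T" using T T' open_corner(1) standard_unique by auto
      then show ?thesis using T T' open_corner_inj by auto
    qed
    then have "?M = {T}" using T by blast
    then show "card ?M = 1" by simp
  qed
  finally show ?thesis .
qed

end

section \<open>Krull dimension of subrings of polynomial rings\<close>

definition unital_subring :: "'a::comm_ring_1 set \<Rightarrow> bool" where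
  "unital_subring C \<longleftrightarrow> 1 \<in> C \<and> (\<forall>x\<in>C. - x \<in> C) \<and> (\<forall>x\<in>C. \<forall>y\<in>C. x + y \<in> C) \<and> (\<forall>x\<in>C. \<forall>y\<in>C. x * y \<in> C)"

lemma unital_subringD:
  assumes "unital_subring C"
  shows "1 \<in> C" "0 \<in> C" "x \<in> C \<Longrightarrow> - x \<in> C" "x \<in> C \<Longrightarrow> y \<in> C \<Longrightarrow> x + y \<in> C"
    "x \<in> C \<Longrightarrow> y \<in> C \<Longrightarrow> x - y \<in> C" "x \<in> C \<Longrightarrow> y \<in> C \<Longrightarrow> x * y \<in> C" "x \<in> C \<Longrightarrow> x ^ n \<in> C"
    "(\<And>i. i \<in> I \<Longrightarrow> f i \<in> C) \<Longrightarrow> sum f I \<in> C"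
proof -
  show one: "1 \<in> C" and neg: "x \<in> C \<Longrightarrow> - x \<in> C" and add: "x \<in> C \<Longrightarrow> y \<in> C \<Longrightarrow> x + y \<in> C"
    and mult: "x \<in> C \<Longrightarrow> y \<in> C \<Longrightarrow> x * y \<in> C" for x y
    using assms by (auto simp: unital_subring_def)
  show zero: "0 \<in> C" using add[OF one neg[OF one]] by simp
  show "x \<in> C \<Longrightarrow> y \<in> C \<Longrightarrow> x - y \<in> C" using add[of x "- y"] neg[of y] by simp
  show "x \<in> C \<Longrightarrow> x ^ n \<in> C" by (induction n) (auto intro: one mult)
  show "(\<And>i. i \<in> I \<Longrightarrow> f i \<in> C) \<Longrightarrow> sum f I \<in> C"
    by (induction I rule: infinite_finite_induct) (auto intro: zero add)
qed

abbreviation subalgebra_ring :: "'a::comm_ring_1 set \<Rightarrow> 'a ring" where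
  "subalgebra_ring C \<equiv> ring_of_type_algebra\<lparr>carrier := C\<rparr>"

lemma subalgebra_ring_simps [simp]:
  "carrier (subalgebra_ring C) = C" "monoid.mult (subalgebra_ring C) = (*)" "one (subalgebra_ring C) = 1"
  "zero (subalgebra_ring C) = 0" "add (subalgebra_ring C) = (+)"
  by (simp_all add: ring_of_type_algebra_def fun_eq_iff)

lemma cring_subalgebra_ring:
  assumes "unital_subring C"
  shows "cring (subalgebra_ring C)"
proof -
  note [intro] = unital_subringD[OF assms]
  have "\<exists>y\<in>C. y + x = 0" if "x \<in> C" for x using that by (intro bexI[of _ "- x"]) auto
  then show ?thesis
    by (intro cringI abelian_groupI comm_monoidI) (auto simp: algebra_simps)
qed

text \<open>Plain closure conditions on a subset of the ambient ring type, so that kernels and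
  chains can be treated with the type class operations; \<open>primeideal_subalgebra_ring\<close>
  translates.\<close>

definition prime_in :: "'a::comm_ring_1 set \<Rightarrow> 'a set \<Rightarrow> bool" where
  "prime_in P C \<longleftrightarrow> P \<subseteq> C \<and> 0 \<in> P \<and> (\<forall>x\<in>P. \<forall>y\<in>P. x + y \<in> P) \<and> (\<forall>x\<in>C. \<forall>y\<in>P. x * y \<in> P) \<and>
     1 \<notin> P \<and> (\<forall>x\<in>C. \<forall>y\<in>C. x * y \<in> P \<longrightarrow> x \<in> P \<or> y \<in> P)"

lemma primeideal_subalgebra_ring:
  assumes C: "unital_subring C"
  shows "primeideal P (subalgebra_ring C) \<longleftrightarrow> prime_in P C"
proof
  assume "primeideal P (subalgebra_ring C)"
  then interpret primeideal P "subalgebra_ring C" .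
  have "1 \<notin> P" using one_imp_carrier I_notcarr by auto
  then show "prime_in P C"
    using a_subset additive_subgroup.zero_closed[OF additive_subgroup_axioms]
      additive_subgroup.a_closed[OF additive_subgroup_axioms] I_l_closed I_prime
    unfolding prime_in_def by auto
next
  assume P: "prime_in P C"
  interpret cring "subalgebra_ring C" using cring_subalgebra_ring[OF C] .
  have neg: "- x \<in> P" if "x \<in> P" for x
  proof -
    have "(-1) * x \<in> P" using P that unital_subringD(1,3)[OF C] unfolding prime_in_def by blast
    then show ?thesis by simp
  qed
  have PC: "P \<subseteq> C" using P by (simp add: prime_in_def)
  have "\<ominus>\<^bsub>subalgebra_ring C\<^esub> x = - x" if "x \<in> C" for x
    using that unital_subringD(3)[OF C] by (intro minus_equality) auto
  then have inv: "inv\<^bsub>add_monoid (subalgebra_ring C)\<^esub> x = - x" if "x \<in> C" for x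
    using that by (simp add: a_inv_def)
  have "subgroup P (add_monoid (subalgebra_ring C))"
    using P PC neg inv by (intro subgroup.intro) (auto simp: prime_in_def)
  moreover have "a * x \<in> P" if "a \<in> P" "x \<in> C" for a x
    using P that unfolding prime_in_def by (metis mult.commute)
  ultimately show "primeideal P (subalgebra_ring C)"
    using P unital_subringD(1)[OF C]
    by (intro primeidealI idealI) (auto simp: prime_in_def ring_axioms cring_axioms)
qed

text \<open>One step of a chain of primes: the powers of \<open>a \<in> Q - P\<close> multiply a system that is independent
  modulo \<open>Q\<close> into one that is independent modulo \<open>P\<close>.  A chain of length \<open>n\<close> therefore forces growth of
  order at least \<open>n\<close>, without any transcendence theory.\<close>

lemma power_combination_in_prime:
  assumes C: "unital_subring C" and P: "prime_in P C" and Q: "prime_in Q C" and "P \<subseteq> Q"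
    and a: "a \<in> Q" "a \<notin> P"
  shows "(\<And>i. w i \<in> C) \<Longrightarrow> (\<And>i. w i \<in> Q \<Longrightarrow> w i = 0) \<Longrightarrow> (\<Sum>i\<le>m. a ^ i * w i) \<in> P \<Longrightarrow> i \<le> m \<Longrightarrow> w i = 0"
proof (induction m arbitrary: w i)
  case 0
  then show ?case using \<open>P \<subseteq> Q\<close> by auto
next
  case (Suc m)
  have aC: "a \<in> C" using a Q by (auto simp: prime_in_def)
  define s where "s = (\<Sum>i\<le>m. a ^ i * w (Suc i))"
  have sC: "s \<in> C" unfolding s_def using Suc.prems(1) aC unital_subringD[OF C] by (intro unital_subringD(8)[OF C]) auto
  have eq: "(\<Sum>i\<le>Suc m. a ^ i * w i) = w 0 + a * s"
    by (simp add: s_def sum.atMost_Suc_shift sum_distrib_left mult.assoc del: sum.atMost_Suc)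
  \<comment> \<open>Modulo \<open>Q\<close> the factor \<open>a\<close> kills everything but the
    constant term, so \<open>w 0\<close> lies in \<open>Q\<close> and vanishes. Cancelling
    \<open>a\<close>, which is outside the prime \<open>P\<close>, then lowers the degree.\<close>
  have "s * a \<in> Q" using Q a sC by (auto simp: prime_in_def)
  then have "(- 1) * (s * a) \<in> Q" using Q unital_subringD(1,3)[OF C] unfolding prime_in_def by blast
  moreover have "w 0 + a * s \<in> Q" using Suc.prems(3) eq \<open>P \<subseteq> Q\<close> by auto
  ultimately have "(w 0 + a * s) + (- 1) * (s * a) \<in> Q" using Q unfolding prime_in_def by blast
  then have w0: "w 0 = 0" using Suc.prems(2) by (simp add: mult.commute)
  then have "a * s \<in> P" using Suc.prems(3) eq by simp
  then have "s \<in> P" using P a aC sC by (auto simp: prime_in_def)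
  then have "w (Suc i) = 0" if "i \<le> m" for i
    using Suc.IH[of "w \<circ> Suc" i] Suc.prems(1,2) that by (simp add: s_def)
  then show ?case using w0 Suc.prems(4) by (cases i) auto
qed

fun list_monomial :: "'a::comm_monoid_mult list \<Rightarrow> nat list \<Rightarrow> 'a" where
  "list_monomial (a # as) (i # l) = a ^ i * list_monomial as l"
| "list_monomial _ _ = 1"

definition exponents :: "nat \<Rightarrow> nat \<Rightarrow> nat list set" where
  "exponents m n = {l. length l = n \<and> set l \<subseteq> {..m}}"

lemma finite_exponents: "finite (exponents m n)"
  using finite_lists_length_eq[of "{..m}" n] by (simp add: exponents_def conj_commute)

lemma card_exponents: "card (exponents m n) = (m + 1) ^ n"
  using card_lists_length_eq[of "{..m}" n] by (simp add: exponents_def conj_commute)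

lemma exponents_0: "exponents m 0 = {[]}"
  by (auto simp: exponents_def)

lemma exponents_Suc: "exponents m (Suc n) = (\<lambda>(i, l). i # l) ` ({..m} \<times> exponents m n)"
  by (auto simp: exponents_def length_Suc_conv image_iff)

lemma sum_exponents_Suc: "(\<Sum>l\<in>exponents m (Suc n). f l) = (\<Sum>i\<le>m. \<Sum>l\<in>exponents m n. f (i # l))"
  by (simp add: exponents_Suc sum.reindex inj_on_def sum.cartesian_product case_prod_unfold)

lemma list_monomial_in:
  assumes "unital_subring C" "set as \<subseteq> C"
  shows "list_monomial as l \<in> C"
  using assms(2) by (induction as l rule: list_monomial.induct) (auto intro: unital_subringD[OF assms(1)])

text \<open>Group the monomials by their exponent of \<open>a 0\<close>. The coefficients
  \<open>w i\<close> involve only later elements, and by induction they have zero scalars as soon as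
  they lie in \<open>P 1\<close>; this is the hypothesis that
  \<open>power_combination_in_prime\<close> needs for \<open>P 0\<close> and \<open>P 1\<close>. The
  base case holds because nonzero constants are units.\<close>

lemma chain_independent:
  fixes C :: "('v::linorder, 'k::field) mpoly set"
  assumes C: "unital_subring C" and const: "\<And>c. Const c \<in> C"
  shows "(\<And>i. i \<le> n \<Longrightarrow> prime_in (P i) C) \<Longrightarrow> (\<And>i. i < n \<Longrightarrow> P i \<subseteq> P (Suc i)) \<Longrightarrow>
    (\<And>i. i < n \<Longrightarrow> a i \<in> P (Suc i) - P i) \<Longrightarrow>
    (\<Sum>l\<in>exponents m n. Const (c l) * list_monomial (map a [0..<n]) l) \<in> P 0 \<Longrightarrow>
    l \<in> exponents m n \<Longrightarrow> c l = (0 :: 'k)"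
proof (induction n arbitrary: P a c l)
  case 0
  have P: "prime_in (P 0) C" using 0 by simp
  have c0: "Const (c []) \<in> P 0" using 0 by (simp add: exponents_0)
  have "c [] = 0"
  proof (rule ccontr)
    assume nz: "c [] \<noteq> 0"
    have "Const (inverse (c [])) * Const (c []) \<in> P 0" using P c0 const unfolding prime_in_def by blast
    moreover have "Const (inverse (c [])) * Const (c []) = (1 :: ('v, 'k) mpoly)"
      using nz by (simp add: Const_def mult_single)
    ultimately show False using P by (simp add: prime_in_def)
  qed
  then show ?case using 0 by (simp add: exponents_0)
next
  case (Suc n)
  let ?as = "map (a \<circ> Suc) [0..<n]"
  have map: "map a [0..<Suc n] = a 0 # ?as" by (simp add: upt_conv_Cons map_Suc_upt[symmetric] del: upt_Suc)
  define w where "w i = (\<Sum>l\<in>exponents m n. Const (c (i # l)) * list_monomial ?as l)" for i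
  have "a (Suc i) \<in> C" if "i < n" for i
    using Suc.prems(1)[of "Suc (Suc i)"] Suc.prems(3)[of "Suc i"] that by (auto simp: prime_in_def)
  then have asC: "set ?as \<subseteq> C" by auto
  have wC: "w i \<in> C" for i
    unfolding w_def using const list_monomial_in[OF C asC] unital_subringD(6)[OF C]
    by (intro unital_subringD(8)[OF C]) blast
  have wIH: "c (i # l) = 0" if "w i \<in> P 1" "l \<in> exponents m n" for i l
    using Suc.IH[of "P \<circ> Suc" "a \<circ> Suc" "\<lambda>l. c (i # l)" l] Suc.prems(1-3) that by (simp add: w_def o_def)
  have w0: "w i = 0" if "w i \<in> P 1" for i
    unfolding w_def using wIH[OF that] by (intro sum.neutral) (simp add: Const_def)
  have "(\<Sum>i\<le>m. a 0 ^ i * w i) = (\<Sum>l\<in>exponents m (Suc n). Const (c l) * list_monomial (map a [0..<Suc n]) l)"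
    unfolding map sum_exponents_Suc w_def by (simp add: sum_distrib_left mult_ac)
  also have "\<dots> \<in> P 0" by (rule Suc.prems(4))
  finally have in0: "(\<Sum>i\<le>m. a 0 ^ i * w i) \<in> P 0" .
  obtain i l' where l: "l = i # l'" "i \<le> m" "l' \<in> exponents m n" using Suc.prems(5) by (auto simp: exponents_Suc)
  have "w i = 0"
    using power_combination_in_prime[OF C, of "P 0" "P 1" "a 0" w m i] Suc.prems(1)[of 0] Suc.prems(1)[of 1]
      Suc.prems(2)[of 0] Suc.prems(3)[of 0] wC w0 in0 l(2) by simp
  moreover have "0 \<in> P 1" using Suc.prems(1)[of 1] by (simp add: prime_in_def)
  ultimately show ?case using wIH[of i l'] l by simp
qed

lemma mpoly_expansion:
  assumes "finite S" "Poly_Mapping.keys p \<subseteq> S"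
  shows "p = (\<Sum>x\<in>S. Poly_Mapping.single x (Poly_Mapping.lookup p x))"
proof (rule poly_mapping_eqI)
  fix k
  show "Poly_Mapping.lookup p k = Poly_Mapping.lookup (\<Sum>x\<in>S. Poly_Mapping.single x (Poly_Mapping.lookup p x)) k"
    using assms by (auto simp: lookup_sum lookup_single when_def in_keys_iff)
qed

interpretation mpoly: vector_space "mpoly_scale :: 'k::field \<Rightarrow> ('v, 'k) mpoly \<Rightarrow> _"
  by (rule vector_space_mpoly_scale)

lemma mpoly_scale_single: "mpoly_scale c (Poly_Mapping.single x d) = Poly_Mapping.single x (c * d)"
  by (simp add: mpoly_scale_def Const_def mult_single)

lemma mpoly_in_span:
  fixes p :: "('v, 'k::field) mpoly"
  assumes "Poly_Mapping.keys p \<subseteq> S"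
  shows "p \<in> mpoly.span ((\<lambda>x. Poly_Mapping.single x 1) ` S)"
proof -
  have "p = (\<Sum>x\<in>Poly_Mapping.keys p. mpoly_scale (Poly_Mapping.lookup p x) (Poly_Mapping.single x 1))"
    using mpoly_expansion[OF _ order_refl, of p] by (simp add: mpoly_scale_single)
  also have "\<dots> \<in> mpoly.span ((\<lambda>x. Poly_Mapping.single x 1) ` S)"
    using assms by (intro mpoly.span_sum mpoly.span_scale mpoly.span_base) auto
  finally show ?thesis .
qed

lemma keys_list_monomial:
  fixes as :: "('v::linorder, 'k::field) mpoly list"
  assumes dg: "dg 0 = (0::nat)" "\<And>x y. dg (x + y) = dg x + dg y"
    and B: "\<And>a x. a \<in> set as \<Longrightarrow> x \<in> Poly_Mapping.keys a \<Longrightarrow> dg x \<le> B"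
  shows "length l = length as \<Longrightarrow> set l \<subseteq> {..m} \<Longrightarrow> x \<in> Poly_Mapping.keys (list_monomial as l) \<Longrightarrow>
    dg x \<le> length as * (m * B)"
  using B
proof (induction as l arbitrary: x rule: list_monomial.induct)
  case (1 a as i l)
  have pow: "x \<in> Poly_Mapping.keys (a ^ j) \<Longrightarrow> dg x \<le> j * B" for j x
  proof (induction j arbitrary: x)
    case 0
    then show ?case using dg by simp
  next
    case (Suc j)
    then obtain y z where "x = y + z" "y \<in> Poly_Mapping.keys a" "z \<in> Poly_Mapping.keys (a ^ j)"
      using keys_mult[of a "a ^ j"] by auto
    then show ?case using Suc.IH[of z] 1(5)[of a y] dg by simp
  qed
  obtain y z where x: "x = y + z" "y \<in> Poly_Mapping.keys (a ^ i)" "z \<in> Poly_Mapping.keys (list_monomial as l)"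
    using 1(4) keys_mult[of "a ^ i" "list_monomial as l"] by auto
  have "dg z \<le> length as * (m * B)" using 1 x by auto
  moreover have "i * B \<le> m * B" using 1(3) by simp
  then have "dg y \<le> m * B" using pow[OF x(2)] by (rule order_trans[rotated])
  ultimately show ?case using x(1) dg(2)[of y z] by simp
qed (use dg in auto)

lemma polynomial_growth_bound:
  fixes D n F c :: nat
  assumes "\<And>m. (m + 1) ^ n \<le> F * (c * m + 1) ^ D"
  shows "n \<le> D"
proof (rule ccontr)
  assume "\<not> n \<le> D"
  \<comment> \<open>With this \<open>m\<close> the right side is at most
    \<open>m * (m + 1) ^ D\<close>, while the left side is at least
    \<open>(m + 1) * (m + 1) ^ D\<close> once \<open>n > D\<close>.\<close>
  define m where "m = F * (c + 1) ^ D"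
  have "(m + 1) * (m + 1) ^ D = (m + 1) ^ Suc D" by simp
  also have "\<dots> \<le> (m + 1) ^ n" using \<open>\<not> n \<le> D\<close> by (intro power_increasing) auto
  also have "\<dots> \<le> F * (c * m + 1) ^ D" by (rule assms)
  also have "\<dots> \<le> F * ((c + 1) * (m + 1)) ^ D" by (intro mult_left_mono power_mono) (auto simp: algebra_simps)
  also have "\<dots> = m * (m + 1) ^ D" by (simp only: power_mult_distrib mult.assoc[symmetric] m_def[symmetric])
  finally show False by simp
qed

text \<open>Picking one element from each \<open>P (Suc i) - P i\<close> gives
  \<open>(m + 1) ^ n\<close> linearly independent monomials in these elements. With \<open>B\<close>
  bounding the degrees of the chosen elements, they all live in degree at most
  \<open>n * (m * B)\<close>, where the dimension grows only with order \<open>D\<close>.\<close>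

lemma chain_length_le:
  fixes C :: "('v::linorder, 'k::field) mpoly set" and dg :: "('v \<Rightarrow>\<^sub>0 nat) \<Rightarrow> nat"
  assumes C: "unital_subring C" and const: "\<And>c. Const c \<in> C"
    and keys: "\<And>p. p \<in> C \<Longrightarrow> Poly_Mapping.keys p \<subseteq> M"
    and dg: "dg 0 = 0" "\<And>x y. dg (x + y) = dg x + dg y"
    and growth: "\<And>N. finite {x \<in> M. dg x \<le> N}" "\<And>N. card {x \<in> M. dg x \<le> N} \<le> F * (N + 1) ^ D"
    and P: "\<And>i. i \<le> n \<Longrightarrow> prime_in (P i) C" "\<And>i. i < n \<Longrightarrow> P i \<subset> P (Suc i)"
  shows "n \<le> D"
proof -
  have "\<forall>i\<in>{..<n}. \<exists>a. a \<in> P (Suc i) - P i" using P(2) by blast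
  from bchoice[OF this] obtain a where a: "\<And>i. i < n \<Longrightarrow> a i \<in> P (Suc i) - P i" by auto
  let ?as = "map a [0..<n]"
  have "a i \<in> C" if "i < n" for i
    using a[OF that] P(1)[of "Suc i"] that by (auto simp: prime_in_def)
  then have asC: "set ?as \<subseteq> C" by auto
  define B where "B = Max (insert 0 (\<Union>p\<in>set ?as. dg ` Poly_Mapping.keys p))"
  have B: "k \<le> B" if "k \<in> (\<Union>p\<in>set ?as. dg ` Poly_Mapping.keys p)" for k
    unfolding B_def using that by (intro Max_ge) auto
  have "(m + 1) ^ n \<le> F * ((n * B) * m + 1) ^ D" for m
  proof -
    let ?b = "list_monomial ?as" and ?I = "exponents m n"
    define N where "N = n * (m * B)"
    have P0: "0 \<in> P 0" using P(1)[of 0] by (simp add: prime_in_def)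
    have indep: "c l = 0" if "(\<Sum>l\<in>?I. Const (c l) * ?b l) = 0" "l \<in> ?I" for c :: "nat list \<Rightarrow> 'k" and l
    proof (rule chain_independent[OF C const, where n = n and P = P and a = a and m = m and c = c and l = l])
      show "(\<Sum>l\<in>?I. Const (c l) * ?b l) \<in> P 0" unfolding that(1) by (rule P0)
    qed (use P a that(2) in blast)+
    have inj: "inj_on ?b ?I"
    proof (rule inj_onI, rule ccontr)
      fix l l' assume l: "l \<in> ?I" "l' \<in> ?I" "?b l = ?b l'" "l \<noteq> l'"
      define c where "c j = (if j = l then 1 else if j = l' then -1 else 0 :: 'k)" for j
      have "(\<Sum>j\<in>?I. Const (c j) * ?b j) = (\<Sum>j\<in>{l, l'}. Const (c j) * ?b j)"
        using l finite_exponents by (intro sum.mono_neutral_right) (auto simp: c_def Const_def)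
      also have "\<dots> = 0" using l by (simp add: c_def Const_def single_uminus)
      finally show False using indep[of c l] l by (simp add: c_def)
    qed
    have ind: "mpoly.independent (?b ` ?I)"
    proof (rule mpoly.independent_if_scalars_zero)
      show "finite (?b ` ?I)" using finite_exponents by simp
      fix f :: "('v, 'k) mpoly \<Rightarrow> 'k" and x
      assume s: "(\<Sum>x\<in>?b ` ?I. mpoly_scale (f x) x) = 0" and x: "x \<in> ?b ` ?I"
      then obtain l where l: "l \<in> ?I" "x = ?b l" by blast
      have "(\<Sum>l\<in>?I. Const (f (?b l)) * ?b l) = 0" using s inj by (simp add: sum.reindex mpoly_scale_def)
      then show "f x = 0" using indep[of "\<lambda>l. f (?b l)" l] l by simp
    qed
    let ?S = "{x \<in> M. dg x \<le> N}"
    have "?b ` ?I \<subseteq> mpoly.span ((\<lambda>x. Poly_Mapping.single x 1) ` ?S)"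
    proof (rule image_subsetI)
      fix l assume l: "l \<in> ?I"
      have "Poly_Mapping.keys (?b l) \<subseteq> ?S"
      proof
        fix x assume x: "x \<in> Poly_Mapping.keys (?b l)"
        have "x \<in> M" using keys[OF list_monomial_in[OF C asC]] x by blast
        moreover have "dg x \<le> length ?as * (m * B)"
        proof (rule keys_list_monomial[of dg ?as B l m x])
          show "dg x \<le> B" if "a \<in> set ?as" "x \<in> Poly_Mapping.keys a" for a x using B that by blast
        qed (use dg l x in \<open>auto simp: exponents_def\<close>)
        ultimately show "x \<in> ?S" by (simp add: N_def)
      qed
      then show "?b l \<in> mpoly.span ((\<lambda>x. Poly_Mapping.single x 1) ` ?S)" by (rule mpoly_in_span)
    qed
    then have "card (?b ` ?I) \<le> card ((\<lambda>x. Poly_Mapping.single x (1::'k)) ` ?S)"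
      using mpoly.independent_span_bound[OF _ ind] growth(1) by blast
    also have "\<dots> \<le> card ?S" using growth(1) by (rule card_image_le)
    also have "\<dots> \<le> F * (N + 1) ^ D" by (rule growth(2))
    finally show ?thesis using inj by (simp add: card_image card_exponents N_def algebra_simps)
  qed
  then show ?thesis by (rule polynomial_growth_bound)
qed

section \<open>Maps of monoid algebras and chains of kernels\<close>

definition push :: "('m \<Rightarrow> 'n) \<Rightarrow> ('m \<Rightarrow>\<^sub>0 'k) \<Rightarrow> ('n \<Rightarrow>\<^sub>0 'k::comm_ring_1)" where
  "push \<pi> p = (\<Sum>x\<in>Poly_Mapping.keys p. Poly_Mapping.single (\<pi> x) (Poly_Mapping.lookup p x))"

lemma push_superset:
  "finite S \<Longrightarrow> Poly_Mapping.keys p \<subseteq> S \<Longrightarrow> push \<pi> p = (\<Sum>x\<in>S. Poly_Mapping.single (\<pi> x) (Poly_Mapping.lookup p x))"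
  unfolding push_def by (rule sum.mono_neutral_left) (auto simp: in_keys_iff)

lemma push_zero [simp]: "push \<pi> 0 = 0"
  by (simp add: push_def)

lemma push_single [simp]: "push \<pi> (Poly_Mapping.single x c) = Poly_Mapping.single (\<pi> x) c"
  by (subst push_superset[of "{x}"]) auto

lemma push_add: "push \<pi> (p + q) = push \<pi> p + push \<pi> q"
proof -
  let ?S = "Poly_Mapping.keys p \<union> Poly_Mapping.keys q"
  have "push \<pi> (p + q) = (\<Sum>x\<in>?S. Poly_Mapping.single (\<pi> x) (Poly_Mapping.lookup (p + q) x))"
    using keys_add[of p q] by (intro push_superset) auto
  also have "\<dots> = push \<pi> p + push \<pi> q"
    by (simp add: push_superset[of ?S] lookup_add single_add sum.distrib)
  finally show ?thesis .
qed

lemma push_sum: "push \<pi> (sum f I) = (\<Sum>i\<in>I. push \<pi> (f i))"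
  by (induction I rule: infinite_finite_induct) (simp_all add: push_add)

lemma push_push: "push \<rho> (push \<pi> p) = push (\<rho> \<circ> \<pi>) p"
  by (simp add: push_def[of \<pi>] push_sum) (simp add: push_def)

text \<open>Additivity of \<open>\<pi>\<close> is asked only on a set \<open>M\<close>, because the
  coordinate map to which this is applied is meaningful only on monomials of the edge ring.\<close>

lemma push_mult:
  assumes "\<And>x y. x \<in> M \<Longrightarrow> y \<in> M \<Longrightarrow> \<pi> (x + y) = \<pi> x + \<pi> y"
    and "Poly_Mapping.keys p \<subseteq> M" "Poly_Mapping.keys q \<subseteq> M"
  shows "push \<pi> (p * q) = push \<pi> p * push \<pi> q"
proof -
  let ?P = "Poly_Mapping.keys p" and ?Q = "Poly_Mapping.keys q"
  have "p * q = (\<Sum>x\<in>?P. Poly_Mapping.single x (Poly_Mapping.lookup p x)) * (\<Sum>y\<in>?Q. Poly_Mapping.single y (Poly_Mapping.lookup q y))"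
    using mpoly_expansion[of ?P p] mpoly_expansion[of ?Q q] by simp
  also have "\<dots> = (\<Sum>x\<in>?P. \<Sum>y\<in>?Q. Poly_Mapping.single (x + y) (Poly_Mapping.lookup p x * Poly_Mapping.lookup q y))"
    by (simp add: sum_product mult_single)
  finally have "push \<pi> (p * q) = (\<Sum>x\<in>?P. \<Sum>y\<in>?Q. Poly_Mapping.single (\<pi> (x + y)) (Poly_Mapping.lookup p x * Poly_Mapping.lookup q y))"
    by (simp add: push_sum)
  also have "\<dots> = (\<Sum>x\<in>?P. \<Sum>y\<in>?Q. Poly_Mapping.single (\<pi> x + \<pi> y) (Poly_Mapping.lookup p x * Poly_Mapping.lookup q y))"
    using assms by (intro sum.cong) (auto simp: subset_iff)
  also have "\<dots> = push \<pi> p * push \<pi> q" by (simp add: push_def sum_product mult_single)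
  finally show ?thesis .
qed

text \<open>The projections of Z^D onto its first \<open>j\<close> coordinates, modelled inside a
  single type. All targets of \<open>push\<close> are then the same Laurent polynomial ring, an
  integral domain; exponents are integers because coordinates in a lattice basis can be
  negative.\<close>

definition truncate :: "nat \<Rightarrow> (nat \<Rightarrow>\<^sub>0 int) \<Rightarrow> (nat \<Rightarrow>\<^sub>0 int)" where
  "truncate j z = (\<Sum>i<j. Poly_Mapping.single i (Poly_Mapping.lookup z i))"

lemma truncate_add: "truncate j (y + z) = truncate j y + truncate j z"
  by (simp add: truncate_def lookup_add single_add sum.distrib)

lemma truncate_0 [simp]: "truncate j 0 = 0"
  by (simp add: truncate_def)

lemma truncate_single: "truncate j (Poly_Mapping.single i x) = (if i < j then Poly_Mapping.single i x else 0)"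
proof -
  have "truncate j (Poly_Mapping.single i x) = (\<Sum>k<j. if k = i then Poly_Mapping.single i x else 0)"
    unfolding truncate_def by (intro sum.cong) (auto simp: lookup_single)
  then show ?thesis by simp
qed

lemma lookup_truncate: "Poly_Mapping.lookup (truncate j z) i = (if i < j then Poly_Mapping.lookup z i else 0)"
  by (simp add: truncate_def lookup_sum lookup_single when_def)

lemma truncate_truncate: "truncate j (truncate (Suc j) z) = truncate j z"
  by (rule poly_mapping_eqI) (simp add: lookup_truncate)

text \<open>Reading only the first \<open>j\<close> coordinates is a homomorphism into a domain, so
  its kernel is prime. Kernels grow as \<open>j\<close> shrinks, strictly: the monomial with
  exponent \<open>x j\<close>, minus 1, is killed once coordinate \<open>j\<close> is forgotten, but
  not before.\<close>

lemma chain_of_kernels: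
  fixes C :: "('v::linorder, 'k::field) mpoly set" and \<pi> :: "('v \<Rightarrow>\<^sub>0 nat) \<Rightarrow> (nat \<Rightarrow>\<^sub>0 int)"
  assumes C: "unital_subring C"
    and keys: "\<And>p. p \<in> C \<Longrightarrow> Poly_Mapping.keys p \<subseteq> M"
    and \<pi>: "\<pi> 0 = 0" "\<And>x y. x \<in> M \<Longrightarrow> y \<in> M \<Longrightarrow> \<pi> (x + y) = \<pi> x + \<pi> y"
    and x: "\<And>i. i < D \<Longrightarrow> Poly_Mapping.single (x i) 1 \<in> C" "\<And>i. i < D \<Longrightarrow> \<pi> (x i) = Poly_Mapping.single i 1"
  obtains P where "\<And>i. i \<le> D \<Longrightarrow> prime_in (P i) C" "\<And>i. i < D \<Longrightarrow> P i \<subset> P (Suc i)"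
proof -
  define ker where "ker j = {p \<in> C. push (truncate j \<circ> \<pi>) p = 0}" for j
  have one: "push (truncate j \<circ> \<pi>) 1 = (1 :: (nat \<Rightarrow>\<^sub>0 int) \<Rightarrow>\<^sub>0 'k)" for j
    using push_single[of "truncate j \<circ> \<pi>" 0 "1::'k"] \<pi> by (simp add: single_one)
  have mult: "push (truncate j \<circ> \<pi>) (p * q) = push (truncate j \<circ> \<pi>) p * push (truncate j \<circ> \<pi>) q"
    if "p \<in> C" "q \<in> C" for p q j
    using keys that \<pi>(2) by (intro push_mult[of M]) (auto simp: truncate_add)
  have prime: "prime_in (ker j) C" for j
    unfolding prime_in_def using unital_subringD[OF C]
    by (auto simp: ker_def push_add mult one)
  have "ker (Suc j) \<subset> ker j" if j: "j < D" for j
  proof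
    show "ker (Suc j) \<subseteq> ker j"
    proof
      fix p assume p: "p \<in> ker (Suc j)"
      have "push (truncate j \<circ> \<pi>) p = push (truncate j) (push (truncate (Suc j) \<circ> \<pi>) p)"
        by (simp add: push_push o_def truncate_truncate)
      then show "p \<in> ker j" using p by (simp add: ker_def)
    qed
    let ?p = "Poly_Mapping.single (x j) 1 + - 1 :: ('v, 'k) mpoly"
    have pC: "?p \<in> C" using x(1)[OF j] unital_subringD[OF C] by blast
    have z: "1 + Poly_Mapping.single 0 (- 1) = (0 :: (nat \<Rightarrow>\<^sub>0 int) \<Rightarrow>\<^sub>0 'k)" by (simp add: single_uminus)
    have m1: "- 1 = (Poly_Mapping.single 0 (- 1) :: ('v, 'k) mpoly)" by (simp add: single_uminus)
    have "?p \<in> ker j" using pC j x(2)[OF j] \<pi>(1)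
      by (simp add: ker_def push_add m1 truncate_single z)
    moreover have "?p \<notin> ker (Suc j)"
    proof
      assume "?p \<in> ker (Suc j)"
      then have "Poly_Mapping.single (Poly_Mapping.single j (1::int)) (1::'k) + Poly_Mapping.single 0 (- 1) = 0"
        using x(2)[OF j] \<pi>(1) by (simp add: ker_def push_add m1 truncate_single)
      then have "Poly_Mapping.lookup (Poly_Mapping.single (Poly_Mapping.single j (1::int)) (1::'k) + Poly_Mapping.single 0 (- 1)) 0 = 0"
        by simp
      then show False by (simp add: lookup_add lookup_single when_def)
    qed
    ultimately show "ker (Suc j) \<noteq> ker j" by blast
  qed
  then have "ker (D - i) \<subset> ker (D - Suc i)" if "i < D" for i
    using that Suc_diff_Suc[OF that] diff_Suc_less[of D i] by (metis gr_implies_not0 neq0_conv)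
  then show thesis using that[of "\<lambda>i. ker (D - i)"] prime by blast
qed

lemma krull_dim_eqI:
  assumes C: "unital_subring C"
    and "\<And>i. i \<le> D \<Longrightarrow> prime_in (P i) C" "\<And>i. i < D \<Longrightarrow> P i \<subset> P (Suc i)"
    and le: "\<And>n P. (\<And>i. i \<le> n \<Longrightarrow> prime_in (P i) C) \<Longrightarrow> (\<And>i. i < n \<Longrightarrow> P i \<subset> P (Suc i)) \<Longrightarrow> n \<le> D"
  shows "krull_dim (subalgebra_ring C) = enat D"
  unfolding krull_dim_def primeideal_subalgebra_ring[OF C]
proof (rule Sup_eqI)
  fix y assume "y \<in> {enat n | n. \<exists>P. (\<forall>i\<le>n. prime_in (P i) C) \<and> (\<forall>i<n. P i \<subset> P (Suc i))}"
  then obtain n P where "y = enat n" "\<forall>i\<le>n. prime_in (P i) C" "\<forall>i<n. P i \<subset> P (Suc i)" by blast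
  with le[of n P] show "y \<le> enat D" by simp
next
  fix y assume "\<And>z. z \<in> {enat n | n. \<exists>P. (\<forall>i\<le>n. prime_in (P i) C) \<and> (\<forall>i<n. P i \<subset> P (Suc i))} \<Longrightarrow> z \<le> y"
  then show "enat D \<le> y" using assms(2,3) by blast
qed

section \<open>The edge ring of a bipartite graph\<close>

abbreviation edge_ring_carrier :: "'v graph \<Rightarrow> ('v, 'k::field) mpoly set" where
  "edge_ring_carrier G \<equiv> generate_ring ring_of_type_algebra (range Const \<union> edge_monomial ` Edges G)"

lemma a_inv_type_algebra: "\<ominus>\<^bsub>ring_of_type_algebra\<^esub> x = - (x :: 'a::comm_ring_1)"
proof -
  interpret cring "ring_of_type_algebra :: 'a ring" by (rule cring_from_type_algebra)
  show ?thesis by (rule minus_equality) (auto simp: ring_of_type_algebra_def)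
qed

lemma unital_subring_generate_ring:
  "unital_subring (generate_ring (ring_of_type_algebra :: 'a::comm_ring_1 ring) H)"
  using generate_ring.intros[where R = ring_of_type_algebra and H = H]
  by (auto simp: unital_subring_def a_inv_type_algebra) (auto simp: ring_of_type_algebra_def)

lemma independent_monomials:
  fixes S :: "('v \<Rightarrow>\<^sub>0 nat) set"
  shows "finite S \<Longrightarrow> mpoly.independent ((\<lambda>x. Poly_Mapping.single x (1::'k::field)) ` S)"
proof (rule mpoly.independent_if_scalars_zero)
  fix f :: "('v, 'k) mpoly \<Rightarrow> 'k" and p
  assume S: "finite S" and s: "(\<Sum>p\<in>(\<lambda>x. Poly_Mapping.single x (1::'k)) ` S. mpoly_scale (f p) p) = 0"
    and p: "p \<in> (\<lambda>x. Poly_Mapping.single x (1::'k)) ` S"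
  then obtain y where y: "y \<in> S" "p = Poly_Mapping.single y 1" by blast
  have inj: "inj_on (\<lambda>x. Poly_Mapping.single x (1::'k)) S"
    by (rule inj_onI) (metis keys_single singleton_inject zero_neq_one)
  have "0 = (\<Sum>x\<in>S. Poly_Mapping.single x (f (Poly_Mapping.single x 1)))"
    using s inj by (simp add: sum.reindex mpoly_scale_single)
  then have "0 = Poly_Mapping.lookup (\<Sum>x\<in>S. Poly_Mapping.single x (f (Poly_Mapping.single x 1))) y"
    by simp
  also have "\<dots> = f p" using S y by (simp add: lookup_sum lookup_single when_def)
  finally show "f p = 0" by simp
qed simp

locale bipartite_network = weighted_network "Edges G" \<alpha> \<beta> q
  for G :: "'v::linorder graph" and \<alpha> \<beta> :: "'v set \<Rightarrow> 'v" and q +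
  assumes edge_ends: "\<And>e. e \<in> Edges G \<Longrightarrow> e = {\<alpha> e, \<beta> e}"
begin

abbreviation E where "E \<equiv> Edges G"

definition expo :: "('v set \<Rightarrow> int) \<Rightarrow> ('v \<Rightarrow>\<^sub>0 nat)" where
  "expo c = (\<Sum>e\<in>E. Poly_Mapping.single (\<alpha> e) (nat (c e)) + Poly_Mapping.single (\<beta> e) (nat (c e)))"

definition deg :: "('v set \<Rightarrow> int) \<Rightarrow> 'v \<Rightarrow> int" where
  "deg c v = (\<Sum>e\<in>E. c e * of_bool (v \<in> e))"

lemma mem_edge: "e \<in> E \<Longrightarrow> v \<in> e \<longleftrightarrow> \<alpha> e = v \<or> \<beta> e = v"
  using arg_cong[OF edge_ends, of e "\<lambda>x. v \<in> x"] by auto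

lemma tail_not_head: "e \<in> E \<Longrightarrow> \<beta> e \<notin> \<alpha> ` E"
  using bipartite_ends imageI[of e E \<beta>] by (metis IntI empty_iff)

lemma ends_distinct: "e \<in> E \<Longrightarrow> f \<in> E \<Longrightarrow> \<alpha> e \<noteq> \<beta> f"
  using tail_not_head by (metis imageI)

lemma bd_eq_deg: "bd c v = (if v \<in> \<alpha> ` E then deg c v else - deg c v)"
proof (cases "v \<in> \<alpha> ` E")
  case True
  then have "\<beta> e \<noteq> v" if "e \<in> E" for e using that tail_not_head by metis
  then show ?thesis using True unfolding bd_def deg_def by (auto intro!: sum.cong simp: mem_edge)
next
  case False
  then have "\<alpha> e \<noteq> v" if "e \<in> E" for e using that by blast
  then show ?thesis using False unfolding bd_def deg_def
    by (auto intro!: sum.cong simp: mem_edge simp flip: sum_negf)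
qed

lemma bd_eq_iff_deg: "bd c = bd d \<longleftrightarrow> deg c = deg d"
proof -
  have "bd c v = bd d v \<longleftrightarrow> deg c v = deg d v" for v by (simp add: bd_eq_deg)
  then show ?thesis by (simp add: fun_eq_iff)
qed

lemma lookup_expo:
  assumes "c \<in> effective_vec E"
  shows "int (Poly_Mapping.lookup (expo c) v) = deg c v"
proof -
  have "int (Poly_Mapping.lookup (expo c) v) =
      (\<Sum>e\<in>E. int (Poly_Mapping.lookup (Poly_Mapping.single (\<alpha> e) (nat (c e))) v) +
        int (Poly_Mapping.lookup (Poly_Mapping.single (\<beta> e) (nat (c e))) v))"
    by (simp add: expo_def lookup_sum lookup_add)
  also have "\<dots> = deg c v"
    unfolding deg_def
  proof (rule sum.cong[OF refl])
    fix e assume e: "e \<in> E"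
    have "c e \<ge> 0" using assms by (simp add: effective_vec_def)
    then show "int (Poly_Mapping.lookup (Poly_Mapping.single (\<alpha> e) (nat (c e))) v) +
        int (Poly_Mapping.lookup (Poly_Mapping.single (\<beta> e) (nat (c e))) v) = c e * of_bool (v \<in> e)"
      using ends_distinct[OF e e] e by (auto simp: lookup_single when_def mem_edge)
  qed
  finally show ?thesis .
qed

text \<open>Monomials of the edge ring thus become nonnegative flows modulo circulations.\<close>

lemma expo_eq_iff:
  assumes "c \<in> effective_vec E" "d \<in> effective_vec E"
  shows "expo c = expo d \<longleftrightarrow> bd c = bd d"
  unfolding bd_eq_iff_deg using lookup_expo[OF assms(1)] lookup_expo[OF assms(2)]
  by (metis (no_types, lifting) ext of_nat_eq_iff poly_mapping_eqI)

lemma effective_add: "c \<in> effective_vec E \<Longrightarrow> d \<in> effective_vec E \<Longrightarrow> (\<lambda>e. c e + d e) \<in> effective_vec E"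
  by (auto simp: effective_vec_def vec_def)

lemma expo_add:
  assumes "c \<in> effective_vec E" "d \<in> effective_vec E"
  shows "expo (\<lambda>e. c e + d e) = expo c + expo d"
  using assms unfolding expo_def effective_vec_def
  by (simp add: nat_add_distrib single_add algebra_simps sum.distrib)

lemma expo_zero: "expo (\<lambda>_. 0) = 0"
  by (simp add: expo_def)

lemma zero_effective: "(\<lambda>_. 0) \<in> effective_vec E"
  by (simp add: effective_vec_def vec_def)

lemma single_edge_effective: "e \<in> E \<Longrightarrow> single_edge e \<in> effective_vec E"
  by (auto simp: effective_vec_def vec_def single_edge_def)

lemma sum_single_edge: "e \<in> E \<Longrightarrow> sum (single_edge e) E = 1"
  using finite_E by (simp add: single_edge_def of_bool_def)

lemma edge_monomial_eq:
  assumes e: "e \<in> E"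
  shows "edge_monomial e = (Poly_Mapping.single (expo (single_edge e)) 1 :: ('v, 'k::field) mpoly)"
proof -
  have "edge_monomial e = (\<Prod>i\<in>{\<alpha> e, \<beta> e}. Var i :: ('v, 'k) mpoly)"
    unfolding edge_monomial_def by (rule prod.cong[OF edge_ends[OF e] refl])
  also have "\<dots> = Var (\<alpha> e) * Var (\<beta> e)" using ends_distinct[OF e e] by simp
  also have "\<dots> = Poly_Mapping.single (Poly_Mapping.single (\<alpha> e) 1 + Poly_Mapping.single (\<beta> e) 1) 1"
    by (simp add: Var_def mult_single)
  also have "Poly_Mapping.single (\<alpha> e) 1 + Poly_Mapping.single (\<beta> e) 1 = expo (single_edge e)"
  proof -
    have "expo (single_edge e) = (\<Sum>f\<in>E. if f = e then
        Poly_Mapping.single (\<alpha> e) 1 + Poly_Mapping.single (\<beta> e) 1 else 0)"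
      unfolding expo_def by (intro sum.cong) (auto simp: single_edge_def)
    then show ?thesis using e finite_E by simp
  qed
  finally show ?thesis .
qed

lemma component_generators:
  "{\<Prod>i<k. edge_monomial (f i) | f. \<forall>i<k. f i \<in> E} =
   (\<lambda>c. Poly_Mapping.single (expo c) (1::'k::field)) ` {c \<in> effective_vec E. sum c E = int k}"
proof (rule subset_antisym; rule subsetI)
  fix p :: "('v, 'k) mpoly"
  assume "p \<in> {\<Prod>i<k. edge_monomial (f i) | f. \<forall>i<k. f i \<in> E}"
  then obtain f where f: "p = (\<Prod>i<k. edge_monomial (f i))" "\<forall>i<k. f i \<in> E" by blast
  have "\<exists>c\<in>effective_vec E. sum c E = int k \<and> (\<Prod>i<k. edge_monomial (f i)) = Poly_Mapping.single (expo c) (1::'k)"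
    using f(2)
  proof (induction k)
    case 0
    then show ?case by (intro bexI[of _ "\<lambda>_. 0"]) (auto simp: expo_zero zero_effective single_one)
  next
    case (Suc k)
    then obtain c where c: "c \<in> effective_vec E" "sum c E = int k"
      "(\<Prod>i<k. edge_monomial (f i)) = Poly_Mapping.single (expo c) (1::'k)" by auto
    have fk: "f k \<in> E" using Suc.prems by simp
    have "(\<Prod>i<Suc k. edge_monomial (f i)) = Poly_Mapping.single (expo (\<lambda>e. c e + single_edge (f k) e)) (1::'k)"
      using c expo_add[OF c(1) single_edge_effective[OF fk]]
      by (simp add: mult_single edge_monomial_eq[OF fk])
    moreover have "sum (\<lambda>e. c e + single_edge (f k) e) E = int (Suc k)"
      using c sum_single_edge[OF fk] by (simp add: sum.distrib)
    ultimately show ?case using effective_add[OF c(1) single_edge_effective[OF fk]] by blast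
  qed
  with f show "p \<in> (\<lambda>c. Poly_Mapping.single (expo c) (1::'k)) ` {c \<in> effective_vec E. sum c E = int k}" by auto
next
  fix p :: "('v, 'k) mpoly"
  assume "p \<in> (\<lambda>c. Poly_Mapping.single (expo c) (1::'k)) ` {c \<in> effective_vec E. sum c E = int k}"
  then obtain c where c: "c \<in> effective_vec E" "sum c E = int k" "p = Poly_Mapping.single (expo c) 1" by blast
  have "\<exists>f. (\<forall>i<k. f i \<in> E) \<and> Poly_Mapping.single (expo c) (1::'k) = (\<Prod>i<k. edge_monomial (f i))"
    using c(1,2)
  proof (induction k arbitrary: c)
    case 0
    have "c e = 0" if "e \<in> E" for e
      using 0 that finite_E sum_nonneg_eq_0_iff[of E c] by (auto simp: effective_vec_def)
    then have "c = (\<lambda>_. 0)" using 0 by (auto simp: effective_vec_def vec_def)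
    then show ?case by (simp add: expo_zero single_one)
  next
    case (Suc k)
    have "\<exists>e\<in>E. c e \<noteq> 0"
    proof (rule ccontr)
      assume "\<not> (\<exists>e\<in>E. c e \<noteq> 0)"
      then have "sum c E = 0" by simp
      then show False using Suc.prems by simp
    qed
    then obtain e where e: "e \<in> E" "c e \<noteq> 0" by blast
    define d where "d = (\<lambda>f. c f - single_edge e f)"
    have d: "d \<in> effective_vec E"
    proof -
      have "c f \<ge> 0" for f using Suc.prems by (auto simp: effective_vec_def)
      moreover from this[of e] have "c e \<ge> 1" using e by linarith
      ultimately show ?thesis using Suc.prems e
        by (auto simp: d_def effective_vec_def vec_def single_edge_def)
    qed
    have cd: "c = (\<lambda>f. d f + single_edge e f)" by (simp add: d_def)
    have "sum d E = int k" using Suc.prems sum_single_edge[OF e(1)] by (simp add: d_def sum_subtractf)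
    with Suc.IH[OF d] obtain f where f: "\<forall>i<k. f i \<in> E"
      "Poly_Mapping.single (expo d) (1::'k) = (\<Prod>i<k. edge_monomial (f i))" by blast
    have "Poly_Mapping.single (expo c) (1::'k) = Poly_Mapping.single (expo d) 1 * edge_monomial e"
      unfolding edge_monomial_eq[OF e(1)] by (subst cd)
        (simp add: mult_single expo_add[OF d single_edge_effective[OF e(1)]])
    also have "\<dots> = (\<Prod>i<Suc k. edge_monomial ((f(k := e)) i))" unfolding f(2) by simp
    finally show ?case using f(1) e(1) by (intro exI[of _ "f(k := e)"]) (auto simp: less_Suc_eq)
  qed
  with c show "p \<in> {\<Prod>i<k. edge_monomial (f i) | f. \<forall>i<k. f i \<in> E}" by auto
qed

lemma expo_inj_standard: "inj_on expo standard"
proof (rule inj_onI)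
  fix c d assume "c \<in> standard" "d \<in> standard" "expo c = expo d"
  then show "c = d" using expo_eq_iff[of c d] standard_unique[of c d] by (simp add: standard_def)
qed

lemma expo_standard_image:
  "expo ` {c \<in> effective_vec E. R (sum c E)} = expo ` {c \<in> standard. R (sum c E)}"
proof (rule subset_antisym; rule image_subsetI)
  fix c assume c: "c \<in> {c \<in> effective_vec E. R (sum c E)}"
  obtain d where d: "d \<in> standard" "bd d = bd c" by (rule standard_exists[of c]) (use c in auto)
  then have "expo c = expo d" "sum d E = sum c E"
    using c expo_eq_iff[of c d] sum_cong_bd[OF d(2)] by (auto simp: standard_def)
  then show "expo c \<in> expo ` {c \<in> standard. R (sum c E)}" using c d by auto
qed (auto simp: standard_def)

lemma component_dim:
  "mpoly.dim (edge_ring_component G k :: ('v, 'k::field) mpoly set) = card {c \<in> standard. sum c E = int k}"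
proof -
  let ?S = "{c \<in> standard. sum c E = int k}"
  have fin: "finite ?S" by (rule finite_subset[OF _ card_standard_le(1)[of k]]) auto
  have "edge_ring_component G k = mpoly.span ((\<lambda>x. Poly_Mapping.single x (1::'k)) ` expo ` ?S)"
    unfolding edge_ring_component_def component_generators expo_standard_image[symmetric, of "\<lambda>s. s = int k"]
    by (simp add: image_image)
  then have "mpoly.dim (edge_ring_component G k :: ('v, 'k) mpoly set) =
      card ((\<lambda>x. Poly_Mapping.single x (1::'k)) ` expo ` ?S)"
    using mpoly.dim_span_eq_card_independent[OF independent_monomials[of "expo ` ?S"]] fin by simp
  also have "\<dots> = card (expo ` ?S)"
    by (intro card_image inj_onI) (metis keys_single singleton_inject zero_neq_one)
  also have "\<dots> = card ?S" by (intro card_image inj_on_subset[OF expo_inj_standard]) auto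
  finally show ?thesis .
qed

section \<open>The Krull dimension of the edge ring\<close>

definition monomials where "monomials = expo ` effective_vec E"

lemma monomials_add:
  assumes "x \<in> monomials" "y \<in> monomials"
  shows "x + y \<in> monomials"
proof -
  obtain c d where c: "c \<in> effective_vec E" "x = expo c" and d: "d \<in> effective_vec E" "y = expo d"
    using assms by (auto simp: monomials_def)
  show ?thesis
    unfolding monomials_def c(2) d(2) expo_add[OF c(1) d(1), symmetric] using effective_add[OF c(1) d(1)] by (rule imageI)
qed

lemma zero_monomials: "0 \<in> monomials"
  unfolding monomials_def expo_zero[symmetric] using zero_effective by (rule imageI)

lemma keys_edge_ring_carrier:
  "p \<in> (edge_ring_carrier G :: ('v, 'k::field) mpoly set) \<Longrightarrow> Poly_Mapping.keys p \<subseteq> monomials"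
proof (induction rule: generate_ring.induct)
  case one
  then show ?case using zero_monomials by (simp add: ring_of_type_algebra_def)
next
  case (incl h)
  then show ?case
    using zero_monomials by (auto simp: Const_def edge_monomial_eq monomials_def single_edge_effective split: if_splits)
next
  case (a_inv h)
  then show ?case by (simp add: a_inv_type_algebra)
next
  case (eng_add p q)
  then show ?case using keys_add[of p q] by (auto simp: ring_of_type_algebra_def)
next
  case (eng_mult p q)
  have "Poly_Mapping.keys (p * q) \<subseteq> monomials" using keys_mult[of p q] eng_mult.IH monomials_add by blast
  then show ?case by (simp add: ring_of_type_algebra_def)
qed

text \<open>Each edge has exactly one end in the tail class; counting only that class gives the
  degree in the edge ring instead of its double.\<close>

definition mdeg :: "('v \<Rightarrow>\<^sub>0 nat) \<Rightarrow> nat" where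
  "mdeg x = (\<Sum>v\<in>\<alpha> ` E. Poly_Mapping.lookup x v)"

lemma mdeg_expo:
  assumes "c \<in> effective_vec E"
  shows "int (mdeg (expo c)) = sum c E"
proof -
  have "int (mdeg (expo c)) = (\<Sum>v\<in>\<alpha> ` E. bd c v)"
    unfolding mdeg_def of_nat_sum by (intro sum.cong refl) (simp only: bd_eq_deg lookup_expo[OF assms] if_True)
  also have "\<dots> = (\<Sum>v\<in>\<alpha> ` E \<inter> (\<alpha> ` E \<union> \<beta> ` E). bd c v)"
    by (simp only: inf_sup_absorb)
  also have "\<dots> = (\<Sum>e\<in>E. c e * cut (\<alpha> ` E) e)" by (rule sum_cut[symmetric])
  also have "\<dots> = sum c E"
  proof (rule sum.cong[OF refl])
    fix e assume e: "e \<in> E"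
    then have "\<beta> e \<notin> \<alpha> ` E" by (rule tail_not_head)
    then show "c e * cut (\<alpha> ` E) e = c e" using e by (simp add: cut_def)
  qed
  finally show ?thesis .
qed

lemma monomials_bounded:
  "finite {x \<in> monomials. mdeg x \<le> N}" "card {x \<in> monomials. mdeg x \<le> N} \<le> card {T. facet T} * (N + 1) ^ rank"
proof -
  let ?S = "{c \<in> standard. sum c E \<le> int N}"
  have "{x \<in> monomials. mdeg x \<le> N} = expo ` {c \<in> effective_vec E. sum c E \<le> int N}"
  proof -
    have "mdeg (expo c) \<le> N \<longleftrightarrow> sum c E \<le> int N" if "c \<in> effective_vec E" for c
      using mdeg_expo[OF that] by linarith
    then show ?thesis by (auto simp: monomials_def)
  qed
  then have eq: "{x \<in> monomials. mdeg x \<le> N} = expo ` ?S"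
    using expo_standard_image[of "\<lambda>s. s \<le> int N"] by simp
  show "finite {x \<in> monomials. mdeg x \<le> N}" unfolding eq using card_standard_le(1) by simp
  show "card {x \<in> monomials. mdeg x \<le> N} \<le> card {T. facet T} * (N + 1) ^ rank"
    unfolding eq using card_image_le[OF card_standard_le(1)] card_standard_le(2) le_trans by blast
qed

lemma Const_in_carrier: "Const c \<in> edge_ring_carrier G"
  by (rule generate_ring.incl) simp

text \<open>Coordinates in a facet \<open>T\<close> send the edge monomials of \<open>T\<close> to
  the variables of a Laurent polynomial ring, so \<open>chain_of_kernels\<close> yields a chain of
  length \<open>rank\<close>. The growth bound for monomials excludes longer ones.\<close>

lemma krull_dim_edge_ring:
  "krull_dim (edge_ring G :: ('v, 'k::field) mpoly ring) = enat rank"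
proof -
  let ?C = "edge_ring_carrier G :: ('v, 'k) mpoly set"
  have C: "unital_subring ?C" by (rule unital_subring_generate_ring)
  obtain T where T: "facet T" using facet_exists by blast
  have "finite T" using facet_subset_E[OF T] finite_E by (rule finite_subset)
  then obtain b where b: "bij_betw b {..<rank} T"
    using ex_bij_betw_nat_finite[of T] unfolding card_facet[OF T] atLeast0LessThan by (metis (no_types))
  \<comment> \<open>An arbitrary flow for each monomial: \<open>coord\<close> depends only on the
    boundary, so \<open>\<pi>\<close> does not depend on the choice and is additive.\<close>
  define rep where "rep x = (SOME c. c \<in> effective_vec E \<and> expo c = x)" for x
  have rep: "rep x \<in> effective_vec E" "expo (rep x) = x" if "x \<in> monomials" for x
  proof -
    have "\<exists>c. c \<in> effective_vec E \<and> expo c = x" using that by (auto simp: monomials_def)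
    from someI_ex[OF this] show "rep x \<in> effective_vec E" "expo (rep x) = x" by (auto simp: rep_def)
  qed
  define \<pi> where "\<pi> x = (\<Sum>i<rank. Poly_Mapping.single i (coord T (rep x) (b i)))" for x
  have \<pi>: "\<pi> (expo c) = (\<Sum>i<rank. Poly_Mapping.single i (coord T c (b i)))" if "c \<in> effective_vec E" for c
  proof -
    have "expo c \<in> monomials" using that by (simp add: monomials_def)
    then have "bd (rep (expo c)) = bd c" using rep[of "expo c"] that expo_eq_iff by blast
    then show ?thesis unfolding \<pi>_def using coord_cong by metis
  qed
  have ev: "c \<in> vec E" if "c \<in> effective_vec E" for c using that by (simp add: effective_vec_def)
  obtain P where P: "\<And>i. i \<le> rank \<Longrightarrow> prime_in (P i) ?C" "\<And>i. i < rank \<Longrightarrow> P i \<subset> P (Suc i)"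
  proof (rule chain_of_kernels[OF C, of monomials \<pi> rank "\<lambda>i. expo (single_edge (b i))"])
    have "coord T (\<lambda>_. 0) = (\<lambda>_. 0)" by (intro coord_unique[OF T]) (auto simp: vec_def)
    then show "\<pi> 0 = 0" using \<pi>[OF zero_effective] by (simp add: expo_zero)
  next
    fix x y assume "x \<in> monomials" "y \<in> monomials"
    then obtain c d where c: "c \<in> effective_vec E" "x = expo c" and d: "d \<in> effective_vec E" "y = expo d"
      by (auto simp: monomials_def)
    have "coord T (\<lambda>e. c e + d e) = (\<lambda>e. coord T c e + coord T d e)"
      using coord_lincomb[OF T ev[OF c(1)] ev[OF d(1)], of 1 1] by simp
    then show "\<pi> (x + y) = \<pi> x + \<pi> y"
      using \<pi>[OF c(1)] \<pi>[OF d(1)] \<pi>[OF effective_add[OF c(1) d(1)]] c d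
      by (simp add: expo_add single_add sum.distrib)
  next
    fix i assume i: "i < rank"
    have biT: "b j \<in> T" if "j < rank" for j using b that by (auto simp: bij_betw_def)
    then have biE: "b j \<in> E" if "j < rank" for j using facet_subset_E[OF T] that by blast
    show "Poly_Mapping.single (expo (single_edge (b i))) 1 \<in> ?C"
      using edge_monomial_eq[OF biE[OF i], where 'k = 'k] biE[OF i] by (metis UnI2 generate_ring.incl imageI)
    have "coord T (single_edge (b i)) = single_edge (b i)"
      using biT[OF i] by (intro coord_unique[OF T]) (auto simp: vec_def single_edge_def)
    then have "\<pi> (expo (single_edge (b i))) = (\<Sum>j<rank. Poly_Mapping.single j (single_edge (b i) (b j)))"
      using \<pi>[OF single_edge_effective[OF biE[OF i]]] by simp
    also have "\<dots> = (\<Sum>j<rank. if j = i then Poly_Mapping.single i 1 else 0)"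
    proof (rule sum.cong[OF refl])
      fix j assume "j \<in> {..<rank}"
      then have "b j = b i \<longleftrightarrow> j = i" using b i by (auto simp: bij_betw_def inj_on_def)
      then show "Poly_Mapping.single j (single_edge (b i) (b j)) = (if j = i then Poly_Mapping.single i 1 else 0)"
        by (simp add: single_edge_def)
    qed
    finally show "\<pi> (expo (single_edge (b i))) = Poly_Mapping.single i 1" using i by simp
  next
    show "Poly_Mapping.keys p \<subseteq> monomials" if "p \<in> ?C" for p using keys_edge_ring_carrier[OF that] .
  qed blast
  have le: "n \<le> rank" if Q: "\<And>i. i \<le> n \<Longrightarrow> prime_in (Q i) ?C" "\<And>i. i < n \<Longrightarrow> Q i \<subset> Q (Suc i)" for n Q
  proof (rule chain_length_le[OF C, where dg = mdeg and M = monomials and n = n and P = Q])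
    show "card {x \<in> monomials. mdeg x \<le> N} \<le> card {T. facet T} * (N + 1) ^ rank" for N
      by (rule monomials_bounded(2))
    show "Poly_Mapping.keys p \<subseteq> monomials" if "p \<in> ?C" for p using that by (rule keys_edge_ring_carrier)
  qed (use Q Const_in_carrier monomials_bounded(1) in
      \<open>auto simp: mdeg_def lookup_add sum.distrib\<close>)
  show ?thesis unfolding edge_ring_def
  proof (rule krull_dim_eqI[OF C, where P = P])
    show "n \<le> rank" if "\<And>i. i \<le> n \<Longrightarrow> prime_in (Q i) ?C" "\<And>i. i < n \<Longrightarrow> Q i \<subset> Q (Suc i)" for n Q
      using that by (rule le)
  qed (use P in auto)
qed

lemma pseudo_Gorenstein_iff_lead_coeff:
  "pseudo_Gorenstein (mpoly_scale :: 'k::field \<Rightarrow> ('v, 'k) mpoly \<Rightarrow> _) (edge_ring G) (edge_ring_component G)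
    \<longleftrightarrow> lead_coeff h_numerator = 1"
proof -
  have hs: "hilbert_series (mpoly_scale :: 'k \<Rightarrow> ('v, 'k) mpoly \<Rightarrow> _) (edge_ring_component G) =
      Abs_fps (\<lambda>k. of_nat (card {c \<in> standard. sum c E = int k}))"
    by (simp add: hilbert_series_def component_dim)
  have div: "F = fps_of_poly h / (1 - fps_X) ^ rank \<longleftrightarrow> F * (1 - fps_X) ^ rank = fps_of_poly h"
    for F and h :: "rat poly"
  proof -
    let ?u = "(1 - fps_X) ^ rank :: rat fps"
    have u: "?u $ 0 \<noteq> 0" by (simp add: fps_power_zeroth)
    then have inv: "?u * inverse ?u = 1" by (simp add: inverse_mult_eq_1')
    show ?thesis
      unfolding fps_divide_unit[OF u]
    proof
      assume "F = fps_of_poly h * inverse ?u"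
      then have "F * ?u = fps_of_poly h * (?u * inverse ?u)" by (simp only: mult_ac)
      then show "F * ?u = fps_of_poly h" unfolding inv by simp
    next
      assume "F * ?u = fps_of_poly h"
      then have "fps_of_poly h * inverse ?u = F * (?u * inverse ?u)" by (simp only: mult.assoc flip: \<open>F * ?u = fps_of_poly h\<close>)
      then show "F = fps_of_poly h * inverse ?u" unfolding inv by simp
    qed
  qed
  have eq: "hilbert_series (mpoly_scale :: 'k \<Rightarrow> ('v, 'k) mpoly \<Rightarrow> _) (edge_ring_component G) =
      fps_of_poly h / (1 - fps_X) ^ rank \<longleftrightarrow> h = h_numerator" for h
    unfolding div using hilbert_numerator hs by (metis fps_of_poly_eq_iff)
  show ?thesis
    unfolding pseudo_Gorenstein_def krull_dim_edge_ring using eq by auto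
qed

end

section \<open>Blocks and matchings\<close>

abbreviation adj :: "'a graph \<Rightarrow> ('a \<times> 'a) set" where
  "adj H \<equiv> {(x, y). {x, y} \<in> Edges H}"

lemma adj_rtrancl_sym: "(x, y) \<in> (adj H)\<^sup>* \<Longrightarrow> (y, x) \<in> (adj H)\<^sup>*"
proof -
  have "sym (adj H)" by (auto simp: sym_def insert_commute)
  then show "(x, y) \<in> (adj H)\<^sup>* \<Longrightarrow> (y, x) \<in> (adj H)\<^sup>*" using sym_rtrancl by (auto dest: symD)
qed

lemma connected_graphI:
  assumes "\<And>v. v \<in> Verts H \<Longrightarrow> (u, v) \<in> (adj H)\<^sup>*"
  shows "connected_graph H"
  unfolding connected_graph_def
proof (intro ballI)
  fix x y assume "x \<in> Verts H" "y \<in> Verts H"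
  then have "(x, u) \<in> (adj H)\<^sup>*" "(u, y) \<in> (adj H)\<^sup>*" by (auto intro: assms adj_rtrancl_sym)
  then show "(x, y) \<in> (adj H)\<^sup>*" by (rule rtrancl_trans)
qed

lemma connected_crossing_edge:
  assumes "connected_graph H" "u \<in> Verts H" "u \<in> U" "w \<in> Verts H" "w \<notin> U"
  obtains x y where "{x, y} \<in> Edges H" "x \<in> U" "y \<notin> U"
proof -
  have "(u, w) \<in> (adj H)\<^sup>*" using assms by (simp add: connected_graph_def)
  then have "\<exists>x y. {x, y} \<in> Edges H \<and> x \<in> U \<and> y \<notin> U" using assms(3,5)
  proof (induction rule: converse_rtrancl_induct)
    case (step x y)
    then show ?case by (cases "y \<in> U") auto
  qed simp
  with that show thesis by blast
qed

definition union_graph :: "'a graph \<Rightarrow> 'a graph \<Rightarrow> 'a graph" where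
  "union_graph H K = \<lparr>Verts = Verts H \<union> Verts K, Edges = Edges H \<union> Edges K\<rparr>"

lemma connected_union_graph:
  assumes "connected_graph H" "connected_graph K" "w \<in> Verts H" "w \<in> Verts K"
  shows "connected_graph (union_graph H K)"
proof (rule connected_graphI)
  fix v assume v: "v \<in> Verts (union_graph H K)"
  have "(adj H)\<^sup>* \<subseteq> (adj (union_graph H K))\<^sup>*" "(adj K)\<^sup>* \<subseteq> (adj (union_graph H K))\<^sup>*"
    by (intro rtrancl_mono; auto simp: union_graph_def)+
  then show "(w, v) \<in> (adj (union_graph H K))\<^sup>*"
    using v assms by (auto simp: union_graph_def connected_graph_def)
qed

lemma delete_vertex_absent:
  assumes "simple_graph H" "v \<notin> Verts H"
  shows "delete_vertex v H = H"
proof -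
  have "v \<notin> e" if "e \<in> Edges H" for e using assms that by (auto simp: simple_graph_def)
  then have "{e \<in> Edges H. v \<notin> e} = Edges H" by blast
  with assms(2) show ?thesis by (simp add: delete_vertex_def)
qed

lemma two_connected_delete:
  assumes "two_connected H" "simple_graph H"
  shows "connected_graph (delete_vertex v H)"
  using assms delete_vertex_absent[of H v] by (cases "v \<in> Verts H") (auto simp: two_connected_def)

text \<open>Deleting one vertex leaves at least one of the two common vertices to hold the connected
  pieces together.\<close>

lemma two_connected_union_graph:
  assumes H: "two_connected H" "simple_graph H" and K: "two_connected K" "simple_graph K"
    and xy: "x \<noteq> y" "x \<in> Verts H \<inter> Verts K" "y \<in> Verts H \<inter> Verts K"
  shows "two_connected (union_graph H K)"
  unfolding two_connected_def
proof (intro conjI ballI)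
  show "connected_graph (union_graph H K)"
    using assms by (intro connected_union_graph[of H K x]) (auto simp: two_connected_def)
  fix v
  obtain w where w: "w \<noteq> v" "w \<in> Verts H" "w \<in> Verts K" using xy by (metis IntD1 IntD2)
  have "delete_vertex v (union_graph H K) = union_graph (delete_vertex v H) (delete_vertex v K)"
    by (auto simp: delete_vertex_def union_graph_def)
  moreover have "w \<in> Verts (delete_vertex v H)" "w \<in> Verts (delete_vertex v K)"
    using w by (auto simp: delete_vertex_def)
  ultimately show "connected_graph (delete_vertex v (union_graph H K))"
    using two_connected_delete[OF H] two_connected_delete[OF K] by (metis connected_union_graph)
qed

lemma simple_graph_edge:
  assumes "simple_graph G" "e \<in> Edges G"
  obtains u v where "u \<in> Verts G" "v \<in> Verts G" "u \<noteq> v" "e = {u, v}"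
  using assms by (auto simp: simple_graph_def)

lemma finite_Edges:
  assumes "simple_graph G"
  shows "finite (Edges G)"
proof (rule finite_subset)
  show "Edges G \<subseteq> Pow (Verts G)" using assms by (auto simp: simple_graph_def)
  show "finite (Pow (Verts G))" using assms by (simp add: simple_graph_def)
qed

text \<open>Maximize the number of vertices plus the number of edges; subgraphs need not be induced,
  so counting vertices alone would not give a maximal one.\<close>

lemma block_extends:
  assumes G: "simple_graph G" and H: "subgraph H G" "two_connected H"
  obtains B where "is_block B G" "subgraph H B"
proof -
  define Q where "Q K \<longleftrightarrow> subgraph K G \<and> two_connected K \<and> subgraph H K" for K
  define m where "m K = card (Verts K) + card (Edges K)" for K :: "'a graph"
  have fin: "finite (Verts G)" "finite (Edges G)" using G finite_Edges by (auto simp: simple_graph_def)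
  have "Q H" using H by (auto simp: Q_def subgraph_def)
  moreover have "\<forall>K. Q K \<longrightarrow> m K < Suc (m G)"
    using fin unfolding less_Suc_eq_le m_def Q_def subgraph_def by (auto intro!: add_mono card_mono)
  ultimately obtain B where B: "Q B" and max: "\<And>K. Q K \<Longrightarrow> m K \<le> m B"
    using ex_has_greatest_nat[of Q H m "Suc (m G)"] by metis
  have "K = B" if K: "subgraph K G" "two_connected K" "subgraph B K" for K
  proof -
    have "Q K" using K B by (auto simp: Q_def subgraph_def)
    then have le: "m K \<le> m B" by (rule max)
    have finK: "finite (Verts K)" "finite (Edges K)"
      using K fin by (auto simp: subgraph_def intro: finite_subset)
    have sub: "Verts B \<subseteq> Verts K" "Edges B \<subseteq> Edges K" using K by (auto simp: subgraph_def)
    have "card (Verts B) \<le> card (Verts K)" "card (Edges B) \<le> card (Edges K)"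
      using sub finK by (auto intro: card_mono)
    then have "card (Verts K) \<le> card (Verts B)" "card (Edges K) \<le> card (Edges B)"
      using le by (auto simp: m_def)
    then have "Verts B = Verts K" "Edges B = Edges K" using sub finK by (metis card_seteq)+
    then show ?thesis by simp
  qed
  then have "is_block B G" using B by (auto simp: is_block_def Q_def)
  then show thesis using that B by (auto simp: Q_def)
qed

lemma simple_union_graph:
  assumes "simple_graph H" "simple_graph K"
  shows "simple_graph (union_graph H K)"
  unfolding simple_graph_def
proof (intro conjI ballI)
  show "finite (Verts (union_graph H K))" using assms by (simp add: simple_graph_def union_graph_def)
  fix e assume "e \<in> Edges (union_graph H K)"
  then consider "e \<in> Edges H" | "e \<in> Edges K" by (auto simp: union_graph_def)
  then obtain u v where "u \<in> Verts (union_graph H K)" "v \<in> Verts (union_graph H K)" "u \<noteq> v" "e = {u, v}"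
    by cases (metis assms simple_graph_edge UnCI graph.select_convs(1) union_graph_def)+
  then show "\<exists>u\<in>Verts (union_graph H K). \<exists>v\<in>Verts (union_graph H K). u \<noteq> v \<and> e = {u, v}" by blast
qed

text \<open>A common edge provides two common vertices, so the union is 2-connected, and by
  maximality both blocks equal it.\<close>

lemma blocks_edge_disjoint:
  assumes B: "is_block B G" and K: "is_block K G" and e: "e \<in> Edges B" "e \<in> Edges K"
  shows "B = K"
proof -
  have s: "simple_graph B" "simple_graph K" using B K by (auto simp: is_block_def subgraph_def)
  obtain x y where "x \<noteq> y" "e = {x, y}" "x \<in> Verts B" "y \<in> Verts B" using simple_graph_edge[OF s(1) e(1)] by metis
  moreover obtain x' y' where "e = {x', y'}" "x' \<in> Verts K" "y' \<in> Verts K" using simple_graph_edge[OF s(2) e(2)] by metis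
  ultimately have xy: "x \<noteq> y" "x \<in> Verts B \<inter> Verts K" "y \<in> Verts B \<inter> Verts K"
    by (auto simp: doubleton_eq_iff)
  define L where "L = union_graph B K"
  have "two_connected L" unfolding L_def
    using B K s xy by (intro two_connected_union_graph[of B K x y]) (auto simp: is_block_def)
  moreover have "simple_graph L" unfolding L_def using s by (rule simple_union_graph)
  then have "subgraph L G" "subgraph B L" "subgraph K L"
    using B K s by (auto simp: is_block_def subgraph_def L_def union_graph_def)
  ultimately have "L = B" "L = K" using B K by (auto simp: is_block_def)
  then show ?thesis by simp
qed

lemma two_connected_edge:
  assumes "u \<noteq> v"
  shows "two_connected \<lparr>Verts = {u, v}, Edges = {{u, v}}\<rparr>"
proof -
  have "(u, v) \<in> (adj \<lparr>Verts = {u, v}, Edges = {{u, v}}\<rparr>)\<^sup>*" by (intro r_into_rtrancl) simp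
  then have "connected_graph \<lparr>Verts = {u, v}, Edges = {{u, v}}\<rparr>" by (intro connected_graphI[of _ u]) auto
  then show ?thesis using assms by (auto simp: two_connected_def connected_graph_def delete_vertex_def)
qed

lemma edge_in_block:
  assumes G: "simple_graph G" and e: "e \<in> Edges G"
  obtains B where "is_block B G" "e \<in> Edges B"
proof -
  obtain u v where uv: "u \<in> Verts G" "v \<in> Verts G" "u \<noteq> v" "e = {u, v}" using simple_graph_edge[OF G e] .
  let ?H = "\<lparr>Verts = {u, v}, Edges = {{u, v}}\<rparr>"
  have "subgraph ?H G" using uv e by (auto simp: subgraph_def simple_graph_def)
  then obtain B where "is_block B G" "subgraph ?H B"
    using block_extends[OF G _ two_connected_edge[OF uv(3)]] by blast
  then show thesis using that uv by (auto simp: subgraph_def)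
qed

text \<open>Minimality of the invariant set means that iterating \<open>s\<close> from any vertex
  visits all of \<open>C\<close>.\<close>

lemma two_connected_cycle:
  fixes s :: "'a \<Rightarrow> 'a"
  assumes sC: "s ` C = C" and min: "\<And>P. P \<subseteq> C \<Longrightarrow> P \<noteq> {} \<Longrightarrow> s ` P \<subseteq> P \<Longrightarrow> P = C"
    and neq: "\<And>u. u \<in> C \<Longrightarrow> s u \<noteq> u"
  shows "two_connected \<lparr>Verts = C, Edges = (\<lambda>u. {u, s u}) ` C\<rparr>" (is "two_connected ?H")
  unfolding two_connected_def
proof (intro conjI ballI)
  show "connected_graph ?H"
  proof (cases "C = {}")
    case False
    then obtain u where u: "u \<in> C" by blast
    define P where "P = {x \<in> C. (u, x) \<in> (adj ?H)\<^sup>*}"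
    have "s ` P \<subseteq> P"
    proof (rule image_subsetI)
      fix x assume x: "x \<in> P"
      then have "(x, s x) \<in> adj ?H" by (auto simp: P_def)
      with x sC show "s x \<in> P" unfolding P_def by (auto intro: rtrancl_into_rtrancl)
    qed
    then have "P = C" using u by (intro min) (auto simp: P_def)
    then show ?thesis by (intro connected_graphI[of _ u]) (auto simp: P_def)
  qed (simp add: connected_graph_def)
next
  fix v assume "v \<in> Verts ?H"
  then have v: "v \<in> C" by simp
  let ?K = "delete_vertex v ?H"
  \<comment> \<open>\<open>v\<close> is put in by hand so that \<open>P\<close> is invariant: the
    walk starting at \<open>s v\<close> avoids \<open>v\<close> until it closes up there.\<close>
  define P where "P = {x \<in> C. x = v \<or> (s v, x) \<in> (adj ?K)\<^sup>*}"
  have "s ` P \<subseteq> P"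
  proof (rule image_subsetI)
    fix x assume x: "x \<in> P"
    then have sx: "s x \<in> C" using sC by (auto simp: P_def)
    show "s x \<in> P"
    proof (cases "x = v \<or> s x = v")
      case True
      then show ?thesis using sx by (auto simp: P_def)
    next
      case False
      then have "(x, s x) \<in> adj ?K" using x by (auto simp: P_def delete_vertex_def)
      moreover have "(s v, x) \<in> (adj ?K)\<^sup>*" using x False by (auto simp: P_def)
      ultimately show ?thesis using sx by (auto simp: P_def intro: rtrancl_into_rtrancl)
    qed
  qed
  then have "P = C" using v by (intro min) (auto simp: P_def)
  then show "connected_graph ?K" by (intro connected_graphI[of _ "s v"]) (auto simp: P_def delete_vertex_def)
qed

definition restr :: "('e \<Rightarrow> int) \<Rightarrow> 'e set \<Rightarrow> 'e \<Rightarrow> int" where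
  "restr k S e = (if e \<in> S then k e else 0)"

section \<open>Restriction of flows to blocks\<close>

locale simple_bipartite_network = bipartite_network +
  assumes simple: "simple_graph G"
begin

lemma block_subset: "is_block H G \<Longrightarrow> Edges H \<subseteq> E"
  by (simp add: is_block_def subgraph_def)

lemma circ_iff_deg: "k \<in> circ \<longleftrightarrow> k \<in> vec E \<and> (\<forall>v. deg k v = 0)"
  using bd_eq_iff_deg[of k "\<lambda>_. 0"] by (auto simp: circ_def bd_zero fun_eq_iff deg_def)

lemma deg_add: "deg (\<lambda>e. c e + d e) v = deg c v + deg d v"
  by (simp add: deg_def algebra_simps sum.distrib)

lemma deg_diff: "deg (\<lambda>e. c e - d e) v = deg c v - deg d v"
  by (simp add: deg_def algebra_simps sum_subtractf)

text \<open>An elementary cycle is a 2-connected subgraph, so it lies in a single block.\<close>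

lemma conformal_cycle_in_block:
  assumes k: "k \<in> circ" "k \<noteq> (\<lambda>_. 0)"
  obtains \<kappa> H where "\<kappa> \<in> circ" "ternary \<kappa>" "\<kappa> \<noteq> (\<lambda>_. 0)"
    "\<And>e. \<kappa> e = 1 \<Longrightarrow> k e > 0" "\<And>e. \<kappa> e = -1 \<Longrightarrow> k e < 0"
    "is_block H G" "supp \<kappa> \<subseteq> Edges H"
proof (rule conformal_cycle[OF k])
  fix \<kappa> C s \<epsilon>
  assume \<kappa>: "\<kappa> \<in> circ" "ternary \<kappa>" "\<kappa> \<noteq> (\<lambda>_. 0)"
      "\<And>e. \<kappa> e = 1 \<Longrightarrow> k e > 0" "\<And>e. \<kappa> e = -1 \<Longrightarrow> k e < 0"
    and C: "C \<noteq> {}" "finite C" "s ` C = C" "\<And>P. P \<subseteq> C \<Longrightarrow> P \<noteq> {} \<Longrightarrow> s ` P \<subseteq> P \<Longrightarrow> P = C"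
    and supp: "supp \<kappa> = \<epsilon> ` C"
    and \<epsilon>: "\<And>u. u \<in> C \<Longrightarrow> \<epsilon> u \<in> E \<and> {\<alpha> (\<epsilon> u), \<beta> (\<epsilon> u)} = {u, s u}"
  have eq: "\<epsilon> u = {u, s u}" "{u, s u} \<in> E" if "u \<in> C" for u
  proof -
    have "\<epsilon> u = {\<alpha> (\<epsilon> u), \<beta> (\<epsilon> u)}" using \<epsilon>[OF that] by (intro edge_ends) simp
    then show "\<epsilon> u = {u, s u}" using \<epsilon>[OF that] by simp
    then show "{u, s u} \<in> E" using \<epsilon>[OF that] by simp
  qed
  have edge: "u \<in> Verts G" "s u \<in> Verts G" "s u \<noteq> u" if "u \<in> C" for u
  proof -
    have "{u, s u} \<in> E" using that by (rule eq(2))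
    then obtain x y where xy: "x \<in> Verts G" "y \<in> Verts G" "x \<noteq> y" "{u, s u} = {x, y}"
      by (rule simple_graph_edge[OF simple])
    then have "u = x \<and> s u = y \<or> u = y \<and> s u = x" by (simp add: doubleton_eq_iff)
    then show "u \<in> Verts G" "s u \<in> Verts G" "s u \<noteq> u" using xy by auto
  qed
  let ?H = "\<lparr>Verts = C, Edges = (\<lambda>u. {u, s u}) ` C\<rparr>"
  have "two_connected ?H" using C edge by (intro two_connected_cycle) auto
  moreover have "simple_graph ?H"
    unfolding simple_graph_def
  proof (intro conjI ballI)
    fix e assume "e \<in> Edges ?H"
    then obtain u where "u \<in> C" "e = {u, s u}" by auto
    then show "\<exists>u\<in>Verts ?H. \<exists>v\<in>Verts ?H. u \<noteq> v \<and> e = {u, v}"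
      using edge(3)[of u] C(3) by (intro bexI[of _ u] bexI[of _ "s u"]) auto
  qed (use C in auto)
  then have "subgraph ?H G" using edge eq by (auto simp: subgraph_def)
  ultimately obtain H where H: "is_block H G" "subgraph ?H H" using block_extends[OF simple] by blast
  have "supp \<kappa> \<subseteq> Edges H" using H(2) supp eq(1) by (auto simp: subgraph_def)
  then show thesis using that \<kappa> H(1) by blast
qed

text \<open>Peel off conformal elementary cycles: each lies in one block, so its restriction to
  \<open>H\<close> is the whole cycle or zero.\<close>

lemma circ_restr_block:
  assumes "k \<in> circ" "is_block H G"
  shows "restr k (Edges H) \<in> circ"
  using assms(1)
proof (induction "nat (\<Sum>e\<in>E. \<bar>k e\<bar>)" arbitrary: k rule: less_induct)
  case less
  show ?case
  proof (cases "k = (\<lambda>_. 0)")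
    case True
    then show ?thesis using circ_zero by (simp add: restr_def[abs_def])
  next
    case False
    from conformal_cycle_in_block[OF less.prems False] obtain \<kappa> K where
      \<kappa>: "\<kappa> \<in> circ" "ternary \<kappa>" "\<kappa> \<noteq> (\<lambda>_. 0)"
      "\<And>e. \<kappa> e = 1 \<Longrightarrow> k e > 0" "\<And>e. \<kappa> e = -1 \<Longrightarrow> k e < 0"
      and K: "is_block K G" "supp \<kappa> \<subseteq> Edges K" by blast
    define l where "l = (\<lambda>e. k e - \<kappa> e)"
    have "nat (\<Sum>e\<in>E. \<bar>l e\<bar>) < nat (\<Sum>e\<in>E. \<bar>k e\<bar>)"
      using sum_abs_conformal_less[OF less.prems \<kappa>]
      by (subst nat_less_eq_zless) (auto simp: l_def intro: sum_nonneg)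
    moreover have "l \<in> circ" unfolding l_def using less.prems \<kappa>(1) by (rule circ_diff)
    ultimately have l: "restr l (Edges H) \<in> circ" by (rule less.hyps)
    have "restr \<kappa> (Edges H) = (if K = H then \<kappa> else (\<lambda>_. 0))"
    proof
      fix e
      show "restr \<kappa> (Edges H) e = (if K = H then \<kappa> else (\<lambda>_. 0)) e"
        using K blocks_edge_disjoint[OF K(1) assms(2), of e] by (auto simp: restr_def supp_def)
    qed
    then have "restr \<kappa> (Edges H) \<in> circ" using \<kappa>(1) circ_zero by simp
    from circ_add[OF l this] have "(\<lambda>e. restr l (Edges H) e + restr \<kappa> (Edges H) e) \<in> circ" .
    moreover have "(\<lambda>e. restr l (Edges H) e + restr \<kappa> (Edges H) e) = restr k (Edges H)"
      by (auto simp: restr_def l_def)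
    ultimately show ?thesis by simp
  qed
qed

lemma circ_if_blocks:
  assumes k: "k \<in> vec E" and "\<And>H. is_block H G \<Longrightarrow> restr k (Edges H) \<in> circ"
  shows "k \<in> circ"
proof -
  \<comment> \<open>Indexing by edge sets gives a subfamily of \<open>Pow E\<close>, exactly one
    member of which contains a given edge.\<close>
  define BB where "BB = Edges ` {H. is_block H G}"
  have "finite BB" by (rule finite_subset[of _ "Pow E"]) (use block_subset finite_E in \<open>auto simp: BB_def\<close>)
  have "(\<lambda>e. \<Sum>S\<in>BB. restr k S e) = k"
  proof
    fix e
    show "(\<Sum>S\<in>BB. restr k S e) = k e"
    proof (cases "e \<in> E")
      case True
      then obtain H where H: "is_block H G" "e \<in> Edges H" using edge_in_block[OF simple] by blast
      have "(\<Sum>S\<in>BB. restr k S e) = (\<Sum>S\<in>{Edges H}. restr k S e)"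
        using \<open>finite BB\<close> H blocks_edge_disjoint[OF H(1)]
        by (intro sum.mono_neutral_right) (auto simp: BB_def restr_def)
      then show ?thesis using H by (simp add: restr_def)
    next
      case False
      then show ?thesis using k by (auto simp: restr_def vec_def intro!: sum.neutral)
    qed
  qed
  moreover have "(\<lambda>e. \<Sum>S\<in>BB. restr k S e) \<in> circ"
    using assms(2) by (intro circ_sum) (auto simp: BB_def)
  ultimately show ?thesis by simp
qed

text \<open>Otherwise \<open>c\<close> vanishes on all edges of \<open>H\<close> at
  \<open>v\<close>. A circulation augmenting \<open>e\<close> is then nonnegative on them and
  positive on \<open>e\<close>, so its restriction to \<open>H\<close>, again a circulation, would
  have positive degree at \<open>v\<close>.\<close>

lemma deg_ge_1:
  assumes c: "c \<in> effective_vec E" "interior c" and H: "is_block H G" and e: "e \<in> Edges H" "v \<in> e"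
  shows "deg (restr c (Edges H)) v \<ge> 1"
proof (rule ccontr)
  let ?F = "Edges H"
  assume neg: "\<not> ?thesis"
  have nn: "c f \<ge> 0" for f using c by (simp add: effective_vec_def)
  have eE: "e \<in> E" using e block_subset[OF H] by blast
  have "deg (restr c ?F) v \<ge> 0" unfolding deg_def using nn by (intro sum_nonneg) (simp add: restr_def)
  then have "deg (restr c ?F) v = 0" using neg by simp
  then have z: "restr c ?F f * of_bool (v \<in> f) = 0" if "f \<in> E" for f
    using that finite_E nn unfolding deg_def by (subst (asm) sum_nonneg_eq_0_iff) (auto simp: restr_def)
  then have cz: "c f = 0" if "f \<in> ?F" "v \<in> f" for f
    using that z[of f] block_subset[OF H] by (auto simp: restr_def)
  then obtain k where k: "k \<in> circ" "k e > 0" "\<And>f. f \<in> E \<Longrightarrow> c f = 0 \<Longrightarrow> k f \<ge> 0"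
    using c(2) e eE unfolding interior_def by (metis less_irrefl)
  have "restr k ?F e * of_bool (v \<in> e) \<le> deg (restr k ?F) v"
    unfolding deg_def using eE finite_E cz k(3) by (intro member_le_sum) (auto simp: restr_def)
  moreover have "deg (restr k ?F) v = 0" using circ_restr_block[OF k(1) H] circ_iff_deg by blast
  ultimately show False using e k(2) by (simp add: restr_def)
qed

lemma handshake:
  assumes H: "is_block H G" and c: "c \<in> vec (Edges H)"
  shows "(\<Sum>v\<in>Verts H. deg c v) = 2 * sum c E"
proof -
  have s: "simple_graph H" using H by (simp add: is_block_def subgraph_def)
  then have fin: "finite (Verts H)" by (simp add: simple_graph_def)
  have "(\<Sum>v\<in>Verts H. deg c v) = (\<Sum>e\<in>E. \<Sum>v\<in>Verts H. c e * of_bool (v \<in> e))"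
    unfolding deg_def by (rule sum.swap)
  also have "\<dots> = (\<Sum>e\<in>E. 2 * c e)"
  proof (rule sum.cong[OF refl])
    fix e
    show "(\<Sum>v\<in>Verts H. c e * of_bool (v \<in> e)) = 2 * c e"
    proof (cases "e \<in> Edges H")
      case True
      then obtain x y where xy: "x \<in> Verts H" "y \<in> Verts H" "x \<noteq> y" "e = {x, y}"
        using simple_graph_edge[OF s] by metis
      have "(\<Sum>v\<in>Verts H. of_bool (v \<in> e) :: int) = (\<Sum>v\<in>{x, y}. 1)"
        using xy fin by (intro sum.mono_neutral_cong_right) auto
      then have "(\<Sum>v\<in>Verts H. of_bool (v \<in> e) :: int) = 2" using xy by simp
      then show ?thesis by (simp flip: sum_distrib_left)
    next
      case False
      then show ?thesis using c by (simp add: vec_def)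
    qed
  qed
  also have "\<dots> = 2 * sum c E" by (simp add: sum_distrib_left)
  finally show ?thesis .
qed

lemma perfect_matching_supp:
  assumes H: "is_block H G" and c: "c \<in> effective_vec (Edges H)" and one: "\<And>v. v \<in> Verts H \<Longrightarrow> deg c v = 1"
  shows "perfect_matching (supp c) H"
  unfolding perfect_matching_def
proof (intro conjI ballI)
  show "supp c \<subseteq> Edges H" using c by (auto simp: effective_vec_def vec_iff_supp)
  then have sE: "supp c \<subseteq> E" using block_subset[OF H] by blast
  have nn: "c e \<ge> 0" for e using c by (simp add: effective_vec_def)
  fix v assume v: "v \<in> Verts H"
  have "\<exists>e\<in>E. c e * of_bool (v \<in> e) \<noteq> 0"
  proof (rule ccontr)
    assume "\<not> ?thesis"
    then have "deg c v = 0" unfolding deg_def by (intro sum.neutral) blast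
    then show False using one[OF v] by simp
  qed
  then obtain e where e: "e \<in> supp c" "v \<in> e" by (auto simp: supp_def)
  show "\<exists>!e. e \<in> supp c \<and> v \<in> e"
  proof (rule ex1I)
    show "e \<in> supp c \<and> v \<in> e" using e by simp
    fix f assume f: "f \<in> supp c \<and> v \<in> f"
    show "f = e"
    proof (rule ccontr)
      assume "f \<noteq> e"
      have "c e \<ge> 1" "c f \<ge> 1" using e f nn[of e] nn[of f] by (auto simp: supp_def)
      then have "2 \<le> (\<Sum>g\<in>{e, f}. c g * of_bool (v \<in> g))" using e f \<open>f \<noteq> e\<close> by simp
      also have "\<dots> \<le> deg c v"
        unfolding deg_def using e f sE nn finite_E by (intro sum_mono2) auto
      finally show False using one[OF v] by simp
    qed
  qed
qed

lemma deg_perfect_matching: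
  assumes H: "is_block H G" and M: "perfect_matching M H"
  shows "deg (\<lambda>e. of_bool (e \<in> M)) v = of_bool (v \<in> Verts H)"
proof (cases "v \<in> Verts H")
  case True
  then have "\<exists>!e. e \<in> M \<and> v \<in> e" using M unfolding perfect_matching_def by blast
  then obtain e where e: "e \<in> M" "v \<in> e" "\<And>f. f \<in> M \<Longrightarrow> v \<in> f \<Longrightarrow> f = e" by metis
  have "e \<in> E" using e(1) M block_subset[OF H] unfolding perfect_matching_def by blast
  have iff: "f \<in> M \<and> v \<in> f \<longleftrightarrow> f = e" for f using e by metis
  have "deg (\<lambda>e. of_bool (e \<in> M)) v = (\<Sum>f\<in>E. if f = e then 1 else 0)"
    unfolding deg_def by (intro sum.cong refl) (simp add: iff flip: of_bool_conj)
  then show ?thesis using True \<open>e \<in> E\<close> finite_E by simp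
next
  case False
  have s: "simple_graph H" using H by (simp add: is_block_def subgraph_def)
  have "v \<notin> e" if "e \<in> M" for e
  proof -
    have "e \<in> Edges H" using that M unfolding perfect_matching_def by blast
    then obtain x y where "x \<in> Verts H" "y \<in> Verts H" "e = {x, y}" by (metis simple_graph_edge[OF s])
    then show ?thesis using False by auto
  qed
  then have "deg (\<lambda>e. of_bool (e \<in> M)) v = 0" unfolding deg_def by (intro sum.neutral) auto
  then show ?thesis using False by simp
qed

text \<open>A change of \<open>c\<close> inside \<open>H\<close> does no harm elsewhere, because the
  part of an augmenting circulation inside \<open>H\<close> can be subtracted.\<close>

lemma interior_outside_block:
  assumes H: "is_block H G" and int: "interior c" and e: "e \<in> E" "e \<notin> Edges H"
    and eq: "\<And>f. f \<in> E \<Longrightarrow> f \<notin> Edges H \<Longrightarrow> d f = c f"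
  shows "d e > 0 \<or> (\<exists>k\<in>circ. k e > 0 \<and> (\<forall>f\<in>E. d f = 0 \<longrightarrow> k f \<ge> 0))"
proof (cases "c e > 0")
  case True
  then show ?thesis using eq e by simp
next
  case False
  then obtain k where k: "k \<in> circ" "k e > 0" "\<forall>f\<in>E. c f = 0 \<longrightarrow> k f \<ge> 0"
    using int e by (auto simp: interior_def)
  define l where "l = (\<lambda>f. k f - restr k (Edges H) f)"
  have "l \<in> circ" unfolding l_def using k(1) circ_restr_block[OF k(1) H] by (rule circ_diff)
  moreover have "l e > 0" using k e by (simp add: l_def restr_def)
  moreover have "\<forall>f\<in>E. d f = 0 \<longrightarrow> l f \<ge> 0" using k(3) eq by (simp add: l_def restr_def)
  ultimately show ?thesis by blast
qed

text \<open>Replacing \<open>c\<close> on \<open>H\<close> by a perfect matching keeps it interior,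
  so minimality bounds the degree sum of \<open>c\<close> in \<open>H\<close> by the number of
  vertices. Each degree is at least 1, hence each equals 1.\<close>

lemma deg_restr_matching_covered:
  assumes c: "min_interior c" and H: "is_block H G" and mc: "matching_covered H" and e0: "e0 \<in> Edges H"
  shows "deg (restr c (Edges H)) v = of_bool (v \<in> Verts H)"
proof -
  let ?F = "Edges H"
  have s: "simple_graph H" using H by (simp add: is_block_def subgraph_def)
  have FE: "?F \<subseteq> E" using H by (rule block_subset)
  have ce: "c \<in> effective_vec E" "interior c" using c by (auto simp: min_interior_def)
  have nn: "c e \<ge> 0" for e using ce by (simp add: effective_vec_def)
  obtain M where M: "perfect_matching M H" using mc e0 by (auto simp: matching_covered_def)
  have MF: "M \<subseteq> ?F" using M by (simp add: perfect_matching_def)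
  define d where "d = (\<lambda>e. if e \<in> ?F then of_bool (e \<in> M) else c e)"
  have "interior d"
    unfolding interior_def
  proof
    fix e assume e: "e \<in> E"
    show "d e > 0 \<or> (\<exists>k\<in>circ. k e > 0 \<and> (\<forall>f\<in>E. d f = 0 \<longrightarrow> k f \<ge> 0))"
    proof (cases "e \<in> ?F")
      case False
      then show ?thesis using interior_outside_block[OF H ce(2) e, of d] by (simp add: d_def)
    next
      case True
      then obtain N where N: "perfect_matching N H" "e \<in> N" using mc by (auto simp: matching_covered_def)
      \<comment> \<open>Two perfect matchings differ by a circulation; this one is nonnegative off
        \<open>M\<close> and positive on \<open>e\<close> unless \<open>e\<close> is in
        \<open>M\<close>.\<close>
      define k where "k = (\<lambda>e. of_bool (e \<in> N) - of_bool (e \<in> M) :: int)"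
      have NF: "N \<subseteq> ?F" using N by (simp add: perfect_matching_def)
      have "k \<in> circ" using NF MF FE
        by (auto simp: k_def circ_iff_deg vec_def deg_diff deg_perfect_matching[OF H N(1)] deg_perfect_matching[OF H M])
      moreover have "e \<in> M \<or> k e > 0" using N by (auto simp: k_def)
      moreover have "\<forall>f\<in>E. d f = 0 \<longrightarrow> k f \<ge> 0" using NF MF by (auto simp: k_def d_def)
      ultimately show ?thesis using True by (auto simp: d_def)
    qed
  qed
  moreover have "d \<in> effective_vec E" using ce FE by (auto simp: d_def effective_vec_def vec_def)
  ultimately have le: "sum c E \<le> sum d E" using c by (auto simp: min_interior_def)
  define m where "m = (\<lambda>e. of_bool (e \<in> M) :: int)"
  have "sum c E = sum (restr c ?F) E + (\<Sum>e\<in>E. if e \<in> ?F then 0 else c e)"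
    by (simp add: restr_def flip: sum.distrib) (rule sum.cong, auto)
  moreover have "sum d E = sum m E + (\<Sum>e\<in>E. if e \<in> ?F then 0 else c e)"
    unfolding m_def d_def using MF by (subst sum.distrib[symmetric]) (rule sum.cong, auto)
  ultimately have sum_le: "sum (restr c ?F) E \<le> sum m E" using le by simp
  have mF: "m \<in> vec ?F" "restr c ?F \<in> vec ?F" using MF by (auto simp: m_def vec_def restr_def)
  have deg_m: "deg m v = of_bool (v \<in> Verts H)" for v
    unfolding m_def using deg_perfect_matching[OF H M] .
  have incident: "\<exists>e\<in>?F. v \<in> e" if "v \<in> Verts H" for v
    using that M unfolding perfect_matching_def by blast
  have ge: "deg m v \<le> deg (restr c ?F) v" if "v \<in> Verts H" for v
    using that incident[OF that] deg_ge_1[OF ce H] deg_m by auto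
  have "(\<Sum>v\<in>Verts H. deg (restr c ?F) v) \<le> (\<Sum>v\<in>Verts H. deg m v)"
    using sum_le by (simp add: handshake[OF H] mF)
  then have sum_eq: "(\<Sum>v\<in>Verts H. deg m v) = (\<Sum>v\<in>Verts H. deg (restr c ?F) v)"
    using sum_mono[of "Verts H" "deg m", OF ge] by simp
  have finV: "finite (Verts H)" using s by (simp add: simple_graph_def)
  show ?thesis
  proof (cases "v \<in> Verts H")
    case True
    then show ?thesis using sum_mono_inv[OF sum_eq ge True finV] deg_m by simp
  next
    case False
    have "deg (restr c ?F) v = 0"
      unfolding deg_def
    proof (rule sum.neutral, rule ballI)
      fix e
      show "restr c ?F e * of_bool (v \<in> e) = 0"
        using False simple_graph_edge[OF s, of e] by (cases "e \<in> ?F") (auto simp: restr_def)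
    qed
    then show ?thesis using False by simp
  qed
qed

lemma min_interior_unique_if_matching_covered:
  assumes mc: "\<And>H. is_block H G \<Longrightarrow> matching_covered H" and c: "min_interior c" and d: "min_interior d"
  shows "bd c = bd d"
proof -
  have v: "c \<in> vec E" "d \<in> vec E" using c d by (auto simp: min_interior_def effective_vec_def)
  define k where "k = (\<lambda>e. c e - d e)"
  have "k \<in> circ"
  proof (rule circ_if_blocks)
    show "k \<in> vec E" using v by (auto simp: k_def vec_def)
    fix H assume H: "is_block H G"
    have eq: "restr k (Edges H) = (\<lambda>e. restr c (Edges H) e - restr d (Edges H) e)"
      by (auto simp: k_def restr_def)
    show "restr k (Edges H) \<in> circ"
    proof (cases "Edges H = {}")
      case True
      then show ?thesis using circ_zero by (simp add: restr_def[abs_def])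
    next
      case False
      then obtain e0 where e0: "e0 \<in> Edges H" by blast
      have "(\<lambda>e. restr c (Edges H) e - restr d (Edges H) e) \<in> vec E"
        using v by (auto simp: vec_def restr_def)
      then show ?thesis unfolding eq circ_iff_deg deg_diff
        using deg_restr_matching_covered[OF c H mc[OF H] e0] deg_restr_matching_covered[OF d H mc[OF H] e0]
        by simp
    qed
  qed
  then show ?thesis by (auto simp: circ_def k_def bd_diff fun_eq_iff)
qed

end

section \<open>Uniqueness of the minimal interior point\<close>

text \<open>Either orientation of the edges between the two colour classes is allowed, so that a vertex of
  either class can play the role of a tail.\<close>

locale oriented_block = simple_bipartite_network G \<alpha> \<beta> q
  for G :: "'v::linorder graph" and \<alpha> \<beta> :: "'v set \<Rightarrow> 'v" and q +
  fixes a b :: "'v set \<Rightarrow> 'v" and H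
  assumes oriented: "a = \<alpha> \<and> b = \<beta> \<or> a = \<beta> \<and> b = \<alpha>"
    and block: "is_block H G"
begin

abbreviation "F \<equiv> Edges H"

definition flow :: "('v set \<Rightarrow> int) \<Rightarrow> 'v set \<Rightarrow> int" where
  "flow c U = (\<Sum>e\<in>F. c e * (of_bool (b e \<in> U) - of_bool (a e \<in> U)))"

definition closed :: "'v set \<Rightarrow> bool" where
  "closed U \<longleftrightarrow> U \<subseteq> Verts H \<and> (\<forall>e\<in>F. a e \<in> U \<longrightarrow> b e \<in> U)"

text \<open>The residual digraph: an edge can always be increased, but decreased only where
  \<open>c\<close> is positive. Strong connectivity of this digraph expresses that \<open>c\<close>
  is interior within the block, and the \<open>closed\<close> sets are the possible
  obstructions.\<close>

definition arcs :: "('v set \<Rightarrow> int) \<Rightarrow> ('v \<times> 'v) set" where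
  "arcs c = {(x, y). \<exists>e\<in>F. a e = x \<and> b e = y \<or> c e > 0 \<and> b e = x \<and> a e = y}"

lemma F_subset: "F \<subseteq> E"
  using block by (rule block_subset)

lemma finite_F: "finite F"
  using F_subset finite_E by (rule finite_subset)

lemma simple_H: "simple_graph H"
  using block by (simp add: is_block_def subgraph_def)

lemma edge_eq: "e \<in> E \<Longrightarrow> e = {a e, b e}"
  using oriented edge_ends[of e] by (metis insert_commute)

lemma edge_in_H: "e \<in> F \<Longrightarrow> a e \<in> Verts H \<and> b e \<in> Verts H"
proof -
  assume e: "e \<in> F"
  obtain x y where xy: "x \<in> Verts H" "y \<in> Verts H" "e = {x, y}" using simple_graph_edge[OF simple_H e] by metis
  have "e = {a e, b e}" using e F_subset by (intro edge_eq) blast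
  then have "a e \<in> e" "b e \<in> e" by (metis insertI1, metis insertI1 insert_commute)
  then show ?thesis using xy by (metis insertE singletonD)
qed

lemma head_not_tail: "e \<in> E \<Longrightarrow> f \<in> E \<Longrightarrow> b e \<noteq> a f"
  using oriented ends_distinct by metis

lemma flow_eq_sum_E: "c \<in> vec F \<Longrightarrow> flow c U = (\<Sum>e\<in>E. c e * (of_bool (b e \<in> U) - of_bool (a e \<in> U)))"
  unfolding flow_def using F_subset finite_E by (intro sum.mono_neutral_left) (auto simp: vec_def)

lemma deg_eq_flow:
  assumes "c \<in> vec F"
  shows "deg c z = (if z \<in> a ` E then - flow c {z} else flow c {z})"
proof -
  have "c e * of_bool (z \<in> e) = (if z \<in> a ` E then - 1 else 1) * (c e * (of_bool (b e \<in> {z}) - of_bool (a e \<in> {z})))"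
    if e: "e \<in> E" for e
  proof -
    have m: "z \<in> e \<longleftrightarrow> a e = z \<or> b e = z" using arg_cong[OF edge_eq[OF e], of "\<lambda>x. z \<in> x"] by auto
    show ?thesis
    proof (cases "z \<in> a ` E")
      case True
      then have "b e \<noteq> z" using head_not_tail[OF e] by (metis imageE)
      then show ?thesis using True m by simp
    next
      case False
      then have "a e \<noteq> z" using e by (metis imageI)
      then show ?thesis using False m by simp
    qed
  qed
  then have "deg c z = (if z \<in> a ` E then - 1 else 1) * flow c {z}"
    unfolding deg_def flow_eq_sum_E[OF assms] sum_distrib_left by (intro sum.cong) auto
  then show ?thesis by simp
qed

lemma flow_add: "flow (\<lambda>e. c e + d e) U = flow c U + flow d U"
  by (simp add: flow_def distrib_right sum.distrib)

lemma flow_cong: "(\<And>e. e \<in> F \<Longrightarrow> c e = d e) \<Longrightarrow> flow c U = flow d U"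
  unfolding flow_def by (rule sum.cong) auto

lemma flow_circ:
  assumes "k \<in> circ"
  shows "flow k U = 0"
proof -
  let ?r = "restr k F"
  have r: "?r \<in> circ" using circ_restr_block[OF assms block] .
  have "flow k U = flow ?r U" by (rule flow_cong) (simp add: restr_def)
  also have "\<dots> = (\<Sum>e\<in>E. ?r e * (of_bool (b e \<in> U) - of_bool (a e \<in> U)))"
    by (rule flow_eq_sum_E) (simp add: vec_def restr_def)
  also have "\<dots> = (if a = \<alpha> then - 1 else 1) * (\<Sum>e\<in>E. ?r e * cut U e)"
    unfolding sum_distrib_left using oriented by (intro sum.cong) (auto simp: cut_def)
  also have "(\<Sum>e\<in>E. ?r e * cut U e) = 0" using r by (simp add: sum_cut circ_def)
  finally show ?thesis by simp
qed

lemma circ_if_flow_zero: "k \<in> vec F \<Longrightarrow> (\<And>z. flow k {z} = 0) \<Longrightarrow> k \<in> circ"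
  using deg_eq_flow[of k] F_subset by (auto simp: circ_iff_deg intro: vec_mono)

lemma flow_modular: "flow c U + flow c W = flow c (U \<union> W) + flow c (U \<inter> W)"
  unfolding flow_def sum.distrib[symmetric] by (rule sum.cong) (auto simp: algebra_simps of_bool_def)

lemma flow_closed: "closed U \<Longrightarrow> flow c U = (\<Sum>e\<in>F. c e * of_bool (b e \<in> U \<and> a e \<notin> U))"
  unfolding flow_def closed_def by (intro sum.cong) auto

lemma connected_H: "connected_graph H"
  using block by (simp add: is_block_def two_connected_def)

lemma crossing_edge:
  assumes "closed U" "U \<noteq> {}" "U \<noteq> Verts H"
  obtains e where "e \<in> F" "b e \<in> U" "a e \<notin> U"
proof -
  obtain u w where "u \<in> U" "u \<in> Verts H" "w \<in> Verts H" "w \<notin> U"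
    using assms by (auto simp: closed_def)
  then obtain x y where xy: "{x, y} \<in> F" "x \<in> U" "y \<notin> U"
    using connected_crossing_edge[OF connected_H] by metis
  define e where "e = {x, y}"
  have "e \<in> F" using xy by (simp add: e_def)
  then have "{x, y} = {a e, b e}" using edge_eq[of e] F_subset by (auto simp: e_def)
  then have "a e = x \<and> b e = y \<or> a e = y \<and> b e = x" by (auto simp: doubleton_eq_iff)
  moreover have "a e \<in> U \<longrightarrow> b e \<in> U" using assms(1) \<open>e \<in> F\<close> by (simp add: closed_def)
  ultimately show thesis using that \<open>e \<in> F\<close> xy by blast
qed

text \<open>All edges crossing a closed set enter it. If \<open>c\<close> vanished on all of them, a
  circulation augmenting one would be nonnegative on the others, yet its net flow into the set is
  zero.\<close>

lemma interior_flow_pos: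
  assumes c: "c \<in> effective_vec E" "interior c" and U: "closed U" "U \<noteq> {}" "U \<noteq> Verts H"
  shows "flow c U \<ge> 1"
proof -
  have nn: "c e \<ge> 0" for e using c by (simp add: effective_vec_def)
  obtain e where e: "e \<in> F" "b e \<in> U" "a e \<notin> U" using crossing_edge[OF U] .
  have "\<exists>f\<in>F. b f \<in> U \<and> a f \<notin> U \<and> c f > 0"
  proof (rule ccontr)
    assume "\<not> ?thesis"
    then have z: "c f = 0" if "f \<in> F" "b f \<in> U" "a f \<notin> U" for f using nn[of f] that by force
    then have "\<not> c e > 0" using e by simp
    then obtain k where k: "k \<in> circ" "k e > 0" "\<And>f. f \<in> E \<Longrightarrow> c f = 0 \<Longrightarrow> k f \<ge> 0"
      using c(2) e F_subset unfolding interior_def by (metis subsetD)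
    have "k e * of_bool (b e \<in> U \<and> a e \<notin> U) \<le> (\<Sum>f\<in>F. k f * of_bool (b f \<in> U \<and> a f \<notin> U))"
      using e z k(3) F_subset finite_F by (intro member_le_sum) auto
    also have "\<dots> = 0" using flow_circ[OF k(1)] flow_closed[OF U(1)] by metis
    finally show False using e k(2) by simp
  qed
  then obtain f where f: "f \<in> F" "b f \<in> U" "a f \<notin> U" "c f > 0" by blast
  have "c f * of_bool (b f \<in> U \<and> a f \<notin> U) \<le> flow c U"
    unfolding flow_closed[OF U(1)] using f nn finite_F by (intro member_le_sum) auto
  then show ?thesis using f by simp
qed

text \<open>The set reachable from \<open>x\<close> is closed and no edge with positive entry enters
  it, so its flow is 0; the hypothesis leaves only the full vertex set.\<close>

lemma all_reachable:
  assumes nn: "\<And>e. e \<in> F \<Longrightarrow> c e \<ge> 0"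
    and pos: "\<And>U. closed U \<Longrightarrow> U \<noteq> {} \<Longrightarrow> U \<noteq> Verts H \<Longrightarrow> flow c U \<ge> 1"
    and x: "x \<in> Verts H" and y: "y \<in> Verts H"
  shows "(x, y) \<in> (arcs c)\<^sup>*"
proof -
  define U where "U = {z \<in> Verts H. (x, z) \<in> (arcs c)\<^sup>*}"
  have step: "w \<in> U" if "z \<in> U" "(z, w) \<in> arcs c" for z w
  proof -
    have "w \<in> Verts H" using that(2) edge_in_H by (auto simp: arcs_def)
    then show ?thesis using that by (auto simp: U_def intro: rtrancl_into_rtrancl)
  qed
  have cl: "closed U" unfolding closed_def
  proof (intro conjI ballI impI)
    fix e assume e: "e \<in> F" "a e \<in> U"
    then have "(a e, b e) \<in> arcs c" by (auto simp: arcs_def)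
    then show "b e \<in> U" using step e by blast
  qed (auto simp: U_def)
  have "c e * of_bool (b e \<in> U \<and> a e \<notin> U) = 0" if e: "e \<in> F" for e
  proof (cases "c e > 0 \<and> b e \<in> U")
    case True
    then have "(b e, a e) \<in> arcs c" using e by (auto simp: arcs_def)
    then show ?thesis using step True by auto
  qed (use nn[OF e] in auto)
  then have "flow c U = 0" unfolding flow_closed[OF cl] by (intro sum.neutral) blast
  moreover have "x \<in> U" using x by (simp add: U_def)
  ultimately have "U = Verts H" using pos[OF cl] by fastforce
  then show ?thesis using y by (auto simp: U_def)
qed

text \<open>A shortest path gives a vector with entries in \<open>{-1, 0, 1}\<close>: its first arc leaves the vertices
  that are closer to the end.\<close>

lemma path_vector:
  assumes "(x, y) \<in> (arcs c)\<^sup>*"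
  obtains k where "k \<in> vec F" "ternary k" "\<And>e. k e < 0 \<Longrightarrow> c e > 0"
    "\<And>U. flow k U = of_bool (y \<in> U) - of_bool (x \<in> U)"
proof -
  define near where "near n = {z. \<exists>m\<le>n. (z, y) \<in> arcs c ^^ m}" for n
  have claim: "\<exists>k. k \<in> vec F \<and> ternary k \<and> (\<forall>e. k e < 0 \<longrightarrow> c e > 0) \<and>
      (\<forall>U. flow k U = of_bool (y \<in> U) - of_bool (x \<in> U)) \<and> (\<forall>e. k e \<noteq> 0 \<longrightarrow> a e \<in> near n \<and> b e \<in> near n)"
    if "(x, y) \<in> arcs c ^^ n" "\<forall>m<n. (x, y) \<notin> arcs c ^^ m" for n x
    using that
  proof (induction n arbitrary: x)
    case 0
    then show ?case by (intro exI[of _ "\<lambda>_. 0"]) (auto simp: vec_def ternary_def flow_def)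
  next
    case (Suc n)
    then obtain w where w: "(x, w) \<in> arcs c" "(w, y) \<in> arcs c ^^ n" using relpow_Suc_D2 by metis
    have "\<forall>m<n. (w, y) \<notin> arcs c ^^ m"
    proof (intro allI impI notI)
      fix m assume "m < n" "(w, y) \<in> arcs c ^^ m"
      then have "(x, y) \<in> arcs c ^^ Suc m" using relpow_Suc_I2[OF w(1)] by blast
      then show False using Suc.prems(2) \<open>m < n\<close> by (metis Suc_less_eq)
    qed
    with Suc.IH[OF w(2)] obtain k where k: "k \<in> vec F" "ternary k" "\<forall>e. k e < 0 \<longrightarrow> c e > 0"
      "\<forall>U. flow k U = of_bool (y \<in> U) - of_bool (w \<in> U)"
      "\<forall>e. k e \<noteq> 0 \<longrightarrow> a e \<in> near n \<and> b e \<in> near n" by metis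
    obtain e where e: "e \<in> F" "a e = x \<and> b e = w \<or> c e > 0 \<and> b e = x \<and> a e = w"
      using w(1) by (auto simp: arcs_def)
    define s :: int where "s = (if a e = x \<and> b e = w then 1 else - 1)"
    have xn: "x \<notin> near n" using Suc.prems(2) by (auto simp: near_def less_Suc_eq_le)
    then have ke: "k e = 0" using k(5) e(2) by metis
    define l where "l = (\<lambda>f. k f + (if f = e then s else 0))"
    have "near n \<subseteq> near (Suc n)" by (auto simp: near_def intro: le_SucI)
    moreover have "x \<in> near (Suc n)" "w \<in> near (Suc n)"
      unfolding near_def mem_Collect_eq using Suc.prems(1) w(2) by (blast, metis le_SucI order_refl)
    ultimately have "\<forall>f. l f \<noteq> 0 \<longrightarrow> a f \<in> near (Suc n) \<and> b f \<in> near (Suc n)"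
      using k(5) e(2) by (auto simp: l_def)
    moreover have "l \<in> vec F" using k(1) e(1) by (auto simp: l_def vec_def)
    moreover have "ternary l" using k(2) ke by (auto simp: l_def ternary_def s_def)
    moreover have "\<forall>f. l f < 0 \<longrightarrow> c f > 0" using k(3) ke e(2) by (auto simp: l_def s_def split: if_splits)
    moreover have "flow l U = of_bool (y \<in> U) - of_bool (x \<in> U)" for U
    proof -
      have "flow (\<lambda>f. if f = e then s else 0) U = (\<Sum>f\<in>F. if f = e then s * (of_bool (b e \<in> U) - of_bool (a e \<in> U)) else 0)"
        unfolding flow_def by (rule sum.cong) auto
      also have "\<dots> = of_bool (w \<in> U) - of_bool (x \<in> U)"
        using e finite_F by (auto simp: s_def)
      finally show ?thesis using k(4) by (simp add: l_def flow_add)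
    qed
    ultimately show ?case by blast
  qed
  have "\<exists>n. (x, y) \<in> arcs c ^^ n" using assms by (rule rtrancl_imp_relpow)
  then obtain n where "(x, y) \<in> arcs c ^^ n" "\<forall>m<n. (x, y) \<notin> arcs c ^^ m"
    using exists_least_iff[of "\<lambda>n. (x, y) \<in> arcs c ^^ n"] by blast
  from claim[OF this] that show thesis by blast
qed

text \<open>An edge \<open>e\<close> of the block is completed to a circulation by a residual path
  from \<open>b e\<close> to \<open>a e\<close>. The path may run through \<open>e\<close> itself
  and cancel it, but only when \<open>d e\<close> is already positive.\<close>

lemma interior_if_flow_pos:
  assumes c: "c \<in> effective_vec E" "interior c" and d: "d \<in> effective_vec E"
    and eq: "\<And>e. e \<notin> F \<Longrightarrow> d e = c e"
    and pos: "\<And>U. closed U \<Longrightarrow> U \<noteq> {} \<Longrightarrow> U \<noteq> Verts H \<Longrightarrow> flow d U \<ge> 1"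
  shows "interior d"
  unfolding interior_def
proof
  fix e assume e: "e \<in> E"
  show "d e > 0 \<or> (\<exists>k\<in>circ. k e > 0 \<and> (\<forall>f\<in>E. d f = 0 \<longrightarrow> k f \<ge> 0))"
  proof (cases "e \<in> F")
    case False
    then show ?thesis using interior_outside_block[OF block c(2) e] eq by metis
  next
    case True
    have nn: "d f \<ge> 0" for f using d by (simp add: effective_vec_def)
    have "(b e, a e) \<in> (arcs d)\<^sup>*"
      using edge_in_H[OF True] by (intro all_reachable nn pos) auto
    then obtain k where k: "k \<in> vec F" "ternary k" "\<And>f. k f < 0 \<Longrightarrow> d f > 0"
      "\<And>U. flow k U = of_bool (a e \<in> U) - of_bool (b e \<in> U)" using path_vector by metis
    define l where "l = (\<lambda>f. k f + single_edge e f)"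
    have lv: "l \<in> vec F" using k(1) True by (auto simp: l_def vec_def single_edge_def)
    have "flow (single_edge e) U = of_bool (b e \<in> U) - of_bool (a e \<in> U)" for U
    proof -
      have "flow (single_edge e) U = (\<Sum>f\<in>F. if f = e then of_bool (b e \<in> U) - of_bool (a e \<in> U) else 0)"
        unfolding flow_def by (rule sum.cong) (auto simp: single_edge_def)
      then show ?thesis using True finite_F by simp
    qed
    then have "flow l U = 0" for U using k(4) by (simp add: l_def flow_add)
    then have "l \<in> circ" using circ_if_flow_zero[OF lv] by blast
    moreover have "d e > 0 \<or> l e > 0" using k(3)[of e] by (auto simp: l_def single_edge_def not_less)
    moreover have "\<forall>f\<in>E. d f = 0 \<longrightarrow> l f \<ge> 0"
    proof (intro ballI impI)
      fix f assume "d f = 0"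
      then have "\<not> k f < 0" using k(3)[of f] by auto
      then show "l f \<ge> 0" by (simp add: l_def single_edge_def)
    qed
    ultimately show ?thesis by blast
  qed
qed

text \<open>If \<open>v\<close> had degree at least 2, moving one unit from \<open>v\<close> to another vertex \<open>v'\<close> of its colour
  class would give a second minimal interior point, unless a closed set of flow 1 separates \<open>v'\<close> from \<open>v\<close>.
  Flow is modular, so a maximal closed set of flow 1 avoiding \<open>v\<close> is everything but \<open>v\<close>, by
  2-connectivity; but that set has flow equal to the degree of \<open>v\<close>.\<close>

lemma tight_set_exists:
  assumes c: "min_interior c" and uniq: "\<And>d. min_interior d \<Longrightarrow> bd d = bd c"
    and v: "v \<in> Verts H" "v \<in> a ` F" and w: "w \<in> Verts H" "w \<in> a ` F" "w \<noteq> v"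
  obtains U where "closed U" "w \<in> U" "v \<notin> U" "flow c U = 1"
proof -
  have ce: "c \<in> effective_vec E" "interior c" using c by (auto simp: min_interior_def)
  have nn: "c e \<ge> 0" for e using ce by (simp add: effective_vec_def)
  have "(w, v) \<in> (arcs c)\<^sup>*"
    using v w nn interior_flow_pos[OF ce] by (intro all_reachable) auto
  then obtain k where k: "k \<in> vec F" "ternary k" "\<And>f. k f < 0 \<Longrightarrow> c f > 0"
    "\<And>U. flow k U = of_bool (v \<in> U) - of_bool (w \<in> U)" using path_vector by metis
  define d where "d = (\<lambda>e. c e + k e)"
  have "d e \<ge> 0" for e
    using nn[of e] k(3)[of e] ternary_nonzero_cases[OF k(2), of e] by (auto simp: d_def)
  then have d: "d \<in> effective_vec E"
    using ce k(1) F_subset by (auto simp: d_def effective_vec_def vec_def)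
  \<comment> \<open>The total of \<open>k\<close> is minus its net flow into the tail class, where
    the contributions of \<open>v\<close> and \<open>w\<close> cancel.\<close>
  have sd: "sum d E = sum c E"
  proof -
    have "sum k E = sum k F"
      using k(1) F_subset finite_E by (intro sum.mono_neutral_right) (auto simp: vec_def)
    also have "\<dots> = - flow k (a ` F)"
    proof -
      have "b e \<notin> a ` F" if "e \<in> F" for e using that head_not_tail[of e] F_subset by blast
      then show ?thesis unfolding flow_def sum_negf[symmetric] by (intro sum.cong) auto
    qed
    also have "\<dots> = 0" using k(4) v w by simp
    finally show ?thesis by (simp add: d_def sum.distrib)
  qed
  have "\<not> interior d"
  proof
    assume "interior d"
    then have "min_interior d" using c d sd by (simp add: min_interior_def)
    then have "deg d v = deg c v" using uniq bd_eq_iff_deg by metis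
    then have "deg k v = 0" by (simp add: d_def deg_add)
    moreover have "v \<in> a ` E" using v F_subset by blast
    ultimately have "flow k {v} = 0" using deg_eq_flow[OF k(1)] by simp
    then show False using k(4)[of "{v}"] w by simp
  qed
  moreover have "d e = c e" if "e \<notin> F" for e using that k(1) by (simp add: d_def vec_def)
  ultimately obtain U where U: "closed U" "U \<noteq> {}" "U \<noteq> Verts H" "\<not> flow d U \<ge> 1"
    using interior_if_flow_pos[OF ce d] by metis
  have "flow c U \<ge> 1" using interior_flow_pos[OF ce U(1-3)] .
  moreover have "flow d U = flow c U + (of_bool (v \<in> U) - of_bool (w \<in> U))"
    using k(4) by (simp add: d_def flow_add)
  ultimately have "w \<in> U" "v \<notin> U" "flow c U = 1" using U(4) by (auto simp: of_bool_def split: if_splits)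
  then show thesis using that U(1) by blast
qed

lemma deg_le_1:
  assumes c: "min_interior c" and uniq: "\<And>d. min_interior d \<Longrightarrow> bd d = bd c"
    and le1: "\<And>e. c e \<le> 1" and v: "v \<in> Verts H" "v \<in> a ` F"
  shows "deg (restr c F) v \<le> 1"
proof (rule ccontr)
  assume "\<not> ?thesis"
  then have deg2: "deg (restr c F) v \<ge> 2" by simp
  have ce: "c \<in> effective_vec E" "interior c" using c by (auto simp: min_interior_def)
  have nn: "c e \<ge> 0" for e using ce by (simp add: effective_vec_def)
  let ?K = "delete_vertex v H"
  have conn: "connected_graph ?K" using block v by (auto simp: is_block_def two_connected_def)
  have vK: "Verts ?K = Verts H - {v}" by (simp add: delete_vertex_def)
  have vaE: "v \<in> a ` E" using v F_subset by blast
  have bv: "b e \<noteq> v" if "e \<in> F" for e using that vaE head_not_tail F_subset by blast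
  have degv: "deg (restr c F) v = - flow c {v}"
  proof -
    have "restr c F \<in> vec F" by (simp add: vec_def restr_def)
    then have "deg (restr c F) v = - flow (restr c F) {v}" using deg_eq_flow vaE by simp
    also have "flow (restr c F) {v} = flow c {v}" by (rule flow_cong) (simp add: restr_def)
    finally show ?thesis .
  qed
  have fv: "- flow c {v} = (\<Sum>e\<in>{e \<in> F. a e = v}. c e)"
  proof -
    have "- flow c {v} = (\<Sum>e\<in>F. if a e = v then c e else 0)"
      unfolding flow_def sum_negf[symmetric] using bv by (intro sum.cong) auto
    then show ?thesis using finite_F by (simp add: sum.If_cases Int_def)
  qed
  \<comment> \<open>Here 2-connectivity enters: the block stays connected without \<open>v\<close>,
    so a set separating two other vertices is crossed by an edge avoiding \<open>v\<close>.\<close>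
  have crossK: "\<exists>e\<in>F. a e \<noteq> v \<and> (b e \<in> U \<and> a e \<notin> U \<or> a e \<in> U \<and> b e \<notin> U)"
    if U: "u \<in> U" "u \<in> Verts H" "u \<noteq> v" "w \<in> Verts H" "w \<noteq> v" "w \<notin> U" for u w U
  proof -
    obtain x y where xy: "{x, y} \<in> Edges ?K" "x \<in> U" "y \<notin> U"
      using connected_crossing_edge[OF conn, of u U w] U vK by auto
    define e where "e = {x, y}"
    have e: "e \<in> F" "v \<notin> e" using xy by (auto simp: e_def delete_vertex_def)
    then have ee: "e = {a e, b e}" using edge_eq F_subset by blast
    then have "{x, y} = {a e, b e}" by (simp add: e_def)
    then have "a e = x \<and> b e = y \<or> a e = y \<and> b e = x" by (auto simp: doubleton_eq_iff)
    moreover have "a e \<noteq> v" using e(2) ee by (metis insertI1)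
    ultimately show ?thesis using e(1) xy by blast
  qed
  have tight: "\<exists>U. closed U \<and> w \<in> U \<and> v \<notin> U \<and> flow c U = 1" if "e \<in> F" "a e = w" "w \<noteq> v" for e w
    using tight_set_exists[OF c uniq v, of w] that edge_in_H[of e] by blast
  define T where "T U \<longleftrightarrow> closed U \<and> U \<noteq> {} \<and> v \<notin> U \<and> flow c U = 1" for U
  have "\<exists>U. T U"
  proof -
    \<comment> \<open>Degree at least 2 with entries at most 1 requires two edges at
      \<open>v\<close>. Connecting their other ends without \<open>v\<close> yields an edge whose
      tail is a second vertex of the tail class, to which \<open>tight_set_exists\<close>
      applies.\<close>
    have "\<exists>e f. e \<in> F \<and> f \<in> F \<and> a e = v \<and> a f = v \<and> e \<noteq> f"
    proof (rule ccontr)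
      assume no: "\<not> ?thesis"
      obtain e where e: "e \<in> F" "a e = v" using v by blast
      then have "{e \<in> F. a e = v} = {e}" using no by blast
      then have "- flow c {v} = c e" using fv by simp
      then show False using deg2 degv le1[of e] by simp
    qed
    then obtain e f where ef: "e \<in> F" "f \<in> F" "a e = v" "a f = v" "e \<noteq> f" by blast
    have ne: "b e \<noteq> b f"
    proof
      assume "b e = b f"
      have "e = {a e, b e}" "f = {a f, b f}" using ef edge_eq F_subset by blast+
      then show False using \<open>b e = b f\<close> ef by simp
    qed
    have "\<exists>g\<in>F. a g \<noteq> v \<and> (b g \<in> {b e} \<and> a g \<notin> {b e} \<or> a g \<in> {b e} \<and> b g \<notin> {b e})"
      using ne ef bv edge_in_H by (intro crossK[of "b e" _ "b f"]) auto
    then obtain g where "g \<in> F" "a g \<noteq> v" by blast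
    then show ?thesis using tight[of g "a g"] unfolding T_def by blast
  qed
  moreover have "\<forall>U. T U \<longrightarrow> card U < Suc (card (Verts H))"
    using simple_H by (auto simp: T_def closed_def simple_graph_def less_Suc_eq_le intro: card_mono)
  ultimately obtain Y where Y: "T Y" and max: "\<And>U. T U \<Longrightarrow> card U \<le> card Y"
    using ex_has_greatest_nat[of T _ card "Suc (card (Verts H))"] by metis
  show False
  proof (cases "Y = Verts H - {v}")
    case True
    have "flow c Y = - flow c {v}"
      unfolding flow_def sum_negf[symmetric] using bv edge_in_H True by (intro sum.cong) auto
    then show False using Y deg2 degv by (simp add: T_def)
  next
    case False
    have YV: "closed Y" "Y \<subseteq> Verts H" "v \<notin> Y" "Y \<noteq> {}" "flow c Y = 1" using Y by (auto simp: T_def closed_def)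
    obtain u w where uw: "u \<in> Y" "u \<in> Verts H" "u \<noteq> v" "w \<in> Verts H" "w \<noteq> v" "w \<notin> Y"
      using YV False by blast
    then obtain e where e: "e \<in> F" "a e \<noteq> v" "b e \<in> Y \<and> a e \<notin> Y \<or> a e \<in> Y \<and> b e \<notin> Y"
      using crossK[OF uw] by blast
    \<comment> \<open>Closedness of \<open>Y\<close> leaves only an edge entering \<open>Y\<close>;
      a tight set around its tail will enlarge \<open>Y\<close>.\<close>
    then have be: "b e \<in> Y" "a e \<notin> Y" using YV(1) by (auto simp: closed_def)
    obtain U where U: "closed U" "a e \<in> U" "v \<notin> U" "flow c U = 1" using tight[OF e(1) refl e(2)] by blast
    have "b e \<in> U" using U e by (auto simp: closed_def)
    have cl: "closed (U \<union> Y)" "closed (U \<inter> Y)" using U YV by (auto simp: closed_def)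
    \<comment> \<open>Uncrossing: union and intersection are proper because they miss
      \<open>v\<close>, and nonempty because the intersection contains \<open>b e\<close>. Both
      flows are at least 1 and by modularity they add up to 2.\<close>
    have "flow c (U \<union> Y) \<ge> 1"
      using U v by (intro interior_flow_pos[OF ce cl(1)]) (use YV in auto)
    moreover have "flow c (U \<inter> Y) \<ge> 1"
      using \<open>b e \<in> U\<close> be v U by (intro interior_flow_pos[OF ce cl(2)]) auto
    ultimately have "flow c (U \<union> Y) = 1" using flow_modular[of c U Y] U YV by simp
    then have "T (U \<union> Y)" using cl U YV by (auto simp: T_def)
    then have "card (U \<union> Y) \<le> card Y" by (rule max)
    moreover have "finite (U \<union> Y)"
      using cl(1) simple_H by (auto simp: closed_def simple_graph_def intro: finite_subset)
    then have "card Y < card (U \<union> Y)" using U be by (intro psubset_card_mono) auto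
    ultimately show False by simp
  qed
qed

end

section \<open>Perfect matchings from a unique least interior point\<close>

context simple_bipartite_network
begin

text \<open>Lowering an entry that is at least 2 preserves the set of zero edges, hence interiority,
  and lowers the degree.\<close>

lemma min_interior_le_1:
  assumes c: "min_interior c"
  shows "c e \<le> 1"
proof (rule ccontr)
  assume "\<not> ?thesis"
  then have e2: "c e \<ge> 2" by simp
  have ce: "c \<in> effective_vec E" "interior c" using c by (auto simp: min_interior_def)
  then have eE: "e \<in> E" using e2 by (auto simp: effective_vec_def vec_def)
  define d where "d = (\<lambda>f. c f - single_edge e f)"
  have d: "d \<in> effective_vec E" using ce e2 eE by (auto simp: d_def effective_vec_def vec_def single_edge_def)
  have "d f > 0 \<longleftrightarrow> c f > 0" "d f = 0 \<longleftrightarrow> c f = 0" for f using e2 by (auto simp: d_def single_edge_def)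
  then have "interior d" using ce(2) by (simp add: interior_def)
  then have "sum c E \<le> sum d E" using c d by (simp add: min_interior_def)
  also have "sum d E = sum c E - 1" using sum_single_edge[OF eE] by (simp add: d_def sum_subtractf)
  finally show False by simp
qed

text \<open>With all degrees inside \<open>H\<close> equal to 1, \<open>c\<close> restricts to a
  perfect matching of \<open>H\<close>. Augmenting it along a ternary circulation through
  \<open>e\<close> keeps the degrees and yields a perfect matching that contains
  \<open>e\<close>.\<close>

lemma matching_covered_if_min_interior_unique:
  assumes c: "min_interior c" and uniq: "\<And>d. min_interior d \<Longrightarrow> bd d = bd c" and H: "is_block H G"
  shows "matching_covered H"
  unfolding matching_covered_def
proof (intro conjI ballI)
  show conn: "connected_graph H" using H by (simp add: is_block_def two_connected_def)
  let ?F = "Edges H"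
  fix e assume e: "e \<in> ?F"
  have s: "simple_graph H" using H by (simp add: is_block_def subgraph_def)
  have FE: "?F \<subseteq> E" using H by (rule block_subset)
  have ce: "c \<in> effective_vec E" "interior c" using c by (auto simp: min_interior_def)
  have nn: "c f \<ge> 0" for f using ce by (simp add: effective_vec_def)
  have incident: "\<exists>f\<in>?F. v \<in> f" if v: "v \<in> Verts H" for v
  proof -
    obtain x y where xy: "x \<in> Verts H" "y \<in> Verts H" "x \<noteq> y" "e = {x, y}" using simple_graph_edge[OF s e] .
    then obtain w where "w \<in> Verts H" "w \<noteq> v" by metis
    then obtain x' y' where "{x', y'} \<in> ?F" "x' \<in> {v}"
      using connected_crossing_edge[OF conn v, of "{v}" w] by blast
    then show ?thesis by blast
  qed
  have one: "deg (restr c ?F) v = 1" if v: "v \<in> Verts H" for v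
  proof -
    obtain f where f: "f \<in> ?F" "v \<in> f" using incident[OF v] by blast
    have ge: "deg (restr c ?F) v \<ge> 1" using deg_ge_1[OF ce H f] .
    \<comment> \<open>\<open>deg_le_1\<close> speaks of tails, so each colour class is handled with
      the orientation that makes it the tail class.\<close>
    have "v = \<alpha> f \<or> v = \<beta> f" using f mem_edge[of f v] FE by blast
    then have "deg (restr c ?F) v \<le> 1"
    proof
      assume "v = \<alpha> f"
      interpret oriented_block G \<alpha> \<beta> q \<alpha> \<beta> H by unfold_locales (simp_all add: H)
      show ?thesis using \<open>v = \<alpha> f\<close> f v by (intro deg_le_1[OF c uniq min_interior_le_1[OF c]]) auto
    next
      assume "v = \<beta> f"
      interpret oriented_block G \<alpha> \<beta> q \<beta> \<alpha> H by unfold_locales (simp_all add: H)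
      show ?thesis using \<open>v = \<beta> f\<close> f v by (intro deg_le_1[OF c uniq min_interior_le_1[OF c]]) auto
    qed
    then show ?thesis using ge by simp
  qed
  \<comment> \<open>A conformal ternary circulation lowers only positive entries of
    \<open>c\<close>, and each by 1, so nothing becomes negative.\<close>
  have "\<exists>k\<in>circ. restr c ?F e + k e > 0 \<and> k \<in> vec ?F \<and> (\<forall>f. restr c ?F f + k f \<ge> 0)"
  proof (cases "c e > 0")
    case True
    then show ?thesis using nn e by (intro bexI[of _ "\<lambda>_. 0"] circ_zero) (auto simp: restr_def vec_def)
  next
    case False
    then obtain k where k: "k \<in> circ" "k e > 0" "\<And>f. f \<in> E \<Longrightarrow> c f = 0 \<Longrightarrow> k f \<ge> 0"
      using ce(2) e FE unfolding interior_def by (metis subsetD)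
    have "restr k ?F \<in> circ" "restr k ?F e > 0"
      using circ_restr_block[OF k(1) H] k(2) e by (auto simp: restr_def)
    then obtain l where l: "l \<in> circ" "ternary l" "l e = 1"
      "\<And>f. l f = 1 \<Longrightarrow> restr k ?F f > 0" "\<And>f. l f = -1 \<Longrightarrow> restr k ?F f < 0"
      using conformal_ternary_through by metis
    have "l f = 0" if "f \<notin> ?F" for f
      using l(4,5)[of f] ternary_nonzero_cases[OF l(2), of f] that by (auto simp: restr_def)
    then have lv: "l \<in> vec ?F" by (simp add: vec_def)
    have "restr c ?F f + l f \<ge> 0" for f
    proof (cases "l f = -1")
      case True
      then have "f \<in> ?F" "k f < 0" using l(5)[OF True] by (auto simp: restr_def split: if_splits)
      then have "c f \<noteq> 0" using k(3)[of f] FE by force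
      then show ?thesis using True \<open>f \<in> ?F\<close> nn[of f] by (simp add: restr_def)
    next
      case False
      then have "l f \<ge> 0" using ternary_nonzero_cases[OF l(2), of f] by auto
      then show ?thesis using nn[of f] by (simp add: restr_def)
    qed
    then show ?thesis using l(1,3) lv nn[of e] by (intro bexI[of _ l]) (auto simp: restr_def add_nonneg_pos)
  qed
  then obtain k where k: "k \<in> circ" "restr c ?F e + k e > 0" "k \<in> vec ?F" "\<And>f. restr c ?F f + k f \<ge> 0" by blast
  define d where "d = (\<lambda>f. restr c ?F f + k f)"
  have "d \<in> effective_vec ?F" using k by (auto simp: d_def effective_vec_def vec_def restr_def)
  moreover have "deg d v = 1" if "v \<in> Verts H" for v
    using one[OF that] k(1) by (simp add: d_def deg_add circ_iff_deg)
  ultimately have "perfect_matching (supp d) H" by (rule perfect_matching_supp[OF H])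
  moreover have "e \<in> supp d" using k(2) by (simp add: d_def supp_def)
  ultimately show "\<exists>M. perfect_matching M H \<and> e \<in> M" by blast
qed

end

theorem theorem1p1:
  fixes G :: "nat graph" and d :: nat
  assumes "simple_graph G" and "Verts G = {1..d}" and "bipartite G"
  shows "pseudo_Gorenstein
           (mpoly_scale :: 'k::{alg_closed_field, field_char_0} \<Rightarrow> (nat, 'k) mpoly \<Rightarrow> (nat, 'k) mpoly)
           (edge_ring G) (edge_ring_component G)
         \<longleftrightarrow> (\<forall>B. is_block B G \<longrightarrow> matching_covered B)"
proof -
  obtain A B where AB: "A \<inter> B = {}" and edges: "\<forall>e\<in>Edges G. \<exists>a\<in>A. \<exists>b\<in>B. e = {a, b}"
    using assms(3) unfolding bipartite_def by (elim exE conjE)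
  from bchoice[OF edges[unfolded Bex_def]] obtain \<alpha>
    where \<alpha>: "\<forall>e\<in>Edges G. \<alpha> e \<in> A \<and> (\<exists>b. b \<in> B \<and> e = {\<alpha> e, b})" ..
  then have "\<forall>e\<in>Edges G. \<exists>b. b \<in> B \<and> e = {\<alpha> e, b}" unfolding ball_conj_distrib by (rule conjunct2)
  from bchoice[OF this] obtain \<beta> where \<beta>: "\<forall>e\<in>Edges G. \<beta> e \<in> B \<and> e = {\<alpha> e, \<beta> e}" ..
  have fin: "finite (Edges G)" using assms(1) by (rule finite_Edges)
  obtain q :: "nat set \<Rightarrow> int" where q: "\<And>e. q e > 0"
    "\<And>\<phi>. (\<And>e. \<phi> e \<in> {-1, 0, 1}) \<Longrightarrow> \<exists>e\<in>Edges G. \<phi> e \<noteq> 0 \<Longrightarrow> (\<Sum>e\<in>Edges G. q e * \<phi> e) \<noteq> 0"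
    using signed_powers_of_two_nonzero[OF fin] by blast
  interpret simple_bipartite_network G \<alpha> \<beta> q
  proof unfold_locales
    show "\<alpha> ` Edges G \<inter> \<beta> ` Edges G = {}"
    proof -
      have "\<alpha> ` Edges G \<subseteq> A" "\<beta> ` Edges G \<subseteq> B" using \<alpha> \<beta> by (simp_all add: image_subset_iff)
      then show ?thesis using AB by blast
    qed
    show "e = {\<alpha> e, \<beta> e}" if "e \<in> Edges G" for e using \<beta> that by blast
  qed (use fin q assms(1) in auto)
  obtain c where c: "min_interior c" using min_interior_exists by blast
  show ?thesis
    unfolding pseudo_Gorenstein_iff_lead_coeff lead_coeff_h_numerator_eq_1_iff
    using c matching_covered_if_min_interior_unique[OF c] min_interior_unique_if_matching_covered by metis
qed

end
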